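(* Let $n\ge2$, $d=n-1$, $\boldsymbol\mu\in\mathbb C^{d+1}$ with $\sum_l\mu_l=0$, $\boldsymbol m\in\mathbb Z^{d+1}$, and define $\nu_l=\mu_l-\mu_{d+1}$, $k_l=m_l-m_{d+1}$ ($l=1,\dots,d$). Suppose $\boldsymbol\nu\in\bigcup_{a\in[-\frac12,0]}\{\boldsymbol\nu\in\mathbb C^d:-\frac12<2\operatorname{Re}\nu_l+a<0\text{ for all }l\}$. (1) The integral $J_{\boldsymbol\nu,\boldsymbol k}(x,e^{i\phi})=2^d\int_{\mathbb R_+^d}p_{2\boldsymbol\nu}(\boldsymbol y)J_{\boldsymbol k}(\boldsymbol y;x,\phi)\,d\boldsymbol y$ converges absolutely for all $x>0$, $\phi\in\mathbb R$. (2) For $x>0$ and $\phi\in\mathbb R$, $J_{(\boldsymbol\mu,\boldsymbol m)}(xe^{i\phi})=e^{-im_{d+1}\phi}J_{\boldsymbol\nu,\boldsymbol k}\big(2\pi x^{\frac1{d+1}},e^{i\phi}\big)$.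
   Context: $p_{2\boldsymbol\nu}(\boldsymbol y)=\prod_{l=1}^dy_l^{2\nu_l-1}$; $\Theta_{\boldsymbol k}(\boldsymbol\theta,\boldsymbol y;x,\phi)=2xy_1\cdots y_d\cos(\sum_{l=1}^d\theta_l+\phi)+\sum_{l=1}^d(k_l\theta_l+2xy_l^{-1}\cos\theta_l)$; $J_{\boldsymbol k}(\boldsymbol y;x,\phi)=\int_{[0,2\pi]^d}e^{i\Theta_{\boldsymbol k}(\boldsymbol\theta,\boldsymbol y;x,\phi)}d\boldsymbol\theta$. Bessel kernel: with $\boldsymbol e=(1,\dots,1)$, $G_k(s)=i^{|k|}(2\pi)^{1-2s}\Gamma(s+\frac{|k|}2)/\Gamma(1-s+\frac{|k|}2)$, $G_{(\boldsymbol\mu,\boldsymbol m)}(s)=\prod_lG_{m_l}(s-\mu_l)$, $j_{(\boldsymbol\mu,\boldsymbol m)}(x)=\frac1{2\pi i}\int_{\mathcal C}G_{(\boldsymbol\mu,\boldsymbol m)}(s)x^{-2s}ds$ ($x>0$), with $\mathcal C$ upward from $\sigma-i\infty$ to $\sigma+i\infty$, $\sigma<\frac12+\frac{2\operatorname{Re}\sum\mu_l-1}{2n}$, equal to $\operatorname{Re}s=\sigma$ for $|\operatorname{Im}s|$ large, with all points $\mu_l-\frac{|m_l|}2-\frac\kappa2$ ($\kappa\in\mathbb N$) on its left; $J_{(\boldsymbol\mu,\boldsymbol m)}(z)=\frac1{2\pi}\sum_{k\in\mathbb Z}j_{(\boldsymbol\mu,\boldsymbol m+k\boldsymbol e)}(|z|)(z/|z|)^k$.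 *)

theory Defs
  imports "HOL-Analysis.Analysis"
begin

text \<open>Vectors in C^n, Z^n, R^d are represented as functions on nat, indexed by 1..n
  (resp. 1..d); d-dimensional Lebesgue measure is the product measure
  PiM {1..d} (\<lambda>_. lborel).\<close>

definition Rmeas :: "nat \<Rightarrow> (nat \<Rightarrow> real) measure" where
  "Rmeas d = PiM {1..d} (\<lambda>_. lborel)"

definition p2nu :: "nat \<Rightarrow> (nat \<Rightarrow> complex) \<Rightarrow> (nat \<Rightarrow> real) \<Rightarrow> complex" where
  "p2nu d \<nu> y = (\<Prod>l\<in>{1..d}. of_real (y l) powr (2 * \<nu> l - 1))"

definition Theta :: "nat \<Rightarrow> (nat \<Rightarrow> int) \<Rightarrow> (nat \<Rightarrow> real) \<Rightarrow> (nat \<Rightarrow> real) \<Rightarrow> real \<Rightarrow> real \<Rightarrow> real" where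
  "Theta d k \<theta> y x \<phi> =
     2 * x * (\<Prod>l\<in>{1..d}. y l) * cos ((\<Sum>l\<in>{1..d}. \<theta> l) + \<phi>)
     + (\<Sum>l\<in>{1..d}. of_int (k l) * \<theta> l + 2 * x * inverse (y l) * cos (\<theta> l))"

definition Jk :: "nat \<Rightarrow> (nat \<Rightarrow> int) \<Rightarrow> (nat \<Rightarrow> real) \<Rightarrow> real \<Rightarrow> real \<Rightarrow> complex" where
  "Jk d k y x \<phi> =
     (LINT \<theta>:{\<theta>. \<forall>l\<in>{1..d}. \<theta> l \<in> {0..2*pi}}|Rmeas d. exp (\<i> * of_real (Theta d k \<theta> y x \<phi>)))"

definition Rplus :: "nat \<Rightarrow> (nat \<Rightarrow> real) set" where
  "Rplus d = {y. \<forall>l\<in>{1..d}. 0 < y l}"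

definition Jnuk :: "nat \<Rightarrow> (nat \<Rightarrow> complex) \<Rightarrow> (nat \<Rightarrow> int) \<Rightarrow> real \<Rightarrow> real \<Rightarrow> complex" where
  "Jnuk d \<nu> k x \<phi> = 2 ^ d * (LINT y:Rplus d|Rmeas d. p2nu d \<nu> y * Jk d k y x \<phi>)"

definition Gk :: "int \<Rightarrow> complex \<Rightarrow> complex" where
  "Gk k s = \<i> ^ nat \<bar>k\<bar> * of_real (2 * pi) powr (1 - 2 * s)
            * Gamma (s + of_int \<bar>k\<bar> / 2) / Gamma (1 - s + of_int \<bar>k\<bar> / 2)"

definition Gmum :: "nat \<Rightarrow> (nat \<Rightarrow> complex) \<Rightarrow> (nat \<Rightarrow> int) \<Rightarrow> complex \<Rightarrow> complex" where
  "Gmum n \<mu> m s = (\<Prod>l\<in>{1..n}. Gk (m l) (s - \<mu> l))"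

text \<open>Admissible contours: s = f(t) + i t (t from -infinity to +infinity, i.e. upward),
  f C^1, f(t) = sigma for |t| large, sigma below the bound, and all points
  mu_l - |m_l|/2 - kappa/2 strictly to the left of the contour.\<close>
definition admissible_contour ::
  "nat \<Rightarrow> (nat \<Rightarrow> complex) \<Rightarrow> (nat \<Rightarrow> int) \<Rightarrow> real \<Rightarrow> (real \<Rightarrow> real) \<Rightarrow> bool" where
  "admissible_contour n \<mu> m \<sigma> f \<longleftrightarrow>
     \<sigma> < 1/2 + (2 * Re (\<Sum>l\<in>{1..n}. \<mu> l) - 1) / (2 * real n)
     \<and> f C1_differentiable_on UNIV
     \<and> (\<exists>T. \<forall>t. T \<le> \<bar>t\<bar> \<longrightarrow> f t = \<sigma>)
     \<and> (\<forall>l\<in>{1..n}. \<forall>\<kappa>::nat.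
          let p = \<mu> l - of_int \<bar>m l\<bar> / 2 - of_nat \<kappa> / 2 in Re p < f (Im p))"

definition contour_value ::
  "nat \<Rightarrow> (nat \<Rightarrow> complex) \<Rightarrow> (nat \<Rightarrow> int) \<Rightarrow> (real \<Rightarrow> real) \<Rightarrow> real \<Rightarrow> complex" where
  "contour_value n \<mu> m f x =
     (LINT t|lborel. Gmum n \<mu> m (Complex (f t) t) * of_real x powr (- 2 * Complex (f t) t)
                     * (of_real (deriv f t) + \<i>))"

text \<open>j_{(mu,m)}(x) = 1/(2 pi i) * contour integral (the value is independent of the
  admissible contour; we take some admissible contour).\<close>
definition jmum :: "nat \<Rightarrow> (nat \<Rightarrow> complex) \<Rightarrow> (nat \<Rightarrow> int) \<Rightarrow> real \<Rightarrow> complex" where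
  "jmum n \<mu> m x =
     (let f = SOME f. \<exists>\<sigma>. admissible_contour n \<mu> m \<sigma> f
      in contour_value n \<mu> m f x / (2 * of_real pi * \<i>))"

definition Jmum :: "nat \<Rightarrow> (nat \<Rightarrow> complex) \<Rightarrow> (nat \<Rightarrow> int) \<Rightarrow> complex \<Rightarrow> complex" where
  "Jmum n \<mu> m z =
     (\<Sum>\<^sub>\<infinity>k\<in>(UNIV::int set). jmum n \<mu> (\<lambda>l. m l + k) (cmod z) * (z / of_real (cmod z)) powi k)
     / (2 * of_real pi)"

end

theory Submission
  imports Defs "HOL-Probability.Probability" "HOL-Complex_Analysis.Complex_Analysis"
begin

text \<open>Write b_m(r) = i^|m| J_|m|(2r). The Jacobi-Anger expansion e^(2ir cos t) = \<Sum> b_q(r) e^(iqt), inserted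
  into the torus integral, gives J_k(y; x, \<phi>) as (2 \<pi>)^d times a sum over q of e^(iq \<phi>) and d+1 values of b,
  at arguments x y_1 \<cdots> y_d and x / y_l whose product is x^(d+1). The bounds
  b_m(r) = O((1 + |m|) min(1, r^(-1/2))) and, for bounded r, b_m(r) = O(|m|^(-N)) dominate this sum, which
  proves (1) and lets the y-integral act term by term. The Mellin transform of b_m is the gamma factor
  G_m up to elementary factors, so by Mellin inversion the q-th term is the kernel j for the exponents
  m + (q - m_(d+1)) e, with its contour moved to a vertical line in the common strip of absolute
  convergence; summing over q gives (2).\<close>

subsection \<open>Integrals, sums and Fourier inversion\<close>

text \<open>The condition on \<nu> comes from the factor at r = x y_1 ... y_d. For every a in
  [-1/2, 0] it is bounded by min(1, r^(-1/2)) <= r^a, which puts y_l^a on each variable. The other d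
  factors give min(1, y_l^(1/2)), and y^(2 Re \<nu>_l + a - 1) min(1, y^(1/2)) is integrable over y
  > 0 when -1/2 < 2 Re \<nu>_l + a < 0. On the Mellin side the same inequalities say that a line Re
  s = \<sigma> exists with all s - \<mu>_l in the strip 0 < Re < 1/4, where the Mellin integrals of
  the b_m converge absolutely. The obstacle there is that a single gamma factor is only known to be
  O(|t|^(2 Re s - 1)), which is not integrable; the product over all l is. So inversion cannot treat
  the Bessel functions one by one. The inversion lemma assumes integrability only for the product of
  two transforms, and evaluates one function at the values L y of a function on the space carrying
  the other factors. Gamma values enter only through quotients at equal height, where the
  exponential factors cancel.\<close>

lemma exp_substitution:
  fixes f :: "real \<Rightarrow> complex"
  assumes [measurable]: "f \<in> borel_measurable borel"
  shows "set_integrable lborel {0<..} f \<longleftrightarrow> integrable lborel (\<lambda>u. exp u *\<^sub>R f (exp u))" (is ?A)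
    and "(LINT y:{0<..}|lborel. f y) = (LINT u|lborel. exp u *\<^sub>R f (exp u))" (is ?B)
proof -
  have img: "exp ` (UNIV::real set) = {0<..}"
    by (auto simp: image_iff) (metis exp_ln)
  \<comment> \<open>The change of variables is stated for the completed measure; Borel measurability
    of \<open>f\<close> brings the claims back to \<open>lborel\<close>.\<close>
  have mi: "integrable lebesgue (\<lambda>u. exp u *\<^sub>R f (exp u)) = integrable lborel (\<lambda>u. exp u *\<^sub>R f (exp u))"
    by (subst integrable_completion) auto
  have mi2: "integrable lebesgue (\<lambda>u. indicat_real {0<..} u *\<^sub>R f u) = integrable lborel (\<lambda>u. indicat_real {0<..} u *\<^sub>R f u)"
    by (subst integrable_completion) auto
  have 1: "f absolutely_integrable_on exp ` (UNIV::real set)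
     \<longleftrightarrow> (\<lambda>x. \<bar>exp x\<bar> *\<^sub>R f (exp x)) absolutely_integrable_on UNIV"
    by (intro absolutely_integrable_change_of_variables_real)
       (auto intro!: derivative_eq_intros simp: inj_on_def)
  show A: ?A
    using 1 by (simp add: img set_integrable_def mi mi2)
  have 2: "((\<lambda>x. \<bar>exp x\<bar> *\<^sub>R f (exp x)) absolutely_integrable_on UNIV \<and>
      integral UNIV (\<lambda>x. \<bar>exp x\<bar> *\<^sub>R f (exp x)) = b) =
     (f absolutely_integrable_on exp ` UNIV \<and> integral (exp ` UNIV) f = b)" for b
    by (intro has_absolute_integral_change_of_variables_real)
       (auto intro!: derivative_eq_intros simp: inj_on_def)
  show ?B
  proof (cases "set_integrable lborel {0<..} f")
    case True
    then have T2: "integrable lborel (\<lambda>u. exp u *\<^sub>R f (exp u))" using A by simp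
    have "f absolutely_integrable_on exp ` (UNIV::real set)"
      using True by (simp add: img set_integrable_def mi2)
    with 2[of "integral {0<..} f"] have "integral UNIV (\<lambda>x. exp x *\<^sub>R f (exp x)) = integral {0<..} f"
      by (simp add: img)
    moreover have "integral UNIV (\<lambda>x. exp x *\<^sub>R f (exp x)) = (LINT u|lborel. exp u *\<^sub>R f (exp u))"
      using integral_lborel[OF T2] by simp
    moreover have "integral {0<..} f = (LINT y:{0<..}|lborel. f y)"
      using set_borel_integral_eq_integral(2)[OF True] by simp
    ultimately show ?thesis by simp
  next
    case False
    \<comment> \<open>Both sides are then 0, the default value of the Bochner integral of a
      non-integrable function.\<close>
    then have "\<not> integrable lborel (\<lambda>u. exp u *\<^sub>R f (exp u))" using A by simp
    with False show ?thesis
      by (simp add: set_lebesgue_integral_def set_integrable_def not_integrable_integral_eq)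
  qed
qed

text \<open>Euler's integral after t = exp u. Rescaling t becomes a translation of u, the form in
  which Weber's integral and the Mellin transform use it.\<close>

lemma Gamma_log_integral:
  fixes w :: complex
  assumes "Re w > 0"
  shows "integrable lborel (\<lambda>u. exp (w * of_real u) * of_real (exp (- exp u)))"
    and "(LINT u|lborel. exp (w * of_real u) * of_real (exp (- exp u))) = Gamma w"
proof -
  define f where "f t = complex_of_real t powr (w - 1) / complex_of_real (exp t)" for t
  have [measurable]: "f \<in> borel_measurable borel"
    unfolding f_def by measurable
  have "integrable lebesgue (\<lambda>u. indicat_real {0<..} u *\<^sub>R f u) = integrable lborel (\<lambda>u. indicat_real {0<..} u *\<^sub>R f u)"
    by (subst integrable_completion) auto
  then have si: "set_integrable lborel {0<..} f"
    using absolutely_integrable_Gamma_integral'[OF assms] by (simp add: set_integrable_def f_def)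
  have eq: "exp u *\<^sub>R f (exp u) = exp (w * of_real u) * of_real (exp (- exp u))" for u
  proof -
    have "f (exp u) = exp ((w - 1) * of_real u) * of_real (exp (- exp u))"
      by (simp add: f_def powr_def Ln_of_real exp_minus exp_of_real field_simps del: of_real_exp)
    then show ?thesis
      by (simp add: scaleR_conv_of_real algebra_simps flip: exp_of_real exp_add)
  qed
  show "integrable lborel (\<lambda>u. exp (w * of_real u) * of_real (exp (- exp u)))"
    using exp_substitution(1)[of f] si by (simp add: eq)
  have "(LINT y:{0<..}|lborel. f y) = Gamma w"
    using Gamma_integral_complex'[OF assms] set_borel_integral_eq_integral(2)[OF si]
    by (simp add: f_def[abs_def] has_integral_iff)
  then show "(LINT u|lborel. exp (w * of_real u) * of_real (exp (- exp u))) = Gamma w"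
    using exp_substitution(2)[of f] by (simp add: eq)
qed

text \<open>The majorant separates as \<open>c q * P y\<close>, so the integrals of the norms are
  summable; \<open>int_decode\<close> turns the sum over the integers into a series, to which
  termwise integration applies.\<close>

lemma has_sum_integral_dominated:
  fixes f :: "int \<Rightarrow> 'a \<Rightarrow> complex"
  assumes [measurable]: "\<And>q. f q \<in> borel_measurable M" and P: "integrable M P"
    and c: "c summable_on UNIV"
    and le: "\<And>q y. y \<in> space M \<Longrightarrow> norm (f q y) \<le> c q * P y"
    and s: "\<And>y. y \<in> space M \<Longrightarrow> ((\<lambda>q. f q y) has_sum F y) UNIV"
  shows "integrable M F" and "((\<lambda>q. LINT y|M. f q y) has_sum (LINT y|M. F y)) UNIV"
    and "(\<lambda>q. norm (LINT y|M. f q y)) summable_on UNIV"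
proof -
  have cP: "0 \<le> c q * P y" if "y \<in> space M" for q y
    using le[OF that, of q] norm_ge_zero order_trans by blast
  have fi: "integrable M (f q)" for q
    by (rule Bochner_Integration.integrable_bound[of _ "\<lambda>y. c q * P y"])
       (use P le cP in \<open>auto intro!: AE_I2 simp: abs_of_nonneg simp del: abs_mult\<close>)
  define g where "g n = f (int_decode n)" for n
  \<comment> \<open>Only the products \<open>c q * P y\<close> are known to be nonnegative, hence
    absolute values on both factors.\<close>
  define I where "I q = norm (c q) * (LINT y|M. norm (P y))" for q
  have fI: "(LINT y|M. norm (f q y)) \<le> I q" for q
  proof -
    have "(LINT y|M. norm (f q y)) \<le> (LINT y|M. norm (c q) * norm (P y))"
      using fi P le cP
      by (intro integral_mono) (auto simp flip: abs_mult intro!: order_trans[OF le])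
    then show ?thesis by (simp add: I_def)
  qed
  have bij: "bij_betw int_decode UNIV UNIV" by (rule bij_int_decode)
  have cs: "(\<lambda>n. norm (c (int_decode n))) summable_on UNIV"
    using summable_on_reindex_bij_betw[OF bij, of "\<lambda>q. norm (c q)"] c summable_on_iff_abs_summable_on_real
    by blast
  then have sc: "summable (\<lambda>n. norm (c (int_decode n)))"
    by (rule summable_on_imp_summable)
  have sI: "summable (\<lambda>n. I (int_decode n))"
    unfolding I_def by (intro summable_mult2 sc)
  have sg: "summable (\<lambda>n. norm (g n y))" if "y \<in> space M" for y
  proof (rule summable_comparison_test'[of "\<lambda>n. norm (c (int_decode n)) * norm (P y)" 0])
    show "summable (\<lambda>n. norm (c (int_decode n)) * norm (P y))" by (intro summable_mult2 sc)
    show "norm (norm (g n y)) \<le> norm (c (int_decode n)) * norm (P y)" for n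
      using le[OF that, of "int_decode n"] by (simp add: g_def flip: abs_mult)
  qed
  have gF: "(\<lambda>n. g n y) sums F y" if "y \<in> space M" for y
    using s[OF that] has_sum_reindex_bij_betw[OF bij, of "\<lambda>q. f q y"]
    by (auto simp: g_def intro: has_sum_imp_sums)
  have sgI: "summable (\<lambda>n. LINT y|M. norm (g n y))"
    by (rule summable_comparison_test'[OF sI, of 0]) (use fI in \<open>auto simp: g_def\<close>)
  have gi: "integrable M (g n)" for n by (simp add: g_def fi)
  have Fe: "F y = (\<Sum>n. g n y)" if "y \<in> space M" for y using gF[OF that] by (simp add: sums_iff)
  have "integrable M (\<lambda>y. \<Sum>n. g n y)"
    by (rule integrable_suminf[OF gi _ sgI]) (use sg in auto)
  then show "integrable M F"
    using Fe by (simp cong: Bochner_Integration.integrable_cong)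
  have "(\<lambda>n. LINT y|M. g n y) sums (LINT y|M. (\<Sum>n. g n y))"
    by (rule sums_integral[OF gi _ sgI]) (use sg in auto)
  also have "(LINT y|M. (\<Sum>n. g n y)) = (LINT y|M. F y)"
    using Fe by (simp cong: Bochner_Integration.integral_cong)
  finally have S: "(\<lambda>n. LINT y|M. g n y) sums (LINT y|M. F y)" .
  have SN: "summable (\<lambda>n. norm (LINT y|M. g n y))"
    by (rule summable_comparison_test'[OF sgI, of 0]) auto
  have "((\<lambda>n. LINT y|M. g n y) has_sum (LINT y|M. F y)) UNIV"
    by (rule norm_summable_imp_has_sum[OF SN S])
  then show "((\<lambda>q. LINT y|M. f q y) has_sum (LINT y|M. F y)) UNIV"
    using has_sum_reindex_bij_betw[OF bij, of "\<lambda>q. LINT y|M. f q y"] by (simp add: g_def)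
  have "(\<lambda>n. norm (LINT y|M. g n y)) summable_on UNIV"
    using SN by (intro norm_summable_imp_summable_on) simp
  then show "(\<lambda>q. norm (LINT y|M. f q y)) summable_on UNIV"
    using summable_on_reindex_bij_betw[OF bij, of "\<lambda>q. norm (LINT y|M. f q y)"] by (simp add: g_def)
qed

text \<open>The characteristic function of the standard normal law, rescaled. As e grows, the
  cut-off tends to 1 and its transform becomes an approximate identity of mass 2 pi.\<close>

lemma gaussian_fourier:
  assumes "e > (0::real)"
  shows "integrable lborel (\<lambda>t. iexp (t * x) * of_real (exp (- (t / e)\<^sup>2 / 2)))"
    and "(LINT t|lborel. iexp (t * x) * of_real (exp (- (t / e)\<^sup>2 / 2)))
        = of_real (e * sqrt (2 * pi) * exp (- (e * x)\<^sup>2 / 2))"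
proof -
  have i: "integrable lborel (\<lambda>t. complex_of_real (std_normal_density t))"
    by simp
  have i2: "integrable lborel (\<lambda>t. std_normal_density t *\<^sub>R iexp (y * t))" for y
    by (rule Bochner_Integration.integrable_bound[OF i]) (auto simp: norm_mult)
  have ch: "(LINT t|lborel. std_normal_density t *\<^sub>R iexp (y * t)) = of_real (exp (- y\<^sup>2 / 2))" for y
  proof -
    have "char std_normal_distribution y = (LINT t|lborel. std_normal_density t *\<^sub>R iexp (y * t))"
      unfolding char_def by (subst integral_density) auto
    then show ?thesis by (simp add: char_std_normal_distribution)
  qed
  have eq: "iexp (t * x) * of_real (exp (- (t / e)\<^sup>2 / 2)) =
        of_real (sqrt (2*pi)) * (std_normal_density (0 + (1/e) * t) *\<^sub>R iexp ((e * x) * (0 + (1/e) * t)))" for t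
    using assms by (simp add: std_normal_density_def scaleR_conv_of_real field_simps)
  show "integrable lborel (\<lambda>t. iexp (t * x) * of_real (exp (- (t / e)\<^sup>2 / 2)))"
    unfolding eq using assms
    by (intro integrable_mult_right lborel_integrable_real_affine[OF i2[of "e*x"]]) auto
  have "(LINT t|lborel. std_normal_density t *\<^sub>R iexp ((e * x) * t)) = \<bar>1/e\<bar> *\<^sub>R
     (LINT t|lborel. (std_normal_density (0 + (1/e) * t) *\<^sub>R iexp ((e * x) * (0 + (1/e) * t))))"
    using assms by (intro lborel_integral_real_affine) auto
  then show "(LINT t|lborel. iexp (t * x) * of_real (exp (- (t / e)\<^sup>2 / 2)))
        = of_real (e * sqrt (2 * pi) * exp (- (e * x)\<^sup>2 / 2))"
    unfolding eq ch using assms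
    by (subst integral_mult_right_zero) (simp add: scaleR_conv_of_real field_simps)
qed

lemma (in pair_sigma_finite)
  fixes f :: "'a \<Rightarrow> complex" and g :: "'b \<Rightarrow> complex"
  assumes f: "integrable M1 f" and g: "integrable M2 g"
  shows integrable_pair_mult: "integrable (M1 \<Otimes>\<^sub>M M2) (\<lambda>(x, y). f x * g y)"
    and integral_pair_mult: "(LINT z|(M1 \<Otimes>\<^sub>M M2). f (fst z) * g (snd z)) = (LINT x|M1. f x) * (LINT y|M2. g y)"
proof -
  have [measurable]: "f \<in> borel_measurable M1" "g \<in> borel_measurable M2" using f g by auto
  show i: "integrable (M1 \<Otimes>\<^sub>M M2) (\<lambda>(x, y). f x * g y)"
  proof (rule Fubini_integrable)
    show "integrable M1 (\<lambda>x. LINT y|M2. norm (case (x, y) of (x, y) \<Rightarrow> f x * g y))"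
      using f by (simp add: norm_mult)
    show "AE x in M1. integrable M2 (\<lambda>y. case (x, y) of (x, y) \<Rightarrow> f x * g y)"
      using g by simp
  qed measurable
  show "(LINT z|(M1 \<Otimes>\<^sub>M M2). f (fst z) * g (snd z)) = (LINT x|M1. f x) * (LINT y|M2. g y)"
    using integral_fst'[OF i] by (simp add: split_beta')
qed

text \<open>The transform of \<open>g\<close> alone may fail to be integrable, so pointwise
  inversion of \<open>g\<close> is not at hand. A Gaussian in t legitimises Fubini, the t-integral
  becomes an average of \<open>g\<close> around \<open>L y\<close> at scale 1/e, and e tends to
  infinity on both sides.\<close>

lemma fourier_inversion_at_function:
  fixes A :: "'a \<Rightarrow> complex" and L :: "'a \<Rightarrow> real" and g :: "real \<Rightarrow> complex"
  assumes N: "sigma_finite_measure N" and A: "integrable N A" and L[measurable]: "L \<in> borel_measurable N"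
    and g: "integrable lborel g" "continuous_on UNIV g" "\<And>w. norm (g w) \<le> B"
    and P: "integrable lborel (\<lambda>t. (LINT w|lborel. g w * iexp (t * w)) * (LINT y|N. A y * iexp (- (t * L y))))"
  shows "(LINT t|lborel. (LINT w|lborel. g w * iexp (t * w)) * (LINT y|N. A y * iexp (- (t * L y))))
      = 2 * pi * (LINT y|N. A y * g (L y))"
proof -
  interpret N: sigma_finite_measure N by fact
  interpret pair_sigma_finite lborel N ..
  interpret TQ: pair_sigma_finite lborel "lborel \<Otimes>\<^sub>M N" ..
  have [measurable]: "A \<in> borel_measurable N" "g \<in> borel_measurable borel"
    using A g(1) by auto
  have B0: "B \<ge> 0" using g(3)[of 0] norm_ge_zero order_trans by blast
  define h where "h q = g (fst q) * A (snd q)" for q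
  have h: "integrable (lborel \<Otimes>\<^sub>M N) h"
    unfolding h_def using integrable_pair_mult[OF g(1) A] by (simp add: split_beta')
  have [measurable]: "h \<in> borel_measurable (lborel \<Otimes>\<^sub>M N)" using h by auto
  define P where "P t = (LINT w|lborel. g w * iexp (t * w)) * (LINT y|N. A y * iexp (- (t * L y)))" for t
  \<comment> \<open>The product of the two transforms is a single integral over pairs (w, y) with
    phase t (w - L y).\<close>
  have PQ: "P t = (LINT q|(lborel \<Otimes>\<^sub>M N). h q * iexp (t * (fst q - L (snd q))))" for t
  proof -
    have 1: "integrable lborel (\<lambda>w. g w * iexp (t * w))"
      by (rule Bochner_Integration.integrable_bound[OF g(1)]) (auto simp: norm_mult)
    have 2: "integrable N (\<lambda>y. A y * iexp (- (t * L y)))"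
      by (rule Bochner_Integration.integrable_bound[OF A]) (auto simp: norm_mult)
    show ?thesis
      unfolding P_def integral_pair_mult[OF 1 2, symmetric] h_def
      by (intro Bochner_Integration.integral_cong refl)
         (auto simp: split_beta mult_ac algebra_simps simp flip: exp_add)
  qed
  have Pi: "integrable lborel P" using P unfolding P_def[abs_def] .
  define K where "K e v = complex_of_real (exp (- (v / e)\<^sup>2 / 2))" for e v :: real
  have [measurable]: "K e \<in> borel_measurable borel" for e unfolding K_def by measurable
  have step1: "(LINT t|lborel. P t * K e t) = (LINT y|N. A y * (LINT v|lborel. g (L y + v / e) * of_real (sqrt (2*pi) * exp (- v\<^sup>2 / 2))))"
    if e: "e > 0" for e
  proof -
    have "(LINT t|lborel. P t * K e t) = (LINT t|lborel. (LINT q|(lborel \<Otimes>\<^sub>M N). h q * (iexp (t * (fst q - L (snd q))) * K e t)))"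
      unfolding PQ by (intro Bochner_Integration.integral_cong refl)
        (simp flip: integral_mult_left_zero mult.assoc)
    also have "\<dots> = (LINT q|(lborel \<Otimes>\<^sub>M N). (LINT t|lborel. h q * (iexp (t * (fst q - L (snd q))) * K e t)))"
    proof (rule TQ.Fubini_integral[symmetric])
      have "integrable (lborel \<Otimes>\<^sub>M (lborel \<Otimes>\<^sub>M N)) (\<lambda>(t, q). K e t * h q)"
        using gaussian_fourier(1)[OF e, of 0] by (intro TQ.integrable_pair_mult h) (simp add: K_def)
      then show "integrable (lborel \<Otimes>\<^sub>M (lborel \<Otimes>\<^sub>M N)) (\<lambda>(t, q). h q * (iexp (t * (fst q - L (snd q))) * K e t))"
        by (rule Bochner_Integration.integrable_bound) (auto simp: norm_mult split: prod.split)
    qed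
    also have "\<dots> = (LINT q|(lborel \<Otimes>\<^sub>M N). h q * of_real (e * sqrt (2 * pi) * exp (- (e * (fst q - L (snd q)))\<^sup>2 / 2)))"
      unfolding K_def integral_mult_right_zero gaussian_fourier(2)[OF e] ..
    also have "\<dots> = (LINT y|N. (LINT w|lborel. h (w, y) * of_real (e * sqrt (2 * pi) * exp (- (e * (w - L y))\<^sup>2 / 2))))"
    proof (subst integral_snd)
      have key: "c * (e * (s * x)) \<le> e * (s * c)" if "x \<le> 1" "c \<ge> 0" "s \<ge> 0" for c s x :: real
        using mult_left_le[of x "c * e * s"] that e by (simp add: mult_ac)
      show "integrable (lborel \<Otimes>\<^sub>M N) (\<lambda>(w, y). h (w, y) * of_real (e * sqrt (2 * pi) * exp (- (e * (w - L y))\<^sup>2 / 2)))"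
        by (rule Bochner_Integration.integrable_bound[of _ "\<lambda>q. of_real (e * sqrt (2*pi)) * h q"])
          (use h e key in \<open>auto simp: norm_mult mult.assoc intro!: AE_I2\<close>)
    qed (auto simp: split_beta')
    \<comment> \<open>Substituting w = L y + v / e absorbs the factor e and leaves a Gaussian in v
      that is independent of e.\<close>
    also have "\<dots> = (LINT y|N. A y * (LINT v|lborel. g (L y + v / e) * of_real (sqrt (2*pi) * exp (- v\<^sup>2 / 2))))"
    proof (intro Bochner_Integration.integral_cong refl)
      fix y
      have "(LINT w|lborel. h (w, y) * of_real (e * sqrt (2 * pi) * exp (- (e * (w - L y))\<^sup>2 / 2)))
         = \<bar>1/e\<bar> *\<^sub>R (LINT v|lborel. h (L y + (1/e) * v, y) * of_real (e * sqrt (2 * pi) * exp (- (e * ((L y + (1/e) * v) - L y))\<^sup>2 / 2)))"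
        using e by (intro lborel_integral_real_affine) auto
      also have "\<dots> = (LINT v|lborel. A y * (g (L y + v / e) * of_real (sqrt (2*pi) * exp (- v\<^sup>2 / 2))))"
        using e unfolding integral_scaleR_right[symmetric]
        by (intro Bochner_Integration.integral_cong refl) (simp add: h_def scaleR_conv_of_real field_simps)
      finally show "(LINT w|lborel. h (w, y) * of_real (e * sqrt (2 * pi) * exp (- (e * (w - L y))\<^sup>2 / 2)))
         = A y * (LINT v|lborel. g (L y + v / e) * of_real (sqrt (2*pi) * exp (- v\<^sup>2 / 2)))"
        by simp
    qed
    finally show ?thesis .
  qed
  have gi: "integrable lborel (\<lambda>v. sqrt (2*pi) * exp (- v\<^sup>2 / 2))" 
    using gaussian_fourier(1)[of 1 0, THEN integrable_Re] by simp
  have gv: "(LINT v|lborel. sqrt (2*pi) * exp (- v\<^sup>2 / 2)) = 2 * pi"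
  proof -
    have "(LINT v|lborel. std_normal_density v) = 1"
      using prob_space.prob_space[OF prob_space_normal_density] by simp
    then have "sqrt (2 * pi) = (LBINT v. exp (- v\<^sup>2 / 2))"
      by (simp add: std_normal_density_def)
    then have "sqrt (2 * pi) * (LBINT v. exp (- v\<^sup>2 / 2)) = sqrt (2 * pi) * sqrt (2 * pi)" by (simp only:)
    then show ?thesis by (simp flip: real_sqrt_mult)
  qed
  \<comment> \<open>Removing the cut-off is where integrability of the product \<open>P\<close> is
    used: it dominates.\<close>
  have lim1: "(\<lambda>n. LINT t|lborel. P t * K (real (Suc n)) t) \<longlonglongrightarrow> (LINT t|lborel. P t)"
  proof (rule integral_dominated_convergence[where w="\<lambda>t. norm (P t)"])
    have "(\<lambda>n. P t * K (real (Suc n)) t) \<longlonglongrightarrow> P t * of_real (exp (- (t * 0)\<^sup>2 / 2))" for t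
      unfolding K_def divide_inverse[of t] by (intro tendsto_intros LIMSEQ_inverse_real_of_nat) auto
    then show "AE t in lborel. (\<lambda>n. P t * K (real (Suc n)) t) \<longlonglongrightarrow> P t" by simp
    show "AE t in lborel. norm (P t * K (real (Suc n)) t) \<le> norm (P t)" for n
      by (auto simp: norm_mult K_def mult_left_le)
  qed (use Pi in auto)
  define R where "R n y = (LINT v|lborel. g (L y + v / real (Suc n)) * of_real (sqrt (2*pi) * exp (- v\<^sup>2 / 2)))" for n y
  have Rlim: "(\<lambda>n. R n y) \<longlonglongrightarrow> (LINT v|lborel. g (L y) * of_real (sqrt (2*pi) * exp (- v\<^sup>2 / 2)))" for y
    unfolding R_def
  proof (rule integral_dominated_convergence[where w="\<lambda>v. B * (sqrt (2*pi) * exp (- v\<^sup>2 / 2))"])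
    show "integrable lborel (\<lambda>v. B * (sqrt (2*pi) * exp (- v\<^sup>2 / 2)))" using gi by simp
    have "(\<lambda>n. L y + v / real (Suc n)) \<longlonglongrightarrow> L y + v * 0" for v
      unfolding divide_inverse by (intro tendsto_intros LIMSEQ_inverse_real_of_nat)
    then have "(\<lambda>n. g (L y + v / real (Suc n))) \<longlonglongrightarrow> g (L y)" for v
      by (intro continuous_on_tendsto_compose[OF g(2), of _ "L y"]) auto
    then show "AE v in lborel. (\<lambda>n. g (L y + v / real (Suc n)) * of_real (sqrt (2*pi) * exp (- v\<^sup>2 / 2))) \<longlonglongrightarrow>
         g (L y) * of_real (sqrt (2*pi) * exp (- v\<^sup>2 / 2))"
      by (auto intro!: tendsto_intros)
    show "AE v in lborel. norm (g (L y + v / real (Suc n)) * of_real (sqrt (2*pi) * exp (- v\<^sup>2 / 2)))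
       \<le> B * (sqrt (2*pi) * exp (- v\<^sup>2 / 2))" for n
      using g(3) by (auto simp: norm_mult intro!: mult_right_mono)
  qed auto
  have Rl: "(LINT v|lborel. g (L y) * of_real (sqrt (2*pi) * exp (- v\<^sup>2 / 2))) = 2 * pi * g (L y)" for y
    by (subst integral_mult_right_zero, subst integral_complex_of_real, subst gv) (simp add: mult.commute)
  \<comment> \<open>Uniform in n and y, so that this constant times \<open>norm (A y)\<close>
    dominates in the second limit.\<close>
  have Rb: "norm (R n y) \<le> 2 * pi * B" for n y
  proof -
    have "norm (R n y) \<le> (LINT v|lborel. B * (sqrt (2*pi) * exp (- v\<^sup>2 / 2)))"
      unfolding R_def
      by (rule order_trans[OF integral_norm_bound], rule integral_mono')
         (use g(3) gi B0 in \<open>auto simp: norm_mult intro!: mult_right_mono\<close>)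
    then show ?thesis using gv by (simp add: mult_ac)
  qed
  have lim2: "(\<lambda>n. LINT y|N. A y * R n y) \<longlonglongrightarrow> (LINT y|N. A y * (2 * pi * g (L y)))"
  proof (rule integral_dominated_convergence[where w="\<lambda>y. norm (A y) * (2 * pi * B)"])
    show "AE y in N. (\<lambda>n. A y * R n y) \<longlonglongrightarrow> A y * (2 * pi * g (L y))"
      by (intro AE_I2 tendsto_intros Rlim[unfolded Rl])
    show "AE y in N. norm (A y * R n y) \<le> norm (A y) * (2 * pi * B)" for n
      using Rb by (auto simp: norm_mult intro!: mult_left_mono)
    show "(\<lambda>y. A y * R n y) \<in> borel_measurable N" for n
      unfolding R_def by measurable
  qed (use A in auto)
  have "(LINT t|lborel. P t) = (LINT y|N. A y * (2 * pi * g (L y)))"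
    by (rule LIMSEQ_unique[OF lim1]) (use lim2 step1 in \<open>simp add: R_def\<close>)
  also have "\<dots> = 2 * pi * (LINT y|N. A y * g (L y))"
    by (simp flip: integral_mult_right_zero add: mult_ac)
  finally show ?thesis unfolding P_def .
qed

subsection \<open>Bessel functions of integer order\<close>

text \<open>Bessel's integral for i^|m| J_|m|(2 r). It is the integral over one angle that
  \<open>Jk\<close> produces, and its factor i^|m| matches the one in \<open>Gk\<close>.\<close>

definition bes :: "int \<Rightarrow> real \<Rightarrow> complex" where
  "bes m r = (LINT \<theta>:{0..2*pi}|lborel. exp (\<i> * of_real (of_int m * \<theta> + 2 * r * cos \<theta>))) / (2 * pi)"

lemma bes_eq_integral:
  "set_integrable lborel {0..2*pi} (\<lambda>\<theta>. exp (\<i> * of_real (of_int m * \<theta> + 2 * r * cos \<theta>)))"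
  "bes m r = integral {0..2*pi} (\<lambda>\<theta>. exp (\<i> * of_real (of_int m * \<theta> + 2 * r * cos \<theta>))) / (2 * pi)"
proof -
  show *: "set_integrable lborel {0..2*pi} (\<lambda>\<theta>. exp (\<i> * of_real (of_int m * \<theta> + 2 * r * cos \<theta>)))"
    unfolding set_integrable_def by (intro borel_integrable_compact continuous_intros) auto
  show "bes m r = integral {0..2*pi} (\<lambda>\<theta>. exp (\<i> * of_real (of_int m * \<theta> + 2 * r * cos \<theta>))) / (2 * pi)"
    using set_borel_integral_eq_integral(2)[OF *] by (simp add: bes_def)
qed

lemma norm_bes_le_1: "norm (bes m r) \<le> 1"
proof -
  have "norm (integral {0..2*pi} (\<lambda>\<theta>. exp (\<i> * of_real (of_int m * \<theta> + 2 * r * cos \<theta>)))) \<le> 1 * (2 * pi - 0)"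
    by (rule integral_bound) (auto intro!: continuous_intros)
  then show ?thesis by (simp add: bes_eq_integral norm_divide field_simps)
qed

lemma continuous_on_bes [continuous_intros]:
  assumes "continuous_on A f" shows "continuous_on A (\<lambda>x. bes m (f x))"
proof -
  have "continuous_on UNIV (\<lambda>r. integral (cbox 0 (2*pi)) (\<lambda>\<theta>. exp (\<i> * of_real (of_int m * \<theta> + 2 * r * cos \<theta>))))"
    by (rule integral_continuous_on_param) (auto simp: split_beta intro!: continuous_intros)
  then have "continuous_on UNIV (bes m)"
    unfolding bes_eq_integral(2)[abs_def] by (intro continuous_intros) (auto simp: bes_eq_integral(2)[abs_def])
  then show ?thesis
    by (rule continuous_on_compose2[OF _ assms]) auto
qed

lemma measurable_bes [measurable]: "bes m \<in> borel_measurable borel"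
  by (intro borel_measurable_continuous_onI continuous_intros)

section \<open>Generating function and power series of the Bessel functions\<close>

definition bterm :: "real \<Rightarrow> nat \<times> nat \<Rightarrow> complex" where
  "bterm r p = (\<i> * r) ^ fst p / fact (fst p) * ((\<i> * r) ^ snd p / fact (snd p))"

lemma exp_has_sum: "((\<lambda>n. z ^ n / fact n) has_sum exp z) UNIV" for z :: complex
proof -
  have "(\<lambda>n. z ^ n / fact n) sums exp z"
    using exp_converges[of z] by (simp add: scaleR_conv_of_real field_simps)
  moreover have "summable (\<lambda>n. norm (z ^ n / fact n))"
    using summable_exp[of "norm z"] by (simp add: norm_divide norm_power field_simps)
  ultimately show ?thesis by (rule norm_summable_imp_has_sum[rotated])
qed

lemma exp_has_sum_real: "((\<lambda>n. x ^ n / fact n) has_sum exp x) UNIV" if "x \<ge> 0" for x :: real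
proof -
  have "(\<lambda>n. x ^ n / fact n) sums exp x"
    using exp_converges[of x] by (simp add: scaleR_conv_of_real field_simps)
  then show ?thesis using that
    by (intro norm_summable_imp_has_sum) (auto simp: sums_iff)
qed

lemma bterm_abs_summable: "(\<lambda>p. norm (bterm r p)) summable_on UNIV"
proof -
  have "(\<lambda>p. norm (bterm r p)) summable_on (SIGMA a:UNIV. UNIV)"
  proof (rule summable_on_SigmaI)
    show "((\<lambda>b. norm (bterm r (a, b))) has_sum (\<bar>r\<bar> ^ a / fact a * exp \<bar>r\<bar>)) UNIV" for a
      unfolding bterm_def using has_sum_cmult_right[OF exp_has_sum_real[of "\<bar>r\<bar>"], of "\<bar>r\<bar> ^ a / fact a"]
      by (simp add: norm_mult norm_divide norm_power)
    show "(\<lambda>a. \<bar>r\<bar> ^ a / fact a * exp \<bar>r\<bar>) summable_on UNIV"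
      using exp_has_sum_real[of "\<bar>r\<bar>"] by (intro summable_on_cmult_left) (auto simp: summable_on_def)
  qed auto
  then show ?thesis by simp
qed

text \<open>With z = exp(i \<alpha>) the limit is exp(i r / z) exp(i r z), and
  \<open>bterm r (a, b)\<close> is the coefficient of z^(b - a) in the product of the two
  exponential series.\<close>

lemma bterm_has_sum:
  "((\<lambda>p. bterm r p * exp (\<i> * of_real (\<alpha> * (real (snd p) - real (fst p))))) has_sum exp (2 * \<i> * of_real (r * cos \<alpha>))) UNIV"
proof -
  define z where "z = exp (\<i> * \<alpha>)"
  have zn: "exp (\<i> * of_real (\<alpha> * (real b - real a))) = inverse z ^ a * z ^ b" for a b
    by (simp add: z_def exp_of_nat_mult[symmetric] exp_minus[symmetric] exp_add[symmetric] algebra_simps)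
  have eq: "bterm r p * exp (\<i> * of_real (\<alpha> * (real (snd p) - real (fst p)))) =
     ((\<i> * r * inverse z) ^ fst p / fact (fst p)) * ((\<i> * r * z) ^ snd p / fact (snd p))" for p
    unfolding zn bterm_def by (simp add: power_mult_distrib field_simps)
  have S: "((\<lambda>p. ((\<i> * r * inverse z) ^ fst p / fact (fst p)) * ((\<i> * r * z) ^ snd p / fact (snd p)))
    has_sum (exp (\<i> * r * inverse z) * exp (\<i> * r * z))) (SIGMA a:UNIV. UNIV)"
  proof (rule has_sum_SigmaI)
    show "((\<lambda>b. ((\<i> * r * inverse z) ^ fst (a, b) / fact (fst (a, b))) * ((\<i> * r * z) ^ snd (a, b) / fact (snd (a, b))))
      has_sum ((\<i> * r * inverse z) ^ a / fact a * exp (\<i> * r * z))) UNIV" for a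
      unfolding fst_conv snd_conv by (rule has_sum_cmult_right[OF exp_has_sum])
    show "((\<lambda>a. (\<i> * r * inverse z) ^ a / fact a * exp (\<i> * r * z)) has_sum (exp (\<i> * r * inverse z) * exp (\<i> * r * z))) UNIV"
      by (rule has_sum_cmult_left[OF exp_has_sum])
    have "(\<lambda>p. norm (bterm r p * exp (\<i> * of_real (\<alpha> * (real (snd p) - real (fst p)))))) summable_on UNIV"
      using bterm_abs_summable[of r] by (simp add: norm_mult)
    then have "(\<lambda>p. bterm r p * exp (\<i> * of_real (\<alpha> * (real (snd p) - real (fst p))))) summable_on UNIV"
      by (rule abs_summable_summable)
    then show "(\<lambda>p. ((\<i> * r * inverse z) ^ fst p / fact (fst p)) * ((\<i> * r * z) ^ snd p / fact (snd p))) summable_on (SIGMA a:UNIV. UNIV)"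
      unfolding eq UNIV_Times_UNIV .
  qed
  have "z + inverse z = 2 * of_real (cos \<alpha>)"
    by (simp add: z_def cos_exp_eq exp_minus flip: cos_of_real)
  moreover have "\<i> * r * inverse z + \<i> * r * z = \<i> * r * (z + inverse z)" by (simp add: algebra_simps)
  ultimately have "exp (\<i> * r * inverse z) * exp (\<i> * r * z) = exp (2 * \<i> * of_real (r * cos \<alpha>))"
    by (simp only: exp_add[symmetric]) (simp add: mult_ac)
  with S show ?thesis unfolding eq by simp
qed

text \<open>The diagonals on which z^(b - a) is constant, so that \<open>bcoef m r\<close> is the
  Laurent coefficient of exp(i r (z + 1/z)) at z^m.\<close>

definition bfib :: "int \<Rightarrow> (nat \<times> nat) set" where "bfib m = {p. int (snd p) - int (fst p) = m}"
definition bcoef :: "int \<Rightarrow> real \<Rightarrow> complex" where "bcoef m r = infsum (bterm r) (bfib m)"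

lemma bfib_regroup:
  fixes f :: "nat \<times> nat \<Rightarrow> 'b :: {topological_comm_monoid_add, t3_space}"
  assumes "(f has_sum S) UNIV" "\<And>m. (f has_sum g m) (bfib m)"
  shows "(g has_sum S) UNIV"
proof -
  have "bij_betw snd (SIGMA m:UNIV. bfib m) UNIV"
    by (rule bij_betwI[of _ _ _ "\<lambda>p. (int (snd p) - int (fst p), p)"]) (auto simp: bfib_def)
  then have "((\<lambda>q. f (snd q)) has_sum S) (SIGMA m:UNIV. bfib m)"
    using has_sum_reindex_bij_betw[of snd "SIGMA m:UNIV. bfib m" UNIV f S] assms(1) by simp
  then show ?thesis
    by (rule has_sum_SigmaD) (use assms(2) in simp)
qed

lemma bcoef_has_sum: "(bterm r has_sum bcoef m r) (bfib m)"
  unfolding bcoef_def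
  by (intro has_sum_infsum summable_on_subset_banach[OF abs_summable_summable[OF bterm_abs_summable]]) auto

lemma bcoef_abs_summable: "(\<lambda>m. norm (bcoef m r)) summable_on UNIV"
proof -
  have s: "(\<lambda>p. norm (bterm r p)) summable_on bfib m" for m
    by (rule summable_on_subset_banach[OF bterm_abs_summable]) auto
  have "((\<lambda>m. infsum (\<lambda>p. norm (bterm r p)) (bfib m)) has_sum infsum (\<lambda>p. norm (bterm r p)) UNIV) UNIV"
    by (rule bfib_regroup) (use s bterm_abs_summable in \<open>auto intro: has_sum_infsum\<close>)
  then have "(\<lambda>m. infsum (\<lambda>p. norm (bterm r p)) (bfib m)) summable_on UNIV"
    by (auto simp: summable_on_def)
  then show ?thesis
    by (rule Infinite_Sum.abs_summable_on_comparison_test') (use s in \<open>auto simp: bcoef_def intro: norm_infsum_bound\<close>)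
qed

lemma bcoef_generating:
  "((\<lambda>q. bcoef q r * exp (\<i> * of_real (of_int q * \<alpha>))) has_sum exp (2 * \<i> * of_real (r * cos \<alpha>))) UNIV"
proof (rule bfib_regroup[OF bterm_has_sum])
  fix m
  have "((\<lambda>p. bterm r p * exp (\<i> * of_real (of_int m * \<alpha>))) has_sum bcoef m r * exp (\<i> * of_real (of_int m * \<alpha>))) (bfib m)"
    by (intro has_sum_cmult_left bcoef_has_sum)
  moreover have "real (snd p) - real (fst p) = of_int m" if "p \<in> bfib m" for p
  proof -
    have "of_int (int (snd p) - int (fst p)) = (of_int m :: real)" using that by (simp add: bfib_def)
    then show ?thesis by simp
  qed
  ultimately show "((\<lambda>p. bterm r p * exp (\<i> * of_real (\<alpha> * (real (snd p) - real (fst p))))) has_sum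
      bcoef m r * exp (\<i> * of_real (of_int m * \<alpha>))) (bfib m)"
    by (subst has_sum_cong) (auto simp: mult.commute)
qed

lemma bcoef_uminus: "bcoef (-m) r = bcoef m r"
proof -
  have "bij_betw prod.swap (bfib m) (bfib (-m))"
    by (rule bij_betwI[of _ _ _ prod.swap]) (auto simp: bfib_def)
  then have "infsum (\<lambda>p. bterm r (prod.swap p)) (bfib m) = infsum (bterm r) (bfib (-m))"
    by (rule infsum_reindex_bij_betw)
  then show ?thesis by (simp add: bcoef_def bterm_def[abs_def] mult.commute)
qed

lemma exp_int_integral:
  "(LINT \<theta>:{0..2*pi}|lborel. exp (\<i> * of_real (of_int m * \<theta>))) = (if m = 0 then 2 * pi else 0)"
proof (cases "m = 0")
  case True then show ?thesis by (simp add: set_lebesgue_integral_def scaleR_conv_of_real)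
next
  case False
  have "((\<lambda>\<theta>. exp (\<i> * of_real (of_int m * \<theta>))) has_integral
      (exp (\<i> * of_real (of_int m * (2*pi))) / (\<i> * of_int m) - exp (\<i> * of_real (of_int m * 0)) / (\<i> * of_int m))) {0..2*pi}"
  proof (rule fundamental_theorem_of_calculus)
    fix x
    have "((\<lambda>z. exp (\<i> * (of_int m * z)) / (\<i> * of_int m)) has_field_derivative exp (\<i> * (of_int m * of_real x))) (at (of_real x))"
      using False by (auto intro!: derivative_eq_intros simp: field_simps)
    then show "((\<lambda>\<theta>. exp (\<i> * of_real (of_int m * \<theta>)) / (\<i> * of_int m)) has_vector_derivative exp (\<i> * of_real (of_int m * x)))
        (at x within {0..2*pi})"
      using has_vector_derivative_real_field has_vector_derivative_at_within by fastforce
  qed auto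
  moreover have "exp (\<i> * of_real (of_int m * (2*pi))) = 1"
    using exp_integer_2pi[of "of_int m"] by (simp add: mult_ac)
  moreover have "set_integrable lborel {0..2*pi} (\<lambda>\<theta>. exp (\<i> * of_real (of_int m * \<theta>)))"
    unfolding set_integrable_def by (intro borel_integrable_compact continuous_intros) auto
  ultimately show ?thesis
    using False by (simp add: set_borel_integral_eq_integral has_integral_iff)
qed

text \<open>Integrating the generating series against exp(i m \<theta>) leaves only q = -m by
  orthogonality; the symmetry of the coefficients then removes the sign.\<close>

lemma bes_eq_bcoef: "bes m r = bcoef m r"
proof -
  define f where "f q \<theta> = indicat_real {0..2*pi} \<theta> *\<^sub>R (exp (\<i> * of_real (of_int m * \<theta>)) * (bcoef q r * exp (\<i> * of_real (of_int q * \<theta>))))" for q \<theta>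
  have [measurable]: "f q \<in> borel_measurable lborel" for q
    unfolding f_def by (intro borel_measurable_scaleR borel_measurable_continuous_onI) (auto intro!: continuous_intros)
  have "((\<lambda>q. LINT \<theta>|lborel. f q \<theta>) has_sum (LINT \<theta>|lborel. indicat_real {0..2*pi} \<theta> *\<^sub>R (exp (\<i> * of_real (of_int m * \<theta>)) * exp (2 * \<i> * of_real (r * cos \<theta>))))) UNIV"
  proof (rule has_sum_integral_dominated(2)[where P="indicat_real {0..2*pi}" and c="\<lambda>q. norm (bcoef q r)"])
    show "norm (f q y) \<le> norm (bcoef q r) * indicat_real {0..2*pi} y" for q y
      by (simp add: f_def norm_mult)
    show "((\<lambda>q. f q y) has_sum indicat_real {0..2*pi} y *\<^sub>R (exp (\<i> * of_real (of_int m * y)) * exp (2 * \<i> * of_real (r * cos y)))) UNIV" for y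
      unfolding f_def scaleR_conv_of_real by (intro has_sum_cmult_right bcoef_generating)
  qed (auto simp: bcoef_abs_summable)
  moreover have "(LINT \<theta>|lborel. indicat_real {0..2*pi} \<theta> *\<^sub>R (exp (\<i> * of_real (of_int m * \<theta>)) * exp (2 * \<i> * of_real (r * cos \<theta>)))) = 2 * pi * bes m r"
    by (simp add: bes_def set_lebesgue_integral_def algebra_simps flip: exp_add)
  moreover have "(LINT \<theta>|lborel. f q \<theta>) = (if q = -m then 2 * pi * bcoef q r else 0)" for q
  proof -
    have "(LINT \<theta>|lborel. f q \<theta>) = (LINT \<theta>|lborel. bcoef q r * (indicat_real {0..2*pi} \<theta> *\<^sub>R exp (\<i> * of_real (of_int (m + q) * \<theta>))))"
      unfolding f_def by (intro Bochner_Integration.integral_cong refl) (simp add: algebra_simps exp_add)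
    also have "\<dots> = bcoef q r * (LINT \<theta>:{0..2*pi}|lborel. exp (\<i> * of_real (of_int (m + q) * \<theta>)))"
      by (simp only: set_lebesgue_integral_def integral_mult_right_zero)
    finally show ?thesis unfolding exp_int_integral by auto
  qed
  ultimately have "((\<lambda>q. if q = -m then 2 * pi * bcoef q r else 0) has_sum (2 * pi * bes m r)) UNIV" by (simp only:)
  moreover have "((\<lambda>q. if q = -m then 2 * pi * bcoef q r else 0) has_sum (2 * pi * bcoef (-m) r)) UNIV"
    by (rule has_sum_finite_neutralI[of "{-m}"]) auto
  ultimately have "2 * pi * bes m r = 2 * pi * bcoef (-m) r" by (rule has_sum_unique)
  then show ?thesis by (simp add: bcoef_uminus)
qed

lemmas bes_abs_summable = bcoef_abs_summable[folded bes_eq_bcoef]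
lemmas bes_generating = bcoef_generating[folded bes_eq_bcoef]
lemmas bes_uminus = bcoef_uminus[folded bes_eq_bcoef]

lemma bes_abs: "bes \<bar>m\<bar> r = bes m r"
  using bes_uminus[of m r] by (auto simp: abs_if)

lemma bes_series: "((\<lambda>a. (\<i> * r) ^ (2 * a + n) / (fact a * fact (a + n))) has_sum bes (int n) r) UNIV"
proof -
  have "bij_betw (\<lambda>a. (a, a + n)) UNIV (bfib (int n))"
    by (rule bij_betwI[of _ _ _ fst]) (auto simp: bfib_def)
  then have "((\<lambda>a. bterm r (a, a + n)) has_sum bes (int n) r) UNIV"
    using has_sum_reindex_bij_betw[of "\<lambda>a. (a, a + n)" UNIV "bfib (int n)" "bterm r"] bcoef_has_sum
    by (simp add: bes_eq_bcoef)
  then show ?thesis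
    by (simp add: bterm_def power_add power2_eq_square power_mult power_mult_distrib mult_ac)
qed

text \<open>Termwise, (a + n)! >= n! leaves the exponential series of r^2. For bounded r the result
  is factorially small in the order.\<close>

lemma norm_bes_le_power:
  assumes "r \<ge> 0"
  shows "norm (bes m r) \<le> r ^ nat \<bar>m\<bar> / fact (nat \<bar>m\<bar>) * exp (r\<^sup>2)"
proof -
  define n where "n = nat \<bar>m\<bar>"
  have s: "((\<lambda>a. (\<i> * r) ^ (2 * a + n) / (fact a * fact (a + n))) has_sum bes m r) UNIV"
    using bes_series[of r n] by (simp add: n_def bes_abs)
  have b: "((\<lambda>a. r ^ n / fact n * ((r\<^sup>2) ^ a / fact a)) has_sum r ^ n / fact n * exp (r\<^sup>2)) UNIV"
    by (intro has_sum_cmult_right exp_has_sum_real) simp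
  have "norm (bes m r) \<le> r ^ n / fact n * exp (r\<^sup>2)"
  proof (rule norm_infsum_le[OF s b])
    fix a :: nat
    have "r ^ (2 * a + n) / (fact a * fact (a + n)) \<le> r ^ (2 * a + n) / (fact a * fact n)"
      using assms by (intro divide_left_mono mult_left_mono) (auto simp: fact_mono)
    also have "\<dots> = r ^ n / fact n * ((r\<^sup>2) ^ a / fact a)"
      by (simp add: power_add power_mult) (simp add: mult.commute)
    finally show "norm ((\<i> * r) ^ (2 * a + n) / (fact a * fact (a + n))) \<le> r ^ n / fact n * ((r\<^sup>2) ^ a / fact a)"
      using assms by (simp add: norm_divide norm_mult norm_power)
  qed
  then show ?thesis by (simp add: n_def)
qed

text \<open>On this quarter period the phase c cos \<theta> is stationary only at 0. The piece up to
  1 / sqrt |c| is bounded by its length; beyond it, integration by parts gains 1 / (|c| sin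
  \<theta>). The phase m \<theta> is treated as part of the amplitude, which costs the factor 1 +
  |m|.\<close>

lemma exp_cos_quarter_bound:
  fixes c :: real and m :: int
  assumes "c \<noteq> 0"
  shows "norm (integral {0..pi/2} (\<lambda>\<theta>. exp (\<i> * of_real (of_int m * \<theta> + c * cos \<theta>)))) \<le> 7 * (1 + \<bar>of_int m\<bar>) / sqrt \<bar>c\<bar>"
proof (cases "\<bar>c\<bar> \<le> 1")
  case True
  have "norm (integral {0..pi/2} (\<lambda>\<theta>. exp (\<i> * of_real (of_int m * \<theta> + c * cos \<theta>)))) \<le> 1 * (pi/2 - 0)"
    by (rule integral_bound) (auto intro!: continuous_intros)
  also have "\<dots> \<le> 7" using pi_less_4 by simp
  also have "7 * 1 \<le> 7 * (1 + \<bar>of_int m\<bar>) / sqrt \<bar>c\<bar>"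
    using True assms unfolding divide_inverse mult.assoc
    by (intro mult_left_mono mult_ge1_I) (auto simp: one_le_inverse)
  finally show ?thesis by simp
next
  case False
  define a where "a = \<bar>c\<bar>"
  have a: "a > 1" using False by (simp add: a_def)
  \<comment> \<open>Balances the length \<delta> of the first piece against the boundary term, of
    size 1 / (a \<delta>).\<close>
  define \<delta> where "\<delta> = 1 / sqrt a"
  have \<delta>: "0 < \<delta>" "\<delta> < 1" using a by (auto simp: \<delta>_def)
  have \<delta>2: "\<delta> < pi/2" using \<delta> pi_gt3 by simp
  define F where "F \<theta> = exp (\<i> * of_real (of_int m * \<theta> + c * cos \<theta>))" for \<theta> :: real
  \<comment> \<open>\<open>G\<close> is an approximate primitive of \<open>F\<close>: dividing by
    the derivative of c cos \<theta> alone gives G' = F + R.\<close>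
  define R where "R \<theta> = - F \<theta> * (of_int m / of_real (sin \<theta>) + \<i> * of_real (cos \<theta>) / of_real ((sin \<theta>)\<^sup>2)) / of_real c" for \<theta> :: real
  define G where "G \<theta> = \<i> * F \<theta> / (of_real c * of_real (sin \<theta>))" for \<theta> :: real
  have nF: "norm (F \<theta>) = 1" for \<theta> by (simp add: F_def)
  have cF: "continuous_on A F" for A unfolding F_def by (intro continuous_intros)
  have sd: "sin \<theta> \<ge> sin \<delta>" "sin \<theta> > 0" if "\<theta> \<in> {\<delta>..pi/2}" for \<theta>
    using that \<delta> \<delta>2 by (auto intro!: sin_monotone_2pi_le sin_gt_zero)
  have sd0: "sin \<delta> \<ge> \<delta> / 2"
  proof -
    \<comment> \<open>sin \<delta> >= \<delta> - \<delta>^3 / 6, and \<delta>^3 <= \<delta>.\<close>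
    have "\<bar>sin \<delta> - \<delta>\<bar> \<le> \<bar>\<delta>\<bar> ^ 3 / 6"
      using Maclaurin_sin_bound[of \<delta> 3] by (simp add: numeral_3_eq_3 sin_coeff_def field_simps)
    moreover have "\<bar>\<delta>\<bar> ^ 3 \<le> \<delta>" using \<delta> power_decreasing[of 1 3 \<delta>] by simp
    ultimately show ?thesis using \<delta> by linarith
  qed
  have G: "(G has_vector_derivative (F \<theta> + R \<theta>)) (at \<theta> within {\<delta>..pi/2})" if "\<theta> \<in> {\<delta>..pi/2}" for \<theta>
  proof -
    have s: "complex_of_real (sin \<theta>) \<noteq> 0" using sd[OF that] by simp
    have "((\<lambda>z. \<i> * exp (\<i> * (of_int m * z + of_real c * cos z)) / (of_real c * sin z)) has_field_derivative (F \<theta> + R \<theta>)) (at (of_real \<theta>))"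
      using assms s unfolding F_def R_def
      apply (auto intro!: derivative_eq_intros simp: sin_of_real cos_of_real)
      apply (simp add: field_simps power2_eq_square)
      done
    then have "((\<lambda>x. \<i> * exp (\<i> * (of_int m * of_real x + of_real c * cos (of_real x))) / (of_real c * sin (of_real x))) has_vector_derivative (F \<theta> + R \<theta>)) (at \<theta>)"
      by (rule has_vector_derivative_real_field)
    then show ?thesis unfolding G_def[abs_def] F_def
      by (auto intro: has_vector_derivative_at_within simp flip: cos_of_real sin_of_real)
  qed
  have FR: "((\<lambda>\<theta>. F \<theta> + R \<theta>) has_integral (G (pi/2) - G \<delta>)) {\<delta>..pi/2}"
    using \<delta>2 by (intro fundamental_theorem_of_calculus G) auto
  have Rb: "norm (R \<theta>) \<le> (\<bar>of_int m\<bar> / sin \<delta> + cos \<theta> / (sin \<theta>)\<^sup>2) / a" if "\<theta> \<in> {\<delta>..pi/2}" for \<theta>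
  proof -
    have c0: "cos \<theta> \<ge> 0" using that \<delta> by (intro cos_ge_zero) auto
    have "norm (R \<theta>) = norm (of_int m / of_real (sin \<theta>) + \<i> * of_real (cos \<theta>) / of_real ((sin \<theta>)\<^sup>2)) / a"
      by (simp add: R_def norm_mult norm_divide nF a_def)
    also have "\<dots> \<le> (norm (of_int m / of_real (sin \<theta>) :: complex) + norm (\<i> * of_real (cos \<theta>) / of_real ((sin \<theta>)\<^sup>2) :: complex)) / a"
      using a by (intro divide_right_mono norm_triangle_ineq) auto
    also have "\<dots> = (\<bar>of_int m\<bar> / sin \<theta> + cos \<theta> / (sin \<theta>)\<^sup>2) / a"
      using sd(2)[OF that] c0 by (simp add: norm_divide norm_mult norm_power)
    also have "\<dots> \<le> (\<bar>of_int m\<bar> / sin \<delta> + cos \<theta> / (sin \<theta>)\<^sup>2) / a"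
      using sd[OF that] sd(2)[of \<delta>] \<delta> \<delta>2 a by (intro divide_right_mono add_right_mono divide_left_mono) auto
    finally show ?thesis .
  qed
  \<comment> \<open>Since cos / sin^2 has the primitive -1 / sin, the remainder costs no more than
    the boundary terms, up to the factor in m.\<close>
  have bi: "((\<lambda>\<theta>. (\<bar>of_int m\<bar> / sin \<delta> + cos \<theta> / (sin \<theta>)\<^sup>2) / a) has_integral
     ((\<bar>of_int m\<bar> / sin \<delta> * (pi/2) - 1 / sin (pi/2)) / a - (\<bar>of_int m\<bar> / sin \<delta> * \<delta> - 1 / sin \<delta>) / a)) {\<delta>..pi/2}"
    using \<delta>2 a sd(2)
    by (intro fundamental_theorem_of_calculus[where f="\<lambda>x. (\<bar>of_int m\<bar> / sin \<delta> * x - 1 / sin x) / a"])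
       (auto intro!: derivative_eq_intros simp flip: has_real_derivative_iff_has_vector_derivative
          simp: power2_eq_square less_imp_neq[symmetric])
  have cR: "continuous_on {\<delta>..pi/2} R"
    unfolding R_def using assms sd(2) by (intro continuous_intros cF) (auto simp: less_imp_neq[symmetric])
  have Ri: "R integrable_on {\<delta>..pi/2}" using cR by (rule integrable_continuous_interval)
  have "norm (integral {\<delta>..pi/2} R) \<le> ((\<bar>of_int m\<bar> / sin \<delta> * (pi/2) - 1 / sin (pi/2)) / a - (\<bar>of_int m\<bar> / sin \<delta> * \<delta> - 1 / sin \<delta>) / a)"
    using integral_norm_bound_integral[OF Ri has_integral_integrable[OF bi] Rb] bi by (simp add: has_integral_iff)
  also have "\<dots> \<le> (\<bar>of_int m\<bar> * 2 + 1) / (a * sin \<delta>)"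
  proof -
    have "\<bar>of_int m\<bar> * (pi/2) \<le> \<bar>of_int m\<bar> * 2"
      using pi_less_4 by (intro mult_left_mono) auto
    then have "(\<bar>of_int m\<bar> * (pi/2) + 1) / (sin \<delta> * a) \<le> (\<bar>of_int m\<bar> * 2 + 1) / (sin \<delta> * a)"
      using a sd(2)[of \<delta>] \<delta> \<delta>2 by (intro divide_right_mono) auto
    moreover have "(\<bar>of_int m\<bar> / sin \<delta> * (pi/2) - 1 / sin (pi/2)) / a - (\<bar>of_int m\<bar> / sin \<delta> * \<delta> - 1 / sin \<delta>) / a
      = (\<bar>of_int m\<bar> * (pi/2) + 1) / (sin \<delta> * a) - (1 + \<bar>of_int m\<bar> / sin \<delta> * \<delta>) / a"
      using a sd(2)[of \<delta>] \<delta> \<delta>2 by (simp add: field_simps)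
    moreover have "(1 + \<bar>of_int m\<bar> / sin \<delta> * \<delta>) / a \<ge> 0"
      using a sd(2)[of \<delta>] \<delta> \<delta>2 by simp
    ultimately show ?thesis by (simp add: mult.commute)
  qed
  finally have R: "norm (integral {\<delta>..pi/2} R) \<le> (\<bar>of_int m\<bar> * 2 + 1) / (a * sin \<delta>)" .
  have "integral {\<delta>..pi/2} F = G (pi/2) - G \<delta> - integral {\<delta>..pi/2} R"
    using has_integral_diff[OF FR integrable_integral[OF Ri]] by (simp add: integral_unique)
  moreover have "norm (G (pi/2)) \<le> 1 / (a * sin \<delta>)" "norm (G \<delta>) \<le> 1 / (a * sin \<delta>)"
    using a sd(1)[of "pi/2"] sd(2)[of \<delta>] \<delta> \<delta>2
    by (auto simp: G_def norm_divide norm_mult nF field_simps simp flip: a_def)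
  ultimately have "norm (integral {\<delta>..pi/2} F) \<le> (\<bar>of_int m\<bar> * 2 + 3) / (a * sin \<delta>)"
    using R norm_triangle_ineq4[of "G (pi/2) - G \<delta>" "integral {\<delta>..pi/2} R"] norm_triangle_ineq4[of "G (pi/2)" "G \<delta>"]
    by (simp add: add_divide_distrib)
  also have "\<dots> \<le> (\<bar>of_int m\<bar> * 2 + 3) / (a * (\<delta> / 2))"
    using a sd0 \<delta> by (intro divide_left_mono mult_left_mono mult_pos_pos) auto
  also have "a * (\<delta> / 2) = sqrt a / 2"
    using a by (simp add: \<delta>_def real_div_sqrt)
  also have "(\<bar>of_int m\<bar> * 2 + 3) / (sqrt a / 2) = (\<bar>of_int m\<bar> * 4 + 6) / sqrt a"
    using a by (simp add: field_simps)
  finally have 1: "norm (integral {\<delta>..pi/2} F) \<le> (\<bar>of_int m\<bar> * 4 + 6) / sqrt a" .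
  have "norm (integral {0..\<delta>} F) \<le> 1 * (\<delta> - 0)"
    using \<delta> by (intro integral_bound cF) (auto simp: nF)
  moreover have "integral {0..pi/2} F = integral {0..\<delta>} F + integral {\<delta>..pi/2} F"
    using \<delta> \<delta>2 by (intro Henstock_Kurzweil_Integration.integral_combine[symmetric] integrable_continuous_interval cF) auto
  ultimately have "norm (integral {0..pi/2} F) \<le> 1 / sqrt a + (\<bar>of_int m\<bar> * 4 + 6) / sqrt a"
    using 1 norm_triangle_ineq[of "integral {0..\<delta>} F" "integral {\<delta>..pi/2} F"] by (simp add: \<delta>_def)
  \<comment> \<open>1 from the piece near 0 and 4 |m| + 6 from the rest.\<close>
  also have "\<dots> \<le> 7 * (1 + \<bar>of_int m\<bar>) / sqrt a"
    using a by (simp add: field_simps)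
  finally show ?thesis by (simp add: F_def[abs_def] a_def)
qed

text \<open>Translation by pi changes the sign of the cosine and reflection that of m, so all four
  quarter periods reduce to \<open>exp_cos_quarter_bound\<close>, with either sign of c.\<close>

lemma norm_bes_decay:
  assumes "r > 0"
  shows "norm (bes m r) \<le> 5 * (1 + \<bar>of_int m\<bar>) / sqrt r"
proof -
  define F where "F m c \<theta> = exp (\<i> * of_real (of_int m * \<theta> + c * cos \<theta>))" for m :: int and c \<theta> :: real
  have cF: "continuous_on A (F m c)" for A m c unfolding F_def by (intro continuous_intros)
  have iF: "F m c integrable_on {a..b}" for a b m c by (intro integrable_continuous_interval cF)
  have sh: "F m c (\<theta> + pi) = exp (\<i> * of_real (of_int m * pi)) * F m (-c) \<theta>" for m c \<theta>
    by (simp add: F_def algebra_simps flip: exp_add)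
  have shI: "integral {a + pi..b + pi} (F m c) = exp (\<i> * of_real (of_int m * pi)) * integral {a..b} (F m (-c))" for a b m c
    using integral_shift[of a pi b "F m c"] cF by (simp add: o_def sh add.commute)
  have rf: "integral {-b..-a} (F m c) = integral {a..b} (F (-m) c)" for a b m c
    using Henstock_Kurzweil_Integration.integral_reflect_real[of b a "F (-m) c"] by (simp add: F_def[abs_def] algebra_simps)
  have tri: "norm (x + exp (\<i> * of_real y) * z) \<le> norm x + norm z" for x z y
    by (rule order_trans[OF norm_triangle_ineq]) (simp add: norm_mult)
  have Q: "norm (integral {0..pi/2} (F m c)) \<le> 7 * (1 + \<bar>of_int m\<bar>) / sqrt \<bar>c\<bar>" if "c \<noteq> 0" for m c
    using exp_cos_quarter_bound[OF that, of m] by (simp add: F_def[abs_def])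
  have Hf: "norm (integral {0..pi} (F m c)) \<le> 14 * (1 + \<bar>of_int m\<bar>) / sqrt \<bar>c\<bar>" if "c \<noteq> 0" for m c
  proof -
    have "integral {0..pi} (F m c) = integral {0..pi/2} (F m c) + integral {pi/2..pi} (F m c)"
      by (intro Henstock_Kurzweil_Integration.integral_combine[symmetric] iF) auto
    also have "integral {pi/2..pi} (F m c) = exp (\<i> * of_real (of_int m * pi)) * integral {0..pi/2} (F (-m) (-c))"
      using shI[of "-(pi/2)" 0 m c] rf[of "pi/2" 0 m "-c"] by simp
    finally have "norm (integral {0..pi} (F m c)) \<le> norm (integral {0..pi/2} (F m c)) + norm (integral {0..pi/2} (F (-m) (-c)))"
      using tri by (simp only:)
    then show ?thesis using Q[of c m] Q[of "-c" "-m"] that by (simp add: add_divide_distrib)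
  qed
  have "integral {0..2*pi} (F m (2*r)) = integral {0..pi} (F m (2*r)) + integral {pi..2*pi} (F m (2*r))"
    by (intro Henstock_Kurzweil_Integration.integral_combine[symmetric] iF) auto
  also have "integral {pi..2*pi} (F m (2*r)) = exp (\<i> * of_real (of_int m * pi)) * integral {0..pi} (F m (-(2*r)))"
    using shI[of 0 pi m "2*r"] by simp
  finally have "norm (integral {0..2*pi} (F m (2*r))) \<le> norm (integral {0..pi} (F m (2*r))) + norm (integral {0..pi} (F m (-(2*r))))"
    using tri by (simp only:)
  also have "\<dots> \<le> 28 * (1 + \<bar>of_int m\<bar>) / sqrt (2 * r)"
    using Hf[of "2*r" m] Hf[of "-(2*r)" m] assms by (simp add: add_divide_distrib)
  also have "\<dots> \<le> 28 * (1 + \<bar>of_int m\<bar>) / sqrt r"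
    using assms by (intro divide_left_mono) auto
  \<comment> \<open>Four quarters give 28, and 28 / (2 pi) <= 28 / 6 <= 5.\<close>
  finally have "norm (integral {0..2*pi} (F m (2*r))) / (2 * pi) \<le> 28 * (1 + \<bar>of_int m\<bar>) / sqrt r / (2 * 3)"
    using pi_gt3 assms by (intro frac_le) auto
  also have "\<dots> \<le> 5 * (1 + \<bar>of_int m\<bar>) / sqrt r"
    using assms by (simp add: field_simps)
  finally have *: "norm (integral {0..2*pi} (F m (2*r))) / (2 * pi) \<le> 5 * (1 + \<bar>of_int m\<bar>) / sqrt r" .
  have "bes m r = integral {0..2*pi} (F m (2*r)) / (2 * pi)"
    unfolding bes_eq_integral(2) F_def ..
  then have "norm (bes m r) = norm (integral {0..2*pi} (F m (2*r))) / (2 * pi)"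
    by (simp only: norm_divide norm_of_real) simp
  with * show ?thesis by (simp only:)
qed

subsection \<open>Gamma factors and admissible contours\<close>

text \<open>Makes |z + k| comparable with k + 1, uniformly in Re z >= -N and |Im z| >= 1: for k <= N
  the imaginary part suffices, for larger k the real part does.\<close>

lemma norm_ge_on_horizontal_line:
  assumes "\<bar>Im w\<bar> \<ge> 1" "Re w \<ge> real k - real N"
  shows "norm w \<ge> (real k + 1) / (real N + 2)"
proof (cases "k \<le> N")
  case True
  then have "(real k + 1) / (real N + 2) \<le> 1" by (simp add: field_simps)
  also have "\<dots> \<le> norm w" using assms(1) abs_Im_le_cmod[of w] by simp
  finally show ?thesis .
next
  case False
  then have 1: "real k \<ge> real N + 1" by linarith
  have "(real k + 1) \<le> (real k - real N) * (real N + 2)"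
  proof -
    have "(real N + 1) * (real N + 1) \<le> real k * (real N + 1)" using 1 by (intro mult_right_mono) auto
    then show ?thesis by (simp add: algebra_simps)
  qed
  then have "(real k + 1) / (real N + 2) \<le> real k - real N" by (simp add: field_simps)
  also have "\<dots> \<le> norm w" using assms(2) complex_Re_le_cmod[of w] by simp
  finally show ?thesis .
qed

text \<open>The limit formula for Digamma telescopes against Ln: the difference is the sum over k of
  Ln(u + 1) - Ln u - 1/u at u = z + k, each O(1 / (k + 1)^2) uniformly. As |Im z| >= 1, the branch
  cut is never met.\<close>

lemma Digamma_minus_Ln_bounded:
  fixes N :: nat
  obtains C where "\<And>z. \<bar>Im z\<bar> \<ge> 1 \<Longrightarrow> Re z \<ge> - real N \<Longrightarrow> norm (Digamma z - Ln z) \<le> C"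
proof
  fix z :: complex assume z: "\<bar>Im z\<bar> \<ge> 1" "Re z \<ge> - real N"
  define b where "b k = (real N + 2)\<^sup>2 * (1 / (real k + 1)\<^sup>2)" for k
  have "summable (\<lambda>k. 1 / (real (Suc k))\<^sup>2)"
    using inverse_power_summable[of 2, where 'a=real] by (subst summable_Suc_iff) (simp add: inverse_eq_divide)
  then have sb: "summable b" unfolding b_def by (intro summable_mult) (simp add: add.commute)
  have nr: "w \<notin> \<real>\<^sub>\<le>\<^sub>0" if "Im w = Im z" for w
    using that z by (auto simp: complex_nonpos_Reals_iff)
  have trm: "norm (Ln (z + of_nat (Suc k)) - Ln (z + of_nat k) - inverse (z + of_nat k)) \<le> b k" for k
  proof -
    define u where "u = z + of_nat k"
    have seg: "Im w = Im z" "Re w \<ge> real k - real N" "norm (w - u) \<le> 1" if "w \<in> closed_segment u (u + 1)" for w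
      using that z by (auto simp: closed_segment_def u_def algebra_simps)
    have gew: "norm w \<ge> (real k + 1) / (real N + 2)" if "w \<in> closed_segment u (u + 1)" for w
      by (rule norm_ge_on_horizontal_line) (use seg[OF that] z in auto)
    have gt0: "norm w > 0" if "w \<in> closed_segment u (u + 1)" for w
      using gew[OF that] by (rule less_le_trans[rotated]) simp
    have inv: "inverse (norm w) \<le> (real N + 2) / (real k + 1)" if "w \<in> closed_segment u (u + 1)" for w
      using le_imp_inverse_le[OF gew[OF that]] by simp
    \<comment> \<open>Mean value bound for Ln w - w / u, whose derivative 1/w - 1/u = (u - w) / (w
      u) is of second order.\<close>
    have "norm ((Ln (u + 1) - (u + 1) / u) - (Ln u - u / u)) \<le> b k * norm (u + 1 - u)"
    proof (rule field_differentiable_bound[where S = "closed_segment u (u + 1)" and f' = "\<lambda>w. inverse w - 1 / u"])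
      fix w assume w: "w \<in> closed_segment u (u + 1)"
      have u: "u \<in> closed_segment u (u + 1)" by simp
      show "((\<lambda>w. Ln w - w / u) has_field_derivative inverse w - 1 / u) (at w within closed_segment u (u + 1))"
        using nr[OF seg(1)[OF w]] gt0[OF u] by (auto intro!: derivative_eq_intros)
      have "inverse w - 1 / u = (u - w) * inverse w * inverse u"
        using gt0[OF w] gt0[OF u] by (simp add: field_simps)
      then have "norm (inverse w - 1 / u) = norm (w - u) * inverse (norm w) * inverse (norm u)"
        by (simp add: norm_mult norm_inverse norm_minus_commute)
      also have "\<dots> \<le> 1 * ((real N + 2) / (real k + 1)) * ((real N + 2) / (real k + 1))"
        by (intro mult_mono seg(3) inv w u) auto
      also have "\<dots> = b k" by (simp add: b_def power2_eq_square)
      finally show "norm (inverse w - 1 / u) \<le> b k" .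
    qed auto
    moreover have "u \<noteq> 0" using gt0[of u] by auto
    ultimately show ?thesis by (simp add: u_def field_simps)
  qed
  define T where "T m = (\<Sum>k<m. Ln (z + of_nat (Suc k)) - Ln (z + of_nat k) - inverse (z + of_nat k))" for m
  have Tb: "norm (T m) \<le> suminf b" for m
  proof -
    have "norm (T m) \<le> (\<Sum>k<m. b k)" unfolding T_def by (rule sum_norm_le) (use trm in auto)
    also have "\<dots> \<le> suminf b" by (rule sum_le_suminf[OF sb]) (auto simp: b_def)
    finally show ?thesis .
  qed
  have Teq: "T m = Ln (z + of_nat m) - Ln z - (\<Sum>k<m. inverse (z + of_nat k))" for m
    using sum_lessThan_telescope[of "\<lambda>k. Ln (z + of_nat k)" m] by (simp add: T_def sum_subtractf)
  have z0: "z \<noteq> 0" using z by auto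
  have "(\<lambda>m. Ln (1 + z / of_nat m)) \<longlonglongrightarrow> Ln (1 + 0)"
    by (intro tendsto_intros) (auto intro!: tendsto_divide_0 tendsto_of_nat)
  then have L: "(\<lambda>m. Ln (1 + z / of_nat m)) \<longlonglongrightarrow> 0" by simp
  \<comment> \<open>Trades ln m for Ln (z + m), the end of the telescoping sum, at the cost of Ln (1
    + z / m), which tends to 0.\<close>
  have "(\<lambda>m. (of_real (ln (real m)) - (\<Sum>k<m. inverse (z + of_nat k))) - Ln z + Ln (1 + z / of_nat m)) \<longlonglongrightarrow> Digamma z - Ln z + 0"
    by (intro tendsto_intros Digamma_LIMSEQ z0 L)
  moreover have "eventually (\<lambda>m. (of_real (ln (real m)) - (\<Sum>k<m. inverse (z + of_nat k))) - Ln z + Ln (1 + z / of_nat m) = T m) sequentially"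
    using eventually_gt_at_top[of 0]
  proof eventually_elim
    case (elim m)
    have "1 + z / of_nat m \<noteq> 0"
      using elim nr[of "z + of_nat m"] by (auto simp: field_simps)
    then have "Ln (of_real (real m) * (1 + z / of_nat m)) = of_real (ln (real m)) + Ln (1 + z / of_nat m)"
      using elim by (subst Ln_times_of_real) (auto simp: Ln_of_real Ln_of_nat)
    moreover have "of_real (real m) * (1 + z / of_nat m) = z + of_nat m"
      using elim by (simp add: field_simps)
    ultimately show ?case by (simp add: Teq)
  qed
  ultimately have "T \<longlonglongrightarrow> Digamma z - Ln z"
    by (simp add: tendsto_cong)
  from tendsto_norm[OF this] show "norm (Digamma z - Ln z) \<le> (\<Sum>k. (real N + 2)\<^sup>2 * (1 / (real k + 1)\<^sup>2))"
    unfolding b_def[symmetric] by (rule Lim_bounded) (use Tb in auto)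
qed

text \<open>Along a horizontal segment the derivative of ln Gamma(s) - s ln |t| is Digamma s - ln
  |t|, which is bounded by the preceding lemma. At equal heights the exponential decay in t cancels
  and only a power of |t| remains.\<close>

lemma Gamma_quotient_bound:
  fixes A B :: real
  obtains C where "C > 0" "\<And>u v t. u \<in> {A..B} \<Longrightarrow> v \<in> {A..B} \<Longrightarrow> \<bar>t\<bar> \<ge> 1 \<Longrightarrow>
     norm (Gamma (Complex u t)) \<le> C * \<bar>t\<bar> powr (u - v) * norm (Gamma (Complex v t))"
proof -
  obtain N :: nat where N: "- A \<le> real N" using real_arch_simple by blast
  obtain C0 where C0: "\<And>z. \<bar>Im z\<bar> \<ge> 1 \<Longrightarrow> Re z \<ge> - real N \<Longrightarrow> norm (Digamma z - Ln z) \<le> C0"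
    using Digamma_minus_Ln_bounded[of N] by blast
  \<comment> \<open>Bounds |Re s| and thereby ln (|s| / |t|); the argument of s contributes at most
    pi.\<close>
  define M where "M = \<bar>A\<bar> + \<bar>B\<bar>"
  define K where "K = C0 + (M + pi)"
  show ?thesis
  proof (rule that[of "exp (\<bar>K\<bar> * \<bar>B - A\<bar>)"])
    fix u v t :: real assume uv: "u \<in> {A..B}" "v \<in> {A..B}" and t: "\<bar>t\<bar> \<ge> 1"
    define z w where "z = Complex u t" and "w = Complex v t"
    have seg: "Im s = t \<and> Re s \<in> {A..B}" if "s \<in> closed_segment z w" for s
    proof -
      have "closed_segment z w \<subseteq> {s. Im s = t} \<inter> {s. A \<le> Re s} \<inter> {s. Re s \<le> B}"
        using uv by (intro closed_segment_subset convex_Int convex_halfspace_Re_le convex_halfspace_Re_ge)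
          (auto simp: z_def w_def convex_def algebra_simps simp flip: distrib_left distrib_right)
      then show ?thesis using that by auto
    qed
    have nr: "s \<notin> \<real>\<^sub>\<le>\<^sub>0" if "Im s = t" for s
      using that t by (auto simp: complex_nonpos_Reals_iff)
    have "norm ((ln_Gamma z - z * of_real (ln \<bar>t\<bar>)) - (ln_Gamma w - w * of_real (ln \<bar>t\<bar>))) \<le> K * norm (z - w)"
    proof (rule field_differentiable_bound[where S = "closed_segment z w" and f' = "\<lambda>s. Digamma s - of_real (ln \<bar>t\<bar>)"])
      fix s assume s: "s \<in> closed_segment z w"
      have st: "Im s = t" "A \<le> Re s" "Re s \<le> B" using seg[OF s] by auto
      show "((\<lambda>s. ln_Gamma s - s * of_real (ln \<bar>t\<bar>)) has_field_derivative Digamma s - of_real (ln \<bar>t\<bar>)) (at s within closed_segment z w)"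
        using nr[OF st(1)] by (auto intro!: derivative_eq_intros)
      have s0: "s \<noteq> 0" using st t by auto
      have 1: "norm (Digamma s - Ln s) \<le> C0" using st t N by (intro C0) auto
      have "norm (Ln s - of_real (ln \<bar>t\<bar>)) \<le> \<bar>Re (Ln s - of_real (ln \<bar>t\<bar>))\<bar> + \<bar>Im (Ln s - of_real (ln \<bar>t\<bar>))\<bar>"
        by (rule cmod_le)
      also have "\<bar>Im (Ln s - of_real (ln \<bar>t\<bar>))\<bar> \<le> pi"
        using s0 mpi_less_Im_Ln[of s] Im_Ln_le_pi[of s] by auto
      also have "\<bar>Re (Ln s - of_real (ln \<bar>t\<bar>))\<bar> \<le> M"
      proof -
        have "norm s \<le> \<bar>t\<bar> + M" using cmod_le[of s] st by (auto simp: M_def)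
        moreover have "norm s \<ge> \<bar>t\<bar>" using abs_Im_le_cmod[of s] st by simp
        ultimately have ns: "1 \<le> norm s / \<bar>t\<bar>" "norm s / \<bar>t\<bar> \<le> 1 + M / \<bar>t\<bar>"
          using t by (auto simp: field_simps)
        have "M / \<bar>t\<bar> \<le> M" using divide_left_mono[of 1 "\<bar>t\<bar>" M] t by (simp add: M_def)
        then have "norm s / \<bar>t\<bar> - 1 \<le> M" using ns by linarith
        moreover have "Re (Ln s - of_real (ln \<bar>t\<bar>)) = ln (norm s / \<bar>t\<bar>)"
          using s0 t by (simp add: ln_div)
        moreover have "0 \<le> ln (norm s / \<bar>t\<bar>)" "ln (norm s / \<bar>t\<bar>) \<le> norm s / \<bar>t\<bar> - 1"
          using ns by (auto intro!: ln_le_minus_one)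
        ultimately show ?thesis by auto
      qed
      finally have 2: "norm (Ln s - of_real (ln \<bar>t\<bar>)) \<le> M + pi" by simp
      have "norm (Digamma s - of_real (ln \<bar>t\<bar>)) \<le> norm (Digamma s - Ln s) + norm (Ln s - of_real (ln \<bar>t\<bar>))"
        using norm_triangle_ineq[of "Digamma s - Ln s" "Ln s - of_real (ln \<bar>t\<bar>)"] by simp
      then show "norm (Digamma s - of_real (ln \<bar>t\<bar>)) \<le> K" using 1 2 by (simp add: K_def)
    qed auto
    also have "\<dots> \<le> \<bar>K\<bar> * \<bar>B - A\<bar>"
    proof (intro mult_mono)
      have "z - w = of_real (u - v)" by (simp add: z_def w_def complex_eq_iff)
      then show "norm (z - w) \<le> \<bar>B - A\<bar>" using uv by (auto simp del: of_real_diff)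
    qed auto
    finally have "norm ((ln_Gamma z - z * of_real (ln \<bar>t\<bar>)) - (ln_Gamma w - w * of_real (ln \<bar>t\<bar>))) \<le> \<bar>K\<bar> * \<bar>B - A\<bar>" .
    then have "Re ((ln_Gamma z - z * of_real (ln \<bar>t\<bar>)) - (ln_Gamma w - w * of_real (ln \<bar>t\<bar>))) \<le> \<bar>K\<bar> * \<bar>B - A\<bar>"
      using complex_Re_le_cmod order_trans by blast
    then have "Re (ln_Gamma z) \<le> \<bar>K\<bar> * \<bar>B - A\<bar> + (u - v) * ln \<bar>t\<bar> + Re (ln_Gamma w)"
      by (simp add: z_def w_def algebra_simps)
    then have "exp (Re (ln_Gamma z)) \<le> exp (\<bar>K\<bar> * \<bar>B - A\<bar>) * exp ((u - v) * ln \<bar>t\<bar>) * exp (Re (ln_Gamma w))"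
      by (simp flip: exp_add)
    moreover have "exp ((u - v) * ln \<bar>t\<bar>) = \<bar>t\<bar> powr (u - v)"
      using t by (auto simp: powr_def)
    moreover have "norm (Gamma s) = exp (Re (ln_Gamma s))" if "Im s = t" for s
      using nr[OF that] by (auto simp: Gamma_complex_altdef norm_exp_eq_Re dest: nonpos_Ints_subset_nonpos_Reals[THEN subsetD])
    ultimately show "norm (Gamma (Complex u t)) \<le> exp (\<bar>K\<bar> * \<bar>B - A\<bar>) * \<bar>t\<bar> powr (u - v) * norm (Gamma (Complex v t))"
      by (simp add: z_def w_def)
  qed auto
qed

text \<open>Conjugation brings the denominator to the height of the numerator without changing its
  modulus; the real parts Re s + |k|/2 and 1 - Re s + |k|/2 then differ by 2 Re s - 1.\<close>

lemma Gk_bound: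
  fixes A B :: real
  obtains C where "C > 0" "\<And>s. A \<le> Re s \<Longrightarrow> Re s \<le> B \<Longrightarrow> \<bar>Im s\<bar> \<ge> 1 \<Longrightarrow>
     norm (Gk k s) \<le> C * \<bar>Im s\<bar> powr (2 * Re s - 1)"
proof -
  define a where "a = of_int \<bar>k\<bar> / (2::real)"
  \<comment> \<open>The range covers both Re s + a and 1 - Re s + a.\<close>
  obtain C where C: "C > 0" "\<And>u v t. u \<in> {min A (1 - B) + a..max B (1 - A) + a} \<Longrightarrow> v \<in> {min A (1 - B) + a..max B (1 - A) + a} \<Longrightarrow> \<bar>t\<bar> \<ge> 1 \<Longrightarrow>
     norm (Gamma (Complex u t)) \<le> C * \<bar>t\<bar> powr (u - v) * norm (Gamma (Complex v t))"
    using Gamma_quotient_bound by blast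
  show ?thesis
  proof (rule that[of "(2 * pi) powr (1 - 2 * A) * C"])
    fix s assume s: "A \<le> Re s" "Re s \<le> B" "\<bar>Im s\<bar> \<ge> 1"
    have 1: "s + of_int \<bar>k\<bar> / 2 = Complex (Re s + a) (Im s)" by (simp add: a_def complex_eq_iff)
    have "Gamma (1 - s + of_int \<bar>k\<bar> / 2) = cnj (Gamma (cnj (1 - s + of_int \<bar>k\<bar> / 2)))" by (simp add: cnj_Gamma)
    moreover have "cnj (1 - s + of_int \<bar>k\<bar> / 2) = Complex (1 - Re s + a) (Im s)" by (simp add: a_def complex_eq_iff)
    ultimately have 2: "norm (Gamma (1 - s + of_int \<bar>k\<bar> / 2)) = norm (Gamma (Complex (1 - Re s + a) (Im s)))"
      by (metis complex_mod_cnj)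
    have p1: "1 \<le> 2 * pi" using pi_gt3 by simp
    have "norm (complex_of_real (2 * pi) powr (1 - 2 * s)) = (2 * pi) powr (1 - 2 * Re s)"
      by (subst norm_powr_real) (auto simp: powr_def)
    also have "\<dots> \<le> (2 * pi) powr (1 - 2 * A)"
      using p1 s by (intro powr_mono) auto
    finally have 3: "norm (complex_of_real (2 * pi) powr (1 - 2 * s)) \<le> (2 * pi) powr (1 - 2 * A)" .
    have nz: "norm (Gamma (Complex (1 - Re s + a) (Im s))) > 0"
    proof -
      have "Complex (1 - Re s + a) (Im s) \<notin> \<int>\<^sub>\<le>\<^sub>0"
        using s by (auto elim!: nonpos_Ints_cases simp: complex_eq_iff)
      then show ?thesis by (simp add: Gamma_eq_zero_iff)
    qed
    have "norm (Gamma (Complex (Re s + a) (Im s))) \<le> C * \<bar>Im s\<bar> powr ((Re s + a) - (1 - Re s + a)) * norm (Gamma (Complex (1 - Re s + a) (Im s)))"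
      using s by (intro C) auto
    then have 4: "norm (Gamma (Complex (Re s + a) (Im s))) / norm (Gamma (Complex (1 - Re s + a) (Im s))) \<le> C * \<bar>Im s\<bar> powr (2 * Re s - 1)"
      using nz by (simp add: divide_le_eq algebra_simps)
    have "norm (Gk k s) = norm (complex_of_real (2 * pi) powr (1 - 2 * s)) * (norm (Gamma (Complex (Re s + a) (Im s))) / norm (Gamma (Complex (1 - Re s + a) (Im s))))"
      unfolding Gk_def 1 norm_mult norm_divide norm_power 2 by (simp add: 2)
    also have "\<dots> \<le> (2 * pi) powr (1 - 2 * A) * (C * \<bar>Im s\<bar> powr (2 * Re s - 1))"
      by (intro mult_mono 3 4) auto
    finally show "norm (Gk k s) \<le> (2 * pi) powr (1 - 2 * A) * C * \<bar>Im s\<bar> powr (2 * Re s - 1)"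
      by (simp add: mult_ac)
  qed (use C in auto)
qed

text \<open>Lets powers of |Im (s - \<mu>_l)| be replaced by powers of |Im s|: the quotient of the
  bases lies between 1/2 and 2.\<close>

lemma powr_shift_bound:
  fixes t b e E :: real
  assumes "\<bar>t\<bar> \<ge> 2 * \<bar>b\<bar>" "\<bar>t\<bar> > 0" "\<bar>e\<bar> \<le> E"
  shows "\<bar>t - b\<bar> powr e \<le> 2 powr E * \<bar>t\<bar> powr e"
proof -
  define q where "q = \<bar>t - b\<bar> / \<bar>t\<bar>"
  have "\<bar>t\<bar> \<le> 2 * \<bar>t - b\<bar>" "\<bar>t - b\<bar> \<le> 2 * \<bar>t\<bar>" using assms by (smt (verit))+
  then have q: "1/2 \<le> q" "q \<le> 2" using assms by (auto simp: q_def field_simps)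
  have "\<bar>ln q\<bar> \<le> ln 2"
    using q ln_le_cancel_iff[of "1/2" q] ln_le_cancel_iff[of q 2] by (auto simp: abs_le_iff ln_div)
  then have "\<bar>e * ln q\<bar> \<le> E * ln 2"
    unfolding abs_mult using assms(3) by (intro mult_mono) auto
  then have "q powr e \<le> 2 powr E"
    using q by (auto simp: powr_def)
  moreover have "\<bar>t - b\<bar> = q * \<bar>t\<bar>" using assms by (simp add: q_def)
  ultimately show ?thesis using q by (simp add: powr_mult mult_right_mono)
qed

text \<open>Induction on the number of factors, each adding 2 Re (s - \<mu>_l) - 1 to the
  exponent.\<close>

lemma Gmum_bound:
  fixes A B :: real
  obtains C T where "C > 0" "T \<ge> 1" "\<And>s. A \<le> Re s \<Longrightarrow> Re s \<le> B \<Longrightarrow> \<bar>Im s\<bar> \<ge> T \<Longrightarrow>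
     norm (Gmum n \<mu> m s) \<le> C * \<bar>Im s\<bar> powr (2 * real n * Re s - 2 * Re (\<Sum>l\<in>{1..n}. \<mu> l) - real n)"
proof -
  have "\<exists>C T. C > 0 \<and> T \<ge> 1 \<and> (\<forall>s. A \<le> Re s \<longrightarrow> Re s \<le> B \<longrightarrow> \<bar>Im s\<bar> \<ge> T \<longrightarrow>
     norm (Gmum n \<mu> m s) \<le> C * \<bar>Im s\<bar> powr (2 * real n * Re s - 2 * Re (\<Sum>l\<in>{1..n}. \<mu> l) - real n))"
  proof (induction n)
    case 0
    show ?case by (rule exI[of _ 1], rule exI[of _ 1]) (auto simp: Gmum_def)
  next
    case (Suc n)
    then obtain C T where CT: "C > 0" "T \<ge> 1" "\<And>s. A \<le> Re s \<Longrightarrow> Re s \<le> B \<Longrightarrow> \<bar>Im s\<bar> \<ge> T \<Longrightarrow>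
       norm (Gmum n \<mu> m s) \<le> C * \<bar>Im s\<bar> powr (2 * real n * Re s - 2 * Re (\<Sum>l\<in>{1..n}. \<mu> l) - real n)"
      by blast
    define w where "w = \<mu> (Suc n)"
    obtain D where D: "D > 0" "\<And>s. A - Re w \<le> Re s \<Longrightarrow> Re s \<le> B - Re w \<Longrightarrow> \<bar>Im s\<bar> \<ge> 1 \<Longrightarrow>
        norm (Gk (m (Suc n)) s) \<le> D * \<bar>Im s\<bar> powr (2 * Re s - 1)"
      using Gk_bound by blast
    define E where "E = 2 * \<bar>A - Re w\<bar> + 2 * \<bar>B - Re w\<bar> + 1"
    \<comment> \<open>Twice |Im w| for \<open>powr_shift_bound\<close>, and 2 more to keep |Im (s -
      w)| >= 1.\<close>
    define T' where "T' = max T (2 * \<bar>Im w\<bar> + 2)"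
    show ?case
    proof (rule exI[of _ "C * (D * 2 powr E)"], rule exI[of _ T'], intro conjI allI impI)
      fix s assume s: "A \<le> Re s" "Re s \<le> B" "\<bar>Im s\<bar> \<ge> T'"
      then have t: "\<bar>Im s\<bar> \<ge> T" "\<bar>Im s\<bar> \<ge> 2 * \<bar>Im w\<bar>" "\<bar>Im s\<bar> > 0" "\<bar>Im (s - w)\<bar> \<ge> 1" by (auto simp: T'_def)
      have "norm (Gk (m (Suc n)) (s - w)) \<le> D * \<bar>Im (s - w)\<bar> powr (2 * Re (s - w) - 1)"
        using s t by (intro D) auto
      also have "\<dots> \<le> D * (2 powr E * \<bar>Im s\<bar> powr (2 * Re (s - w) - 1))"
      proof -
        have aux: "\<bar>2 * x - 1\<bar> \<le> 2 * \<bar>a\<bar> + 2 * \<bar>b\<bar> + 1" if "a \<le> x" "x \<le> b" for a b x :: real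
          using that by (auto simp: abs_if)
        have "\<bar>2 * Re (s - w) - 1\<bar> \<le> E" unfolding E_def by (rule aux) (use s in auto)
        then show ?thesis
          unfolding minus_complex.sel(2) using t D(1) by (intro mult_left_mono powr_shift_bound) auto
      qed
      finally have 1: "norm (Gk (m (Suc n)) (s - w)) \<le> D * 2 powr E * \<bar>Im s\<bar> powr (2 * Re (s - w) - 1)" by simp
      have "norm (Gmum (Suc n) \<mu> m s) = norm (Gmum n \<mu> m s) * norm (Gk (m (Suc n)) (s - w))"
        by (simp add: Gmum_def w_def norm_mult mult.commute)
      also have "\<dots> \<le> (C * \<bar>Im s\<bar> powr (2 * real n * Re s - 2 * Re (\<Sum>l\<in>{1..n}. \<mu> l) - real n)) * (D * 2 powr E * \<bar>Im s\<bar> powr (2 * Re (s - w) - 1))"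
        using s t by (intro mult_mono CT 1) (use CT in auto)
      also have "\<dots> = C * (D * 2 powr E) * \<bar>Im s\<bar> powr ((2 * real n * Re s - 2 * Re (\<Sum>l\<in>{1..n}. \<mu> l) - real n) + (2 * Re (s - w) - 1))"
        by (simp add: powr_add mult_ac)
      also have "(2 * real n * Re s - 2 * Re (\<Sum>l\<in>{1..n}. \<mu> l) - real n) + (2 * Re (s - w) - 1) =
         2 * real (Suc n) * Re s - 2 * Re (\<Sum>l\<in>{1..Suc n}. \<mu> l) - real (Suc n)"
        by (simp add: w_def algebra_simps)
      finally show "norm (Gmum (Suc n) \<mu> m s) \<le> C * (D * 2 powr E) * \<bar>Im s\<bar> powr (2 * real (Suc n) * Re s - 2 * Re (\<Sum>l\<in>{1..Suc n}. \<mu> l) - real (Suc n))" .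
    qed (use CT D in \<open>auto simp: T'_def\<close>)
  qed
  then show ?thesis using that by blast
qed

section \<open>Moving the contour to a vertical line\<close>

lemma integrable_powr_decay:
  fixes \<phi> :: "real \<Rightarrow> complex"
  assumes c: "continuous_on UNIV \<phi>" and e: "e < -1" and T: "T \<ge> 1"
    and b: "\<And>t. \<bar>t\<bar> \<ge> T \<Longrightarrow> norm (\<phi> t) \<le> C * \<bar>t\<bar> powr e"
  shows "integrable lborel \<phi>"
proof -
  have [measurable]: "\<phi> \<in> borel_measurable borel" using c by (rule borel_measurable_continuous_onI)
  have "set_integrable lebesgue {T..} (\<lambda>x. x powr e)"
    using has_integral_powr_to_inf[OF e, of T] T
    by (intro nonnegative_absolutely_integrable_1) auto
  then have i1: "integrable lborel (\<lambda>x. indicat_real {T..} x *\<^sub>R x powr e)"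
    unfolding set_integrable_def by (subst (asm) integrable_completion) auto
  then have i2: "integrable lborel (\<lambda>x. indicat_real {T..} (0 + (-1) * x) *\<^sub>R (0 + (-1) * x) powr e)"
    by (rule lborel_integrable_real_affine) simp
  have i3: "integrable lborel (\<lambda>x. indicat_real {-T..T} x *\<^sub>R \<phi> x)"
    by (intro borel_integrable_compact continuous_on_subset[OF c]) auto
  have i: "integrable lborel (\<lambda>x. norm (indicat_real {-T..T} x *\<^sub>R \<phi> x)
     + \<bar>C\<bar> * (indicat_real {T..} x *\<^sub>R x powr e) + \<bar>C\<bar> * (indicat_real {T..} (0 + (-1) * x) *\<^sub>R (0 + (-1) * x) powr e))"
    using i1 i2 i3 by (intro Bochner_Integration.integrable_add integrable_norm integrable_mult_right) auto
  show ?thesis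
  proof (rule Bochner_Integration.integrable_bound[OF i])
    show "AE x in lborel. norm (\<phi> x) \<le> norm (norm (indicat_real {-T..T} x *\<^sub>R \<phi> x)
     + \<bar>C\<bar> * (indicat_real {T..} x *\<^sub>R x powr e) + \<bar>C\<bar> * (indicat_real {T..} (0 + (-1) * x) *\<^sub>R (0 + (-1) * x) powr e))"
    proof (rule AE_I2)
      fix x
      have nn: "0 \<le> norm (indicat_real {-T..T} x *\<^sub>R \<phi> x)" "0 \<le> \<bar>C\<bar> * (indicat_real {T..} x *\<^sub>R x powr e)"
        "0 \<le> \<bar>C\<bar> * (indicat_real {T..} (0 + (-1) * x) *\<^sub>R (0 + (-1) * x) powr e)" by auto
      have b': "norm (\<phi> x) \<le> \<bar>C\<bar> * \<bar>x\<bar> powr e" if "\<bar>x\<bar> \<ge> T"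
        by (rule order_trans[OF b[OF that]]) (auto intro!: mult_right_mono)
      consider "\<bar>x\<bar> \<le> T" | "x \<ge> T" | "- x \<ge> T" by linarith
      then have "norm (\<phi> x) \<le> norm (indicat_real {-T..T} x *\<^sub>R \<phi> x)
     + \<bar>C\<bar> * (indicat_real {T..} x *\<^sub>R x powr e) + \<bar>C\<bar> * (indicat_real {T..} (0 + (-1) * x) *\<^sub>R (0 + (-1) * x) powr e)"
      proof cases
        case 1
        then have "norm (\<phi> x) = norm (indicat_real {-T..T} x *\<^sub>R \<phi> x)" by (simp add: indicator_def abs_le_iff)
        then show ?thesis using nn by linarith
      next
        case 2
        then have "\<bar>C\<bar> * (indicat_real {T..} x *\<^sub>R x powr e) = \<bar>C\<bar> * \<bar>x\<bar> powr e" using T by simp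
        then show ?thesis using nn b' 2 by linarith
      next
        case 3
        then have "\<bar>C\<bar> * (indicat_real {T..} (0 + (-1) * x) *\<^sub>R (0 + (-1) * x) powr e) = \<bar>C\<bar> * \<bar>x\<bar> powr e" using T by simp
        then show ?thesis using nn b' 3 by linarith
      qed
      then show "norm (\<phi> x) \<le> norm (norm (indicat_real {-T..T} x *\<^sub>R \<phi> x)
     + \<bar>C\<bar> * (indicat_real {T..} x *\<^sub>R x powr e) + \<bar>C\<bar> * (indicat_real {T..} (0 + (-1) * x) *\<^sub>R (0 + (-1) * x) powr e))"
        using nn by simp
    qed
  qed auto
qed

lemma integral_interval_tendsto:
  fixes \<phi> :: "real \<Rightarrow> complex"
  assumes "integrable lborel \<phi>"
  shows "(\<lambda>n. integral {- real n..real n} \<phi>) \<longlonglongrightarrow> (LINT t|lborel. \<phi> t)"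
proof -
  have [measurable]: "\<phi> \<in> borel_measurable borel" using assms by auto
  have si: "set_integrable lborel A \<phi>" if "A \<in> sets borel" for A
    unfolding set_integrable_def using assms that by (intro integrable_mult_indicator) auto
  have "integral {- real n..real n} \<phi> = (LINT t|lborel. indicat_real {- real n..real n} t *\<^sub>R \<phi> t)" for n
    using set_borel_integral_eq_integral(2)[OF si[of "{- real n..real n}"]] by (simp add: set_lebesgue_integral_def)
  moreover have "(\<lambda>n. LINT t|lborel. indicat_real {- real n..real n} t *\<^sub>R \<phi> t) \<longlonglongrightarrow> (LINT t|lborel. \<phi> t)"
  proof (rule integral_dominated_convergence[where w="\<lambda>t. norm (\<phi> t)"])
    show "AE t in lborel. (\<lambda>n. indicat_real {- real n..real n} t *\<^sub>R \<phi> t) \<longlonglongrightarrow> \<phi> t"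
    proof (rule AE_I2)
      fix t
      have "eventually (\<lambda>n. indicat_real {- real n..real n} t *\<^sub>R \<phi> t = \<phi> t) sequentially"
        using eventually_ge_at_top[of "nat \<lceil>\<bar>t\<bar>\<rceil>"]
        by eventually_elim (auto simp: indicator_def; linarith)
      then show "(\<lambda>n. indicat_real {- real n..real n} t *\<^sub>R \<phi> t) \<longlonglongrightarrow> \<phi> t"
        by (rule tendsto_eventually)
    qed
  qed (use assms in \<open>auto simp: indicator_def\<close>)
  ultimately show ?thesis by simp
qed

text \<open>The shear sending s to s - h(Im s) maps the region homeomorphically onto a
  half-plane.\<close>

lemma simply_connected_right_of_graph:
  assumes "continuous_on UNIV h"
  shows "open {s. h (Im s) < Re s}" "simply_connected {s. h (Im s) < Re s}"
proof -
  have cI: "continuous_on A (\<lambda>s. h (Im s))" for A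
    by (rule continuous_on_compose2[OF assms]) (auto intro!: continuous_intros)
  show "open {s. h (Im s) < Re s}"
    by (intro open_Collect_less cI continuous_intros)
  have "{s. h (Im s) < Re s} homeomorphic {s. Re s > 0}"
  proof (rule homeomorphicI[where f="\<lambda>s. s - of_real (h (Im s))" and g="\<lambda>s. s + of_real (h (Im s))"])
    show "(\<lambda>s. s - of_real (h (Im s))) ` {s. h (Im s) < Re s} = {s. Re s > 0}" (is "?f ` ?A = ?B")
    proof (intro equalityI subsetI)
      show "s \<in> ?f ` ?A" if "s \<in> ?B" for s
        using that by (intro image_eqI[of _ _ "s + of_real (h (Im s))"]) auto
    qed auto
    show "(\<lambda>s. s + of_real (h (Im s))) ` {s. Re s > 0} = {s. h (Im s) < Re s}" (is "?f ` ?A = ?B")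
    proof (intro equalityI subsetI)
      show "s \<in> ?f ` ?A" if "s \<in> ?B" for s
        using that by (intro image_eqI[of _ _ "s - of_real (h (Im s))"]) auto
    qed auto
  qed (auto intro!: continuous_intros cI)
  then show "simply_connected {s. h (Im s) < Re s}"
    by (simp add: homeomorphic_simply_connected_eq convex_imp_simply_connected convex_halfspace_Re_gt)
qed

text \<open>Division by Gamma is multiplication by the entire function rGamma, also at the poles,
  where Gamma takes the value 0; so only the poles of the numerator have to be excluded.\<close>

lemma Gk_holomorphic:
  assumes "\<And>s. s \<in> S \<Longrightarrow> s - w + of_int \<bar>k\<bar> / 2 \<notin> \<int>\<^sub>\<le>\<^sub>0"
  shows "(\<lambda>s. Gk k (s - w)) holomorphic_on S"
proof -
  have "(\<lambda>s. \<i> ^ nat \<bar>k\<bar> * of_real (2 * pi) powr (1 - 2 * (s - w)) * Gamma (s - w + of_int \<bar>k\<bar> / 2)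
      * rGamma (1 - (s - w) + of_int \<bar>k\<bar> / 2)) holomorphic_on S"
    using assms by (intro holomorphic_intros) auto
  then show ?thesis unfolding Gk_def rGamma_inverse_Gamma divide_inverse .
qed

text \<open>The region to the right of both contours is simply connected and free of poles, so the integrand
  has a primitive there, and the two truncated integrals differ by the integral over two horizontal
  segments, on which the integrand decays.\<close>

lemma contour_value_eq:
  assumes f: "admissible_contour n \<mu> m \<sigma> f" and g: "admissible_contour n \<mu> m \<sigma>0 (\<lambda>_. \<sigma>0)"
    and x: "x > 0" and n: "n \<ge> 1"
  shows "contour_value n \<mu> m f x = contour_value n \<mu> m (\<lambda>_. \<sigma>0) x"
    and "integrable lborel (\<lambda>t. Gmum n \<mu> m (Complex \<sigma>0 t) * of_real x powr (- 2 * Complex \<sigma>0 t))"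
proof -
  define F where "F s = Gmum n \<mu> m s * of_real x powr (- 2 * s)" for s
  \<comment> \<open>\<open>r l\<close> is the abscissa of the rightmost pole of the l-th factor,
    whose poles all have height Im \<mu>_l. Moving the left envelope of the two contours to the left
    by the smallest gap \<open>\<epsilon>\<close> gives \<open>h\<close>, which no pole
    exceeds.\<close>
  define r where "r l = Re (\<mu> l) - of_int \<bar>m l\<bar> / 2" for l
  define q where "q l = min (f (Im (\<mu> l))) \<sigma>0 - r l" for l
  define \<epsilon> where "\<epsilon> = Min (q ` {1..n})"
  define h where "h t = min (f t) \<sigma>0 - \<epsilon>" for t
  define S where "S = {s. h (Im s) < Re s}"
  have cf: "f C1_differentiable_on UNIV" using f by (simp add: admissible_contour_def)
  then have contf: "continuous_on UNIV f"
    by (simp add: C1_differentiable_on_eq continuous_at_imp_continuous_on differentiable_imp_continuous_within)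
  have df: "(f has_vector_derivative deriv f t) (at t)" for t
  proof -
    have "f differentiable (at t)" using cf by (simp add: C1_differentiable_on_eq)
    then show ?thesis
      by (metis DERIV_deriv_iff_real_differentiable has_real_derivative_iff_has_vector_derivative)
  qed
  have cdf: "continuous_on UNIV (deriv f)"
  proof -
    have "vector_derivative f (at t) = deriv f t" for t using df by (rule vector_derivative_at)
    then show ?thesis using cf by (simp add: C1_differentiable_on_eq)
  qed
  have q: "q l > 0" if "l \<in> {1..n}" for l
  proof -
    have "Re (\<mu> l - of_int \<bar>m l\<bar> / 2 - of_nat 0 / 2) < f (Im (\<mu> l - of_int \<bar>m l\<bar> / 2 - of_nat 0 / 2))"
      using f that unfolding admissible_contour_def Let_def by blast
    moreover have "Re (\<mu> l - of_int \<bar>m l\<bar> / 2 - of_nat 0 / 2) < \<sigma>0"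
      using g that unfolding admissible_contour_def Let_def by blast
    ultimately show ?thesis by (simp add: q_def r_def)
  qed
  have e: "\<epsilon> > 0" "\<And>l. l \<in> {1..n} \<Longrightarrow> r l \<le> h (Im (\<mu> l))"
  proof -
    show "\<epsilon> > 0" unfolding \<epsilon>_def using q n by (subst Min_gr_iff) auto
    fix l assume "l \<in> {1..n}"
    then have "\<epsilon> \<le> q l" unfolding \<epsilon>_def by (intro Min_le) auto
    then show "r l \<le> h (Im (\<mu> l))" by (simp add: h_def q_def)
  qed
  have hc: "continuous_on UNIV h" unfolding h_def by (intro continuous_intros contf)
  note S = simply_connected_right_of_graph[OF hc, folded S_def]
  have hol: "F holomorphic_on S"
    unfolding F_def Gmum_def
  proof (intro holomorphic_intros Gk_holomorphic)
    fix l s assume l: "l \<in> {1..n}" and s: "s \<in> S"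
    show "s - \<mu> l + of_int \<bar>m l\<bar> / 2 \<notin> \<int>\<^sub>\<le>\<^sub>0"
    proof
      assume "s - \<mu> l + of_int \<bar>m l\<bar> / 2 \<in> \<int>\<^sub>\<le>\<^sub>0"
      then obtain k :: nat where "s - \<mu> l + of_int \<bar>m l\<bar> / 2 = - of_nat k" by (auto elim!: nonpos_Ints_cases')
      then have "Im s = Im (\<mu> l)" "Re s = r l - real k" by (auto simp: complex_eq_iff r_def)
      then show False using e(2)[OF l] s by (simp add: S_def)
    qed
  qed
  obtain \<Phi> where \<Phi>: "\<And>z. z \<in> S \<Longrightarrow> (\<Phi> has_field_derivative F z) (at z)"
    using S(2) hol simply_connected_eq_global_primitive[OF S(1)] by blast
  obtain T0 where T0: "\<And>t. \<bar>t\<bar> \<ge> T0 \<Longrightarrow> f t = \<sigma>" and \<sigma>: "\<sigma> < 1/2 + (2 * Re (\<Sum>l\<in>{1..n}. \<mu> l) - 1) / (2 * real n)"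
    using f unfolding admissible_contour_def by blast
  have \<sigma>0: "\<sigma>0 < 1/2 + (2 * Re (\<Sum>l\<in>{1..n}. \<mu> l) - 1) / (2 * real n)"
    using g unfolding admissible_contour_def by blast
  \<comment> \<open>Decay exponent at the larger abscissa. The bound on \<sigma> in
    \<open>admissible_contour\<close> says exactly that it is below -1.\<close>
  define e0 where "e0 = 2 * real n * max \<sigma> \<sigma>0 - 2 * Re (\<Sum>l\<in>{1..n}. \<mu> l) - real n"
  have "2 * real n * max \<sigma> \<sigma>0 < 2 * real n * (1/2 + (2 * Re (\<Sum>l\<in>{1..n}. \<mu> l) - 1) / (2 * real n))"
    using \<sigma> \<sigma>0 n by (intro mult_strict_left_mono) auto
  also have "\<dots> = real n + (2 * Re (\<Sum>l\<in>{1..n}. \<mu> l) - 1)" using n by (simp add: field_simps)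
  finally have e0: "e0 < -1" by (simp add: e0_def)
  obtain C1 T1 where C1: "C1 > 0" "T1 \<ge> 1" "\<And>s. min \<sigma> \<sigma>0 \<le> Re s \<Longrightarrow> Re s \<le> max \<sigma> \<sigma>0 \<Longrightarrow> \<bar>Im s\<bar> \<ge> T1 \<Longrightarrow>
     norm (Gmum n \<mu> m s) \<le> C1 * \<bar>Im s\<bar> powr (2 * real n * Re s - 2 * Re (\<Sum>l\<in>{1..n}. \<mu> l) - real n)"
    using Gmum_bound by blast
  define T where "T = max T0 T1"
  \<comment> \<open>x^(-2 Re s) is monotone in Re s, hence below the sum of its values at the two
    ends.\<close>
  define C where "C = C1 * (x powr (- 2 * min \<sigma> \<sigma>0) + x powr (- 2 * max \<sigma> \<sigma>0))"
  have FC: "norm (F s) \<le> C * \<bar>Im s\<bar> powr e0"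
    if "min \<sigma> \<sigma>0 \<le> Re s" "Re s \<le> max \<sigma> \<sigma>0" "\<bar>Im s\<bar> \<ge> T" for s
  proof -
    have "norm (Gmum n \<mu> m s) \<le> C1 * \<bar>Im s\<bar> powr (2 * real n * Re s - 2 * Re (\<Sum>l\<in>{1..n}. \<mu> l) - real n)"
      using that by (intro C1) (auto simp: T_def)
    also have "\<dots> \<le> C1 * \<bar>Im s\<bar> powr e0"
      using that C1 unfolding e0_def T_def by (intro mult_left_mono powr_mono diff_right_mono) auto
    finally have 1: "norm (Gmum n \<mu> m s) \<le> C1 * \<bar>Im s\<bar> powr e0" .
    have "norm (of_real x powr (- 2 * s)) = x powr (- 2 * Re s)"
      using x by (subst norm_powr_real) (auto simp: powr_def)
    also have "\<dots> \<le> x powr (- 2 * min \<sigma> \<sigma>0) + x powr (- 2 * max \<sigma> \<sigma>0)"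
    proof (cases "x \<ge> 1")
      case True
      then have "x powr (- 2 * Re s) \<le> x powr (- 2 * min \<sigma> \<sigma>0)" using that by (intro powr_mono) auto
      then show ?thesis by (simp add: add_increasing2)
    next
      case False
      then have "x powr (- 2 * Re s) \<le> x powr (- 2 * max \<sigma> \<sigma>0)" using that x by (intro powr_mono') auto
      then show ?thesis by (simp add: add_increasing)
    qed
    finally have "norm (F s) \<le> C1 * \<bar>Im s\<bar> powr e0 * (x powr (- 2 * min \<sigma> \<sigma>0) + x powr (- 2 * max \<sigma> \<sigma>0))"
      unfolding F_def norm_mult using 1 by (intro mult_mono) (use C1 in auto)
    then show ?thesis by (simp add: C_def mult_ac)
  qed
  \<comment> \<open>Stated for a general graph \<open>u\<close>, since it serves both for
    \<open>f\<close> and for the constant contour.\<close>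
  have main: "integrable lborel (\<lambda>t. F (Complex (u t) t) * (of_real (deriv u t) + \<i>))"
    "integral {- real k..real k} (\<lambda>t. F (Complex (u t) t) * (of_real (deriv u t) + \<i>)) =
       \<Phi> (Complex (u (real k)) (real k)) - \<Phi> (Complex (u (- real k)) (- real k))"
    if u: "\<And>t. h t < u t" "\<And>t. (u has_vector_derivative deriv u t) (at t)" "continuous_on UNIV (deriv u)"
       "\<And>t. \<bar>t\<bar> \<ge> T \<Longrightarrow> u t = \<tau>" "\<tau> \<in> {\<sigma>, \<sigma>0}" for u \<tau> k
  proof -
    have uS: "Complex (u t) t \<in> S" for t using u(1) by (simp add: S_def)
    have cu: "continuous_on UNIV u"
      using u(2) by (meson continuous_at_imp_continuous_on has_vector_derivative_continuous)
    have "continuous_on UNIV (\<lambda>t. F (Complex (u t) t))"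
      by (rule continuous_on_compose2[OF holomorphic_on_imp_continuous_on[OF hol]])
         (use uS in \<open>auto intro!: continuous_intros cu simp: Complex_eq\<close>)
    then have c: "continuous_on UNIV (\<lambda>t. F (Complex (u t) t) * (of_real (deriv u t) + \<i>))"
      by (intro continuous_intros u(3))
    show "integrable lborel (\<lambda>t. F (Complex (u t) t) * (of_real (deriv u t) + \<i>))"
    proof (rule integrable_powr_decay[OF c e0, of "T + 1" C])
      show "T + 1 \<ge> 1" using C1 by (simp add: T_def)
      \<comment> \<open>One unit beyond \<open>T\<close>, \<open>u\<close> is constant on a whole
        neighbourhood of t, so its derivative vanishes there.\<close>
      fix t :: real assume t: "\<bar>t\<bar> \<ge> T + 1"
      have "(u has_vector_derivative 0) (at t)"
      proof (rule has_vector_derivative_transform_within_open[where f="\<lambda>_. \<tau>" and S="ball t 1"])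
        show "\<tau> = u y" if "y \<in> ball t 1" for y
          using that t u(4)[of y] by (auto simp: dist_real_def)
      qed auto
      then have "deriv u t = 0" using u(2)[of t] vector_derivative_unique_at by blast
      then show "norm (F (Complex (u t) t) * (of_real (deriv u t) + \<i>)) \<le> C * \<bar>t\<bar> powr e0"
        using FC[of "Complex (u t) t"] t u(4)[of t] u(5) by (auto simp: norm_mult)
    qed
    have "((\<lambda>t. F (Complex (u t) t) * (of_real (deriv u t) + \<i>)) has_integral
       (\<Phi> (Complex (u (real k)) (real k)) - \<Phi> (Complex (u (- real k)) (- real k)))) {- real k..real k}"
    proof (rule fundamental_theorem_of_calculus)
      fix t :: real
      have "((\<lambda>t. of_real (u t) + \<i> * of_real t) has_vector_derivative (of_real (deriv u t) + \<i> * of_real 1)) (at t)"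
        by (intro has_vector_derivative_add has_vector_derivative_of_real has_vector_derivative_mult_right u(2)[folded has_real_derivative_iff_has_vector_derivative] DERIV_ident)
      then have "((\<lambda>t. Complex (u t) t) has_vector_derivative (of_real (deriv u t) + \<i>)) (at t)"
        by (simp add: Complex_eq)
      from field_vector_diff_chain_at[OF this \<Phi>[OF uS]]
      show "((\<lambda>t. \<Phi> (Complex (u t) t)) has_vector_derivative F (Complex (u t) t) * (of_real (deriv u t) + \<i>)) (at t within {- real k..real k})"
        by (auto simp: o_def mult.commute intro: has_vector_derivative_at_within)
    qed auto
    then show "integral {- real k..real k} (\<lambda>t. F (Complex (u t) t) * (of_real (deriv u t) + \<i>)) =
       \<Phi> (Complex (u (real k)) (real k)) - \<Phi> (Complex (u (- real k)) (- real k))"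
      by (rule integral_unique)
  qed
  have fu: "h t < f t" "h t < \<sigma>0" for t using e by (auto simp: h_def)
  note mf = main[of f \<sigma>, OF fu(1) df cdf]
  note mg = main[of "\<lambda>_. \<sigma>0" \<sigma>0, OF fu(2)]
  have Tf: "f t = \<sigma>" if "\<bar>t\<bar> \<ge> T" for t using T0[of t] that by (simp add: T_def)
  define I where "I u = (LINT t|lborel. F (Complex (u t) t) * (of_real (deriv u t) + \<i>))" for u
  have lf: "(\<lambda>k. \<Phi> (Complex (f (real k)) (real k)) - \<Phi> (Complex (f (- real k)) (- real k))) \<longlonglongrightarrow> I f"
    using integral_interval_tendsto[OF mf(1)] mf(2) Tf by (simp add: I_def)
  have lg: "(\<lambda>k. \<Phi> (Complex \<sigma>0 (real k)) - \<Phi> (Complex \<sigma>0 (- real k))) \<longlonglongrightarrow> I (\<lambda>_. \<sigma>0)"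
  proof -
    have "(\<lambda>k. integral {- real k..real k} (\<lambda>t. F (Complex \<sigma>0 t) * (of_real (deriv (\<lambda>_. \<sigma>0) t) + \<i>))) \<longlonglongrightarrow> I (\<lambda>_. \<sigma>0)"
      unfolding I_def by (rule integral_interval_tendsto, rule mg(1)) auto
    moreover have "integral {- real k..real k} (\<lambda>t. F (Complex \<sigma>0 t) * (of_real (deriv (\<lambda>_. \<sigma>0) t) + \<i>))
       = \<Phi> (Complex \<sigma>0 (real k)) - \<Phi> (Complex \<sigma>0 (- real k))" for k
      by (rule mg(2)) auto
    ultimately show ?thesis by (simp only:)
  qed
  \<comment> \<open>At height b k the values of the primitive on the two contours differ by an
    integral over a segment of length |\<sigma> - \<sigma>0|, with integrand O(k^e0).\<close>
  have hor: "(\<lambda>k. \<Phi> (Complex (f (b k)) (b k)) - \<Phi> (Complex \<sigma>0 (b k))) \<longlonglongrightarrow> 0"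
    if b: "\<And>k. \<bar>b k\<bar> = real k" for b
  proof (rule Lim_null_comparison)
    show "eventually (\<lambda>k. norm (\<Phi> (Complex (f (b k)) (b k)) - \<Phi> (Complex \<sigma>0 (b k))) \<le> C * real k powr e0 * \<bar>\<sigma> - \<sigma>0\<bar>) sequentially"
      using eventually_ge_at_top[of "nat \<lceil>T\<rceil>"]
    proof eventually_elim
      case (elim k)
      have bT: "\<bar>b k\<bar> \<ge> T" using elim b[of k] by linarith
      have "norm (\<Phi> (Complex \<sigma> (b k)) - \<Phi> (Complex \<sigma>0 (b k))) \<le> C * real k powr e0 * norm (Complex \<sigma> (b k) - Complex \<sigma>0 (b k))"
      proof (rule field_differentiable_bound[where S="closed_segment (Complex \<sigma> (b k)) (Complex \<sigma>0 (b k))"])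
        fix s assume "s \<in> closed_segment (Complex \<sigma> (b k)) (Complex \<sigma>0 (b k))"
        moreover have "closed_segment (Complex \<sigma> (b k)) (Complex \<sigma>0 (b k)) \<subseteq> {s. Im s = b k} \<inter> {s. min \<sigma> \<sigma>0 \<le> Re s} \<inter> {s. Re s \<le> max \<sigma> \<sigma>0}"
          by (intro closed_segment_subset convex_Int convex_halfspace_Re_le convex_halfspace_Re_ge)
             (auto simp: convex_def algebra_simps simp flip: distrib_left distrib_right)
        ultimately have s: "Im s = b k" "min \<sigma> \<sigma>0 \<le> Re s" "Re s \<le> max \<sigma> \<sigma>0" by auto
        then have "s \<in> S" using e(1) Tf[OF bT] by (auto simp: S_def h_def)
        then show "(\<Phi> has_field_derivative F s) (at s within closed_segment (Complex \<sigma> (b k)) (Complex \<sigma>0 (b k)))"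
          using \<Phi> has_field_derivative_at_within by blast
        show "norm (F s) \<le> C * real k powr e0" using FC[OF s(2,3)] s(1) bT b by simp
      qed auto
      moreover have "norm (Complex \<sigma> (b k) - Complex \<sigma>0 (b k)) = \<bar>\<sigma> - \<sigma>0\<bar>" by (simp add: cmod_def)
      ultimately show ?case using Tf[OF bT] by simp
    qed
    have "(\<lambda>k. real k powr e0) \<longlonglongrightarrow> 0"
      using e0 by (intro tendsto_neg_powr filterlim_real_sequentially) auto
    then show "(\<lambda>k. C * real k powr e0 * \<bar>\<sigma> - \<sigma>0\<bar>) \<longlonglongrightarrow> 0"
      by (auto intro!: tendsto_mult_left_zero tendsto_mult_right_zero)
  qed
  have "(\<lambda>k. (\<Phi> (Complex (f (real k)) (real k)) - \<Phi> (Complex (f (- real k)) (- real k)))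
      - (\<Phi> (Complex (f (real k)) (real k)) - \<Phi> (Complex \<sigma>0 (real k))) + (\<Phi> (Complex (f (- real k)) (- real k)) - \<Phi> (Complex \<sigma>0 (- real k)))) \<longlonglongrightarrow> I f - 0 + 0"
    by (intro tendsto_add tendsto_diff lf hor) auto
  then have "(\<lambda>k. \<Phi> (Complex \<sigma>0 (real k)) - \<Phi> (Complex \<sigma>0 (- real k))) \<longlonglongrightarrow> I f"
    by (simp add: algebra_simps)
  then have "I f = I (\<lambda>_. \<sigma>0)" using lg LIMSEQ_unique by blast
  then show "contour_value n \<mu> m f x = contour_value n \<mu> m (\<lambda>_. \<sigma>0) x"
    by (simp add: I_def F_def contour_value_def)
  have "integrable lborel (\<lambda>t. F (Complex \<sigma>0 t) * (of_real (deriv (\<lambda>_. \<sigma>0) t) + \<i>))"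
    by (rule mg(1)) auto
  \<comment> \<open>On a vertical line ds = i dt; the factor -i removes the i.\<close>
  from integrable_mult_left[OF this, of "- \<i>"]
  show "integrable lborel (\<lambda>t. Gmum n \<mu> m (Complex \<sigma>0 t) * of_real x powr (- 2 * Complex \<sigma>0 t))"
    by (simp add: F_def mult.assoc)
qed

subsection \<open>The Mellin transform of a Bessel function\<close>

lemma integrable_exp_neg_abs:
  assumes "c > (0::real)"
  shows "integrable lborel (\<lambda>u. exp (- c * \<bar>u\<bar>))"
proof -
  have "set_integrable lebesgue {0..} (\<lambda>x. exp (- c * x))"
    using has_integral_exp_minus_to_infinity[OF assms, of 0] 
    by (intro nonnegative_absolutely_integrable_1) auto
  then have i1: "integrable lborel (\<lambda>x. indicat_real {0..} x *\<^sub>R exp (- c * x))"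
    unfolding set_integrable_def by (subst (asm) integrable_completion) auto
  then have i2: "integrable lborel (\<lambda>x. indicat_real {0..} (0 + (-1) * x) *\<^sub>R exp (- c * (0 + (-1) * x)))"
    by (rule lborel_integrable_real_affine) simp
  show ?thesis
    by (rule Bochner_Integration.integrable_bound[OF Bochner_Integration.integrable_add[OF i1 i2]])
       (auto intro!: AE_I2 simp: indicator_def)
qed

text \<open>exp(\<alpha> u) controls the left end, exp((\<alpha> - 1/2) u) the right end. With
  \<alpha> = 2 Re s this is the origin of the strip 0 < Re s < 1/4.\<close>

lemma integrable_exp_min:
  fixes \<alpha> :: real
  assumes "0 < \<alpha>" "\<alpha> < 1/2"
  shows "integrable lborel (\<lambda>u. exp (\<alpha> * u) * min 1 (exp (- u / 2)))"
proof (rule Bochner_Integration.integrable_bound[OF integrable_exp_neg_abs[of "min \<alpha> (1/2 - \<alpha>)"]])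
  show "AE u in lborel. norm (exp (\<alpha> * u) * min 1 (exp (- u / 2))) \<le> norm (exp (- min \<alpha> (1/2 - \<alpha>) * \<bar>u\<bar>))"
  proof (rule AE_I2)
    fix u :: real
    show "norm (exp (\<alpha> * u) * min 1 (exp (- u / 2))) \<le> norm (exp (- min \<alpha> (1/2 - \<alpha>) * \<bar>u\<bar>))"
    proof (cases "u \<ge> 0")
      case True
      have "min \<alpha> (1/2 - \<alpha>) * u \<le> (1/2 - \<alpha>) * u" using True by (intro mult_right_mono) auto
      then have "exp (\<alpha> * u) * exp (- u / 2) \<le> exp (- min \<alpha> (1/2 - \<alpha>) * u)"
        by (simp add: algebra_simps flip: exp_add)
      moreover have "exp (\<alpha> * u) * min 1 (exp (- u / 2)) \<le> exp (\<alpha> * u) * exp (- u / 2)" by simp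
      ultimately show ?thesis using True by simp
    next
      case False
      then have "min \<alpha> (1/2 - \<alpha>) * (-u) \<le> \<alpha> * (-u)" by (intro mult_right_mono) auto
      then have "exp (\<alpha> * u) \<le> exp (- min \<alpha> (1/2 - \<alpha>) * (-u))" by simp
      moreover have "exp (\<alpha> * u) * min 1 (exp (- u / 2)) \<le> exp (\<alpha> * u) * 1" by (intro mult_left_mono) auto
      ultimately show ?thesis using False by simp
    qed
  qed
qed (use assms in auto)

lemma norm_bes_le_min:
  assumes "r > 0"
  shows "norm (bes m r) \<le> 5 * (1 + \<bar>of_int m\<bar>) * min 1 (1 / sqrt r)"
  using norm_bes_decay[OF assms, of m] norm_bes_le_1[of m r] by (simp add: min_def) linarith

lemma bes_exp_integrable:
  assumes "0 < Re s" "Re s < 1/4"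
  shows "integrable lborel (\<lambda>w. bes m (exp w) * exp (2 * s * of_real w))"
proof (rule Bochner_Integration.integrable_bound)
  show "integrable lborel (\<lambda>w. 5 * (1 + \<bar>of_int m\<bar>) * (exp (2 * Re s * w) * min 1 (exp (- w / 2))))"
    using assms by (intro integrable_mult_right integrable_exp_min) auto
  show "AE w in lborel. norm (bes m (exp w) * exp (2 * s * of_real w)) \<le> norm (5 * (1 + \<bar>of_int m\<bar>) * (exp (2 * Re s * w) * min 1 (exp (- w / 2))))"
  proof (rule AE_I2)
    fix w :: real
    have "sqrt (exp w) = exp (w / 2)"
      by (rule real_sqrt_unique) (simp_all add: power2_eq_square flip: exp_add)
    then have "1 / sqrt (exp w) = exp (- w / 2)"
      by (simp add: exp_minus inverse_eq_divide)
    then have "norm (bes m (exp w)) \<le> 5 * (1 + \<bar>of_int m\<bar>) * min 1 (exp (- w / 2))"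
      using norm_bes_le_min[of "exp w" m] by simp
    then have "norm (bes m (exp w)) * exp (2 * Re s * w) \<le> 5 * (1 + \<bar>of_int m\<bar>) * min 1 (exp (- w / 2)) * exp (2 * Re s * w)"
      by (rule mult_right_mono) simp
    then show "norm (bes m (exp w) * exp (2 * s * of_real w)) \<le> norm (5 * (1 + \<bar>of_int m\<bar>) * (exp (2 * Re s * w) * min 1 (exp (- w / 2))))"
      by (simp add: norm_mult mult_ac min_def)
  qed
qed measurable

lemma gamma_log_integral_scaled:
  fixes w :: complex
  assumes "Re w > 0" "c \<noteq> 0"
  shows "integrable lborel (\<lambda>v. exp (w * of_real (b + c * v)) * of_real (exp (- exp (b + c * v))))"
    and "(LINT v|lborel. exp (w * of_real (b + c * v)) * of_real (exp (- exp (b + c * v)))) = Gamma w / \<bar>c\<bar>"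
proof -
  show "integrable lborel (\<lambda>v. exp (w * of_real (b + c * v)) * of_real (exp (- exp (b + c * v))))"
    using lborel_integrable_real_affine[OF Gamma_log_integral(1)[OF assms(1)] assms(2)] .
  show "(LINT v|lborel. exp (w * of_real (b + c * v)) * of_real (exp (- exp (b + c * v)))) = Gamma w / \<bar>c\<bar>"
    using lborel_integral_real_affine[OF assms(2), of "\<lambda>u. exp (w * of_real u) * of_real (exp (- exp u))" b]
      Gamma_log_integral(2)[OF assms(1)] assms(2)
    by (simp add: scaleR_conv_of_real field_simps)
qed

text \<open>The substitution u = ln p + 2 v in Euler's integral for Gamma(k + 1).\<close>

lemma weber_term:
  assumes p: "p > 0"
  shows "integrable lborel (\<lambda>v. exp (real (2 * (k + 1)) * v) * exp (- p * exp (2 * v)))"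
    and "(LINT v|lborel. exp (real (2 * (k + 1)) * v) * exp (- p * exp (2 * v))) = fact k / (2 * p ^ (k + 1))"
proof -
  define \<phi> where "\<phi> v = exp (real (2 * (k + 1)) * v) * exp (- p * exp (2 * v))" for v
  have eq: "exp (of_nat (k + 1) * of_real (ln p + 2 * v)) * of_real (exp (- exp (ln p + 2 * v))) = (of_real (p ^ (k + 1) * \<phi> v) :: complex)" for v
  proof -
    have "exp (real (k + 1) * (ln p + 2 * v)) = p ^ (k + 1) * exp (real (2 * (k + 1)) * v)"
      using p by (simp add: distrib_left exp_add exp_of_nat_mult mult_ac flip: powr_realpow)
    moreover have "exp (- exp (ln p + 2 * v)) = exp (- p * exp (2 * v))" using p by (simp add: exp_add)
    ultimately have "exp (real (k + 1) * (ln p + 2 * v)) * exp (- exp (ln p + 2 * v)) = p ^ (k + 1) * \<phi> v" by (simp add: \<phi>_def)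
    from arg_cong[OF this, of complex_of_real] show ?thesis by (simp flip: exp_of_real)
  qed
  note G = gamma_log_integral_scaled[of "of_nat (k + 1)" 2 "ln p", unfolded eq]
  have "integrable lborel (\<lambda>v. complex_of_real (p ^ (k + 1) * \<phi> v))" using G(1) by simp
  then have "integrable lborel (\<lambda>v. p ^ (k + 1) * \<phi> v)" by (simp only: complex_of_real_integrable_eq)
  then show "integrable lborel \<phi>" using p by simp
  have "complex_of_real (p ^ (k + 1) * (LINT v|lborel. \<phi> v)) = (LINT v|lborel. complex_of_real (p ^ (k + 1) * \<phi> v))"
    by (simp only: integral_complex_of_real integral_mult_right_zero)
  also have "\<dots> = Gamma (of_nat (k + 1)) / 2" using G(2) by simp
  also have "\<dots> = complex_of_real (fact k / 2)" by (simp add: Gamma_fact)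
  finally have "p ^ (k + 1) * (LINT v|lborel. \<phi> v) = fact k / 2" by (simp only: of_real_eq_iff)
  then show "(LINT v|lborel. \<phi> v) = fact k / (2 * p ^ (k + 1))" using p by (simp add: field_simps)
qed

text \<open>With y = exp v this is Weber's integral of J_n(2 y) y^(n + 1) exp(-p y^2) dy. The weight
  makes the factor (a + n)! of the Bessel series cancel, which leaves the exponential series at
  -1/p; the integrals of the norms give the one at 1/p.\<close>

lemma weber_integral:
  fixes n :: nat
  assumes p: "p > 0"
  shows "integrable lborel (\<lambda>v. bes (int n) (exp v) * of_real (exp (real (n + 2) * v) * exp (- p * exp (2 * v))))"
    and "(LINT v|lborel. bes (int n) (exp v) * of_real (exp (real (n + 2) * v) * exp (- p * exp (2 * v)))) =
       \<i> ^ n / 2 * of_real (exp (- 1 / p) / p ^ (n + 1))"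
proof -
  define \<phi> where "\<phi> k v = exp (real (2 * (k + 1)) * v) * exp (- p * exp (2 * v))" for k :: nat and v
  note W = weber_term[OF p, folded \<phi>_def]
  define f where "f a v = (\<i> ^ (2 * a + n) / (fact a * fact (a + n))) * complex_of_real (\<phi> (a + n) v)" for a v
  have fe: "f a v = (\<i> * exp v) ^ (2 * a + n) / (fact a * fact (a + n)) * of_real (exp (real (n + 2) * v) * exp (- p * exp (2 * v)))" for a v
  proof -
    have "exp v ^ (2 * a + n) * exp (real (n + 2) * v) = exp (real (2 * (a + n + 1)) * v)"
      by (simp add: exp_of_nat_mult[symmetric] exp_add[symmetric] algebra_simps)
    then have "complex_of_real (\<phi> (a + n) v) = of_real (exp v ^ (2 * a + n)) * of_real (exp (real (n + 2) * v) * exp (- p * exp (2 * v)))"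
      unfolding \<phi>_def of_real_mult[symmetric] by (simp add: mult.assoc[symmetric])
    then show ?thesis by (simp add: f_def power_mult_distrib)
  qed
  have fi: "integrable lborel (f a)" for a
    unfolding f_def using W(1) by (intro integrable_mult_right) (simp only: complex_of_real_integrable_eq)
  have fI: "(LINT v|lborel. f a v) = \<i> ^ n / 2 * of_real (1 / p ^ (n + 1)) * ((- of_real (1/p)) ^ a / fact a)" for a
  proof -
    have "(LINT v|lborel. f a v) = \<i> ^ (2 * a + n) / (fact a * fact (a + n)) * of_real (fact (a + n) / (2 * p ^ (a + n + 1)))"
      unfolding f_def by (simp only: integral_mult_right_zero integral_complex_of_real W(2))
    moreover have "(\<i> ^ a)\<^sup>2 = (-1) ^ a"
      by (metis power2_i power_mult mult.commute)
    ultimately have "(LINT v|lborel. f a v) = \<i> ^ n / 2 * of_real (1 / p ^ (n + 1)) * ((- of_real (1/p)) ^ a / fact a)"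
      using p by (simp add: power_add power_mult field_simps power_minus[of "_ / _"] power_divide)
    then show ?thesis .
  qed
  have pos: "\<phi> k v > 0" for k v by (simp add: \<phi>_def)
  have fN: "(LINT v|lborel. norm (f a v)) = 1 / (2 * p ^ (n + 1)) * ((1/p) ^ a / fact a)" for a
  proof -
    have "(LINT v|lborel. norm (f a v)) = (LINT v|lborel. 1 / (fact a * fact (a + n)) * \<phi> (a + n) v)"
      using pos by (intro Bochner_Integration.integral_cong refl) (simp add: f_def norm_mult norm_divide norm_power abs_of_pos)
    also have "\<dots> = 1 / (fact a * fact (a + n)) * (fact (a + n) / (2 * p ^ (a + n + 1)))"
      by (simp only: integral_mult_right_zero W(2))
    also have "\<dots> = 1 / (2 * p ^ (n + 1)) * ((1/p) ^ a / fact a)"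
      by (simp add: power_add field_simps power_divide)
    finally show ?thesis .
  qed
  have "(\<lambda>a. (1/p) ^ a / fact a) summable_on UNIV"
    using exp_has_sum_real[of "1/p"] p by (auto simp: summable_on_def)
  then have sN: "summable (\<lambda>a. LINT v|lborel. norm (f a v))"
    unfolding fN by (intro summable_mult summable_on_imp_summable)
  have hs: "((\<lambda>a. f a v) has_sum bes (int n) (exp v) * of_real (exp (real (n + 2) * v) * exp (- p * exp (2 * v)))) UNIV" for v
    unfolding fe by (intro has_sum_cmult_left bes_series)
  then have sf: "(\<Sum>a. f a v) = bes (int n) (exp v) * of_real (exp (real (n + 2) * v) * exp (- p * exp (2 * v)))" for v
    using has_sum_imp_sums sums_unique by metis
  have nf: "summable (\<lambda>a. norm (f a v))" for v
  proof -
    have "(\<lambda>a. f a v) summable_on UNIV" using hs by (auto simp: summable_on_def)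
    then have "(\<lambda>a. norm (f a v)) summable_on UNIV" by (simp add: summable_on_iff_abs_summable_on_complex)
    then show ?thesis by (rule summable_on_imp_summable)
  qed
  have "integrable lborel (\<lambda>v. \<Sum>a. f a v)"
    by (rule integrable_suminf[OF fi _ sN]) (use nf in auto)
  then show "integrable lborel (\<lambda>v. bes (int n) (exp v) * of_real (exp (real (n + 2) * v) * exp (- p * exp (2 * v))))"
    by (simp only: sf)
  have "(\<lambda>a. LINT v|lborel. f a v) sums (LINT v|lborel. (\<Sum>a. f a v))"
    by (rule sums_integral[OF fi _ sN]) (use nf in auto)
  moreover have "(\<lambda>a. LINT v|lborel. f a v) sums (\<i> ^ n / 2 * of_real (1 / p ^ (n + 1)) * exp (- of_real (1/p)))"
    unfolding fI by (intro sums_mult has_sum_imp_sums exp_has_sum)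
  ultimately have "(LINT v|lborel. (\<Sum>a. f a v)) = \<i> ^ n / 2 * of_real (1 / p ^ (n + 1)) * exp (- of_real (1/p))"
    using sums_unique2 by blast
  then show "(LINT v|lborel. bes (int n) (exp v) * of_real (exp (real (n + 2) * v) * exp (- p * exp (2 * v)))) =
       \<i> ^ n / 2 * of_real (exp (- 1 / p) / p ^ (n + 1))"
    by (simp add: sf exp_of_real[symmetric])
qed

text \<open>Weber's integral, integrated against a power of its parameter, turns into a Gamma integral on
  either side; this avoids any regularisation of the Mellin integral itself.\<close>

lemma bes_mellin:
  assumes s: "0 < Re s" "Re s < 1/4"
  shows "(LINT w|lborel. bes m (exp w) * exp (2 * s * of_real w)) =
     \<i> ^ nat \<bar>m\<bar> / 2 * Gamma (s + of_int \<bar>m\<bar> / 2) / Gamma (1 - s + of_int \<bar>m\<bar> / 2)"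
proof -
  define n where "n = nat \<bar>m\<bar>"
  have bm: "bes m r = bes (int n) r" for r by (simp add: n_def bes_abs)
  have nm: "(of_int \<bar>m\<bar> :: complex) = of_nat n" by (simp add: n_def)
  \<comment> \<open>The exponent of p = exp u against which Weber's integral is taken: the
    u-integral yields exp(-2 v z), and n + 2 - 2 z = 2 s.\<close>
  define z where "z = 1 - s + of_nat n / 2"
  have z: "Re z > 0" using s by (simp add: z_def)
  define H where "H = (\<lambda>(v, u). bes (int n) (exp v) * of_real (exp (real (n + 2) * v)) * (exp (z * of_real u) * of_real (exp (- exp (u + 2 * v)))))"
  have Gi: "integrable lborel (\<lambda>u. exp (w * of_real u) * of_real (exp (- exp (u + 2 * v))))"
    and GI: "(LINT u|lborel. exp (w * of_real u) * of_real (exp (- exp (u + 2 * v)))) = exp (- 2 * of_real v * w) * Gamma w"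
    if "Re w > 0" for v :: real and w :: complex
  proof -
    have eq: "exp (w * of_real u) * of_real (exp (- exp (u + 2 * v))) =
        exp (- 2 * of_real v * w) * (exp (w * of_real (2 * v + 1 * u)) * of_real (exp (- exp (2 * v + 1 * u))))" for u
      by (simp add: algebra_simps exp_add exp_minus exp_diff)
    show "integrable lborel (\<lambda>u. exp (w * of_real u) * of_real (exp (- exp (u + 2 * v))))"
      unfolding eq by (intro integrable_mult_right gamma_log_integral_scaled that) simp
    show "(LINT u|lborel. exp (w * of_real u) * of_real (exp (- exp (u + 2 * v)))) = exp (- 2 * of_real v * w) * Gamma w"
      unfolding eq integral_mult_right_zero by (subst gamma_log_integral_scaled(2)[OF that]) auto
  qed
  have Hi: "integrable (lborel \<Otimes>\<^sub>M lborel) H"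
  proof (rule lborel_pair.Fubini_integrable)
    show "H \<in> borel_measurable (lborel \<Otimes>\<^sub>M lborel)" unfolding H_def by measurable
    show "AE v in lborel. integrable lborel (\<lambda>u. H (v, u))"
      unfolding H_def by (auto intro!: integrable_mult_right Gi[OF z])
    \<comment> \<open>Integrating the norm over u first leaves the absolute value of the Mellin
      integrand times a constant, which is integrable in the strip.\<close>
    have "(LINT u|lborel. norm (H (v, u))) = norm (bes m (exp v) * exp (2 * s * of_real v)) * norm (Gamma (of_real (Re z) :: complex))" for v
    proof -
      have "complex_of_real (LINT u|lborel. norm (exp (z * of_real u) * of_real (exp (- exp (u + 2 * v)))))
         = (LINT u|lborel. exp (of_real (Re z) * of_real u) * of_real (exp (- exp (u + 2 * v))))"
        unfolding integral_complex_of_real[symmetric]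
        by (intro Bochner_Integration.integral_cong refl) (simp add: norm_mult flip: exp_of_real)
      also have "\<dots> = exp (- 2 * of_real v * of_real (Re z)) * Gamma (of_real (Re z) :: complex)"
        by (rule GI) (use z in simp)
      finally have "(LINT u|lborel. norm (exp (z * of_real u) * of_real (exp (- exp (u + 2 * v)))))
         = norm (exp (- 2 * of_real v * of_real (Re z)) * Gamma (complex_of_real (Re z)))"
        by (metis (no_types, lifting) norm_of_real abs_of_nonneg Bochner_Integration.integral_nonneg norm_ge_zero)
      then have "(LINT u|lborel. norm (H (v, u))) = norm (bes (int n) (exp v)) * exp (real (n + 2) * v) * norm (exp (- 2 * of_real v * of_real (Re z)) * Gamma (complex_of_real (Re z)))"
        unfolding H_def by (simp add: norm_mult)
      then show ?thesis
        by (simp add: norm_mult bm z_def algebra_simps flip: exp_add)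
    qed
    then show "integrable lborel (\<lambda>v. LINT u|lborel. norm (H (v, u)))"
      using bes_exp_integrable[OF s, of m] by simp
  qed
  have "(LINT v|lborel. LINT u|lborel. H (v, u)) = (LINT v|lborel. bes m (exp v) * exp (2 * s * of_real v) * Gamma z)"
  proof (intro Bochner_Integration.integral_cong refl)
    fix v :: real
    have "(LINT u|lborel. H (v, u)) = bes (int n) (exp v) * (of_real (exp (real (n + 2) * v)) * (exp (- 2 * of_real v * z) * Gamma z))"
      unfolding H_def by (simp only: prod.case integral_mult_right_zero GI[OF z] mult.assoc)
    also have "of_real (exp (real (n + 2) * v)) * (exp (- 2 * of_real v * z) * Gamma z) = exp (2 * s * of_real v) * Gamma z"
      by (simp add: z_def algebra_simps flip: exp_of_real exp_add)
    finally show "(LINT u|lborel. H (v, u)) = bes m (exp v) * exp (2 * s * of_real v) * Gamma z"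
      by (simp add: bm mult.assoc)
  qed
  moreover have "(LINT u|lborel. LINT v|lborel. H (v, u)) = \<i> ^ n / 2 * Gamma (s + of_nat n / 2)"
  proof -
    \<comment> \<open>In the other order, Weber's integral at p = exp u leaves a Gamma integral in
      -u with exponent n + 1 - z = s + n / 2.\<close>
    have "(LINT v|lborel. H (v, u)) = \<i> ^ n / 2 * (exp ((s + of_nat n / 2) * of_real (0 + (-1) * u)) * of_real (exp (- exp (0 + (-1) * u))))" for u
    proof -
      have "(LINT v|lborel. H (v, u)) = (LINT v|lborel. exp (z * of_real u) * (bes (int n) (exp v) * of_real (exp (real (n + 2) * v) * exp (- exp u * exp (2 * v)))))"
        unfolding H_def by (intro Bochner_Integration.integral_cong refl) (simp add: exp_add mult_ac)
      also have "\<dots> = exp (z * of_real u) * (\<i> ^ n / 2 * of_real (exp (- 1 / exp u) / exp u ^ (n + 1)))"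
        by (simp only: integral_mult_right_zero weber_integral(2)[OF exp_gt_zero])
      also have "exp (- 1 / exp u) / exp u ^ (n + 1) = exp (- real (n + 1) * u) * exp (- exp (- u))"
        by (simp add: exp_of_nat_mult[symmetric] exp_minus field_simps) (simp flip: exp_add)
      also have "exp (z * of_real u) * (\<i> ^ n / 2 * of_real (exp (- real (n + 1) * u) * exp (- exp (- u)))) =
        \<i> ^ n / 2 * (exp ((s + of_nat n / 2) * of_real (0 + (-1) * u)) * of_real (exp (- exp (0 + (-1) * u))))"
        by (simp add: z_def algebra_simps flip: exp_of_real exp_add)
           (rule arg_cong[where f=exp], simp add: algebra_simps)
      finally show ?thesis .
    qed
    then show ?thesis
      using s by (simp only: integral_mult_right_zero) (subst gamma_log_integral_scaled(2), auto)
  qed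
  moreover have "(LINT v|lborel. LINT u|lborel. H (v, u)) = (LINT u|lborel. LINT v|lborel. H (v, u))"
    using lborel_pair.Fubini_integral[of "\<lambda>v u. H (v, u)"] Hi by (simp add: case_prod_eta)
  ultimately have "(LINT v|lborel. bes m (exp v) * exp (2 * s * of_real v)) * Gamma z = \<i> ^ n / 2 * Gamma (s + of_nat n / 2)"
    by simp
  moreover have "Gamma z \<noteq> 0" using z by (auto simp: Gamma_eq_zero_iff elim!: nonpos_Ints_cases)
  ultimately show ?thesis by (simp add: nm flip: n_def z_def) (simp add: field_simps)
qed

subsection \<open>Expansion of the oscillatory integral\<close>

lemma product_sigma_finite_lborel: "product_sigma_finite (\<lambda>_. lborel :: real measure)"
  by standard

lemma indicator_Ball_eq_prod:
  assumes "finite I"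
  shows "indicat_real {y. \<forall>l\<in>I. y l \<in> A} y = (\<Prod>l\<in>I. indicat_real A (y l))"
proof (cases "\<forall>l\<in>I. y l \<in> A")
  case True then show ?thesis by (simp add: indicator_def)
next
  case False
  then obtain l where "l \<in> I" "indicat_real A (y l) = 0" by auto
  then have "(\<Prod>l\<in>I. indicat_real A (y l)) = 0" by (intro prod_zero[OF assms]) blast
  with False show ?thesis by (simp add: indicator_def)
qed

text \<open>Only the term 2 x y_1 ... y_d cos(...) is expanded, since it alone couples the angles.
  Each exp(i q (\<theta>_1 + ... + \<theta>_d + \<phi>)) factorises and raises every frequency k_l
  by q.\<close>

lemma Jk_has_sum:
  "((\<lambda>q. bes q (x * (\<Prod>l\<in>{1..d}. y l)) * exp (\<i> * of_real (of_int q * \<phi>)) * (2 * pi) ^ d *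
      (\<Prod>l\<in>{1..d}. bes (k l + q) (x * inverse (y l)))) has_sum Jk d k y x \<phi>) UNIV"
proof -
  interpret product_sigma_finite "\<lambda>_. lborel :: real measure" by (rule product_sigma_finite_lborel)
  define r where "r = x * (\<Prod>l\<in>{1..d}. y l)"
  define e where "e q l t = indicat_real {0..2*pi} t *\<^sub>R exp (\<i> * of_real (of_int (k l + q) * t + 2 * (x * inverse (y l)) * cos t))" for q l t
  define f where "f q \<theta> = bes q r * exp (\<i> * of_real (of_int q * \<phi>)) * (\<Prod>l\<in>{1..d}. e q l (\<theta> l))" for q \<theta>
  define F where "F \<theta> = indicat_real {\<theta>. \<forall>l\<in>{1..d}. \<theta> l \<in> {0..2*pi}} \<theta> *\<^sub>R exp (\<i> * of_real (Theta d k \<theta> y x \<phi>))" for \<theta>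
  have ei: "integrable lborel (e q l)" for q l
    using bes_eq_integral(1)[of "k l + q" "x * inverse (y l)"] unfolding e_def[abs_def] set_integrable_def .
  have eI: "(LINT t|lborel. e q l t) = 2 * pi * bes (k l + q) (x * inverse (y l))" for q l
    by (simp add: e_def bes_def set_lebesgue_integral_def)
  have fi: "integrable (PiM {1..d} (\<lambda>_. lborel)) (f q)" for q
    unfolding f_def by (intro integrable_mult_right product_integrable_prod ei) auto
  have fI: "(LINT \<theta>|PiM {1..d} (\<lambda>_. lborel). f q \<theta>) = bes q r * exp (\<i> * of_real (of_int q * \<phi>)) * (2 * pi) ^ d *
      (\<Prod>l\<in>{1..d}. bes (k l + q) (x * inverse (y l)))" for q
    unfolding f_def integral_mult_right_zero
    by (subst product_integral_prod[OF _ ei]) (auto simp: eI prod.distrib power_mult_distrib)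
  have "((\<lambda>q. LINT \<theta>|PiM {1..d} (\<lambda>_. lborel). f q \<theta>) has_sum (LINT \<theta>|PiM {1..d} (\<lambda>_. lborel). F \<theta>)) UNIV"
  proof (rule has_sum_integral_dominated(2)[where c="\<lambda>q. norm (bes q r)" and P="\<lambda>\<theta>. \<Prod>l\<in>{1..d}. indicat_real {0..2*pi} (\<theta> l)"])
    show "f q \<in> borel_measurable (PiM {1..d} (\<lambda>_. lborel))" for q using fi by auto
    show "integrable (PiM {1..d} (\<lambda>_. lborel)) (\<lambda>\<theta>. \<Prod>l\<in>{1..d}. indicat_real {0..2*pi} (\<theta> l))"
      by (rule product_integrable_prod) auto
    show "(\<lambda>q. norm (bes q r)) summable_on UNIV" by (rule bes_abs_summable)
    show "norm (f q \<theta>) \<le> norm (bes q r) * (\<Prod>l\<in>{1..d}. indicat_real {0..2*pi} (\<theta> l))" for q \<theta>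
      by (simp add: f_def e_def norm_mult abs_prod flip: prod_norm del: of_real_add of_real_mult of_int_add)
    show "((\<lambda>q. f q \<theta>) has_sum F \<theta>) UNIV" for \<theta>
    proof -
      define E where "E = (\<Prod>l\<in>{1..d}. exp (\<i> * of_real (of_int (k l) * \<theta> l + 2 * (x * inverse (y l)) * cos (\<theta> l))))"
      define c where "c = complex_of_real (\<Prod>l\<in>{1..d}. indicat_real {0..2*pi} (\<theta> l))"
      have "e q l (\<theta> l) = of_real (indicat_real {0..2*pi} (\<theta> l)) * exp (\<i> * of_real (of_int (k l) * \<theta> l + 2 * (x * inverse (y l)) * cos (\<theta> l)))
          * exp (\<i> * of_real (of_int q * \<theta> l))" for q l
        by (simp add: e_def scaleR_conv_of_real algebra_simps flip: exp_add)
      then have "(\<Prod>l\<in>{1..d}. e q l (\<theta> l)) = c * E * exp (\<i> * of_real (of_int q * (\<Sum>l\<in>{1..d}. \<theta> l)))" for q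
        by (simp add: prod.distrib c_def E_def sum_distrib_left exp_sum del: of_real_add of_real_mult)
      then have fe: "f q \<theta> = c * E * (bes q r * exp (\<i> * of_real (of_int q * ((\<Sum>l\<in>{1..d}. \<theta> l) + \<phi>))))" for q
        by (simp add: f_def algebra_simps exp_add)
      have "E = exp (\<i> * of_real (\<Sum>l\<in>{1..d}. of_int (k l) * \<theta> l + 2 * x * inverse (y l) * cos (\<theta> l)))"
        by (simp add: E_def sum_distrib_left exp_sum mult.assoc)
      then have "F \<theta> = c * E * exp (2 * \<i> * of_real (r * cos ((\<Sum>l\<in>{1..d}. \<theta> l) + \<phi>)))"
        unfolding F_def Theta_def indicator_Ball_eq_prod[OF finite_atLeastAtMost] c_def scaleR_conv_of_real
        by (simp add: r_def algebra_simps flip: exp_add)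
      then show ?thesis unfolding fe by (simp only:) (intro has_sum_cmult_right bes_generating)
    qed
  qed
  then show ?thesis
    unfolding fI r_def by (simp add: Jk_def Rmeas_def set_lebesgue_integral_def F_def)
qed

section \<open>Majorants in the order and in y\<close>

lemma power_over_fact_le_exp:
  assumes "x \<ge> (0::real)" shows "x ^ n / fact n \<le> exp x"
proof -
  have "(\<Sum>i\<in>{n}. x ^ i / fact i) \<le> (\<Sum>i. x ^ i / fact i)"
    using has_sum_imp_sums[OF exp_has_sum_real[OF assms]] assms by (intro sum_le_suminf) (auto simp: sums_iff)
  then show ?thesis
    using has_sum_imp_sums[OF exp_has_sum_real[OF assms]] by (simp add: sums_iff)
qed

lemma bes_rapid_decay:
  assumes "\<xi> \<ge> 0"
  obtains D where "D > 0" "\<And>m r. 0 \<le> r \<Longrightarrow> r \<le> \<xi> \<Longrightarrow> norm (bes m r) * (1 + \<bar>of_int m\<bar>) ^ N \<le> D"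
proof
  show "exp (\<xi>\<^sup>2) * (fact N * exp 1 * exp (exp 1 * \<xi>)) > 0" by simp
  fix m r assume r: "0 \<le> r" "r \<le> \<xi>"
  define n where "n = nat \<bar>m\<bar>"
  have mn: "\<bar>of_int m\<bar> = real n" by (simp add: n_def)
  have "norm (bes m r) \<le> r ^ n / fact n * exp (r\<^sup>2)"
    using norm_bes_le_power[OF r(1), of m] by (simp add: n_def)
  also have "\<dots> \<le> \<xi> ^ n / fact n * exp (\<xi>\<^sup>2)"
    using r by (intro mult_mono divide_right_mono power_mono) auto
  finally have 1: "norm (bes m r) \<le> \<xi> ^ n / fact n * exp (\<xi>\<^sup>2)" .
  \<comment> \<open>The polynomial in n costs only a multiple of exp n, and (e \<xi>)^n / n! stays
    below exp(e \<xi>).\<close>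
  have "(1 + real n) ^ N \<le> fact N * exp (1 + real n)"
    using power_over_fact_le_exp[of "1 + real n" N] by (simp add: field_simps)
  also have "exp (1 + real n) = exp 1 * exp 1 ^ n" by (simp add: exp_add exp_of_nat_mult[of n 1, simplified])
  finally have 2: "(1 + real n) ^ N \<le> fact N * (exp 1 * exp 1 ^ n)" .
  have "norm (bes m r) * (1 + \<bar>of_int m\<bar>) ^ N \<le> (\<xi> ^ n / fact n * exp (\<xi>\<^sup>2)) * (fact N * (exp 1 * exp 1 ^ n))"
    unfolding mn using 1 2 assms by (intro mult_mono) auto
  also have "\<dots> = exp (\<xi>\<^sup>2) * (fact N * exp 1 * ((exp 1 * \<xi>) ^ n / fact n))"
    by (simp add: power_mult_distrib)
  also have "\<dots> \<le> exp (\<xi>\<^sup>2) * (fact N * exp 1 * exp (exp 1 * \<xi>))"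
    using assms by (intro mult_left_mono power_over_fact_le_exp) auto
  finally show "norm (bes m r) * (1 + \<bar>of_int m\<bar>) ^ N \<le> exp (\<xi>\<^sup>2) * (fact N * exp 1 * exp (exp 1 * \<xi>))" .
qed

lemma inverse_square_summable_on_int: "(\<lambda>q::int. 1 / (1 + \<bar>of_int q\<bar> :: real)\<^sup>2) summable_on UNIV"
proof -
  have "summable (\<lambda>k. 1 / (real (Suc k))\<^sup>2)"
    using inverse_power_summable[of 2, where 'a=real] by (subst summable_Suc_iff) (simp add: inverse_eq_divide)
  then have s: "summable (\<lambda>k. 1 / (1 + real k)\<^sup>2)" by (simp add: add.commute)
  then have s2: "summable (\<lambda>k. 1 / (2 + real k)\<^sup>2)"
    by (subst (asm) summable_Suc_iff[symmetric]) (simp add: algebra_simps)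
  have "(\<lambda>q::int. 1 / (1 + \<bar>of_int q\<bar> :: real)\<^sup>2) summable_on range int"
    using s by (subst summable_on_reindex) (auto simp: o_def summable_on_UNIV_nonneg_real_iff)
  moreover have "(\<lambda>q::int. 1 / (1 + \<bar>of_int q\<bar> :: real)\<^sup>2) summable_on range (\<lambda>n. - 1 - int n)"
    using s2 by (subst summable_on_reindex) (auto simp: o_def inj_def summable_on_UNIV_nonneg_real_iff)
  ultimately have "(\<lambda>q::int. 1 / (1 + \<bar>of_int q\<bar> :: real)\<^sup>2) summable_on (range int \<union> range (\<lambda>n. - 1 - int n))"
    by (rule summable_on_union)
  moreover have "range int \<union> range (\<lambda>n. - 1 - int n) = UNIV"
  proof -
    have "q \<in> range int \<union> range (\<lambda>n. - 1 - int n)" for q :: int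
      by (cases "q \<ge> 0") (auto simp: image_iff intro: exI[of _ "nat q"] exI[of _ "nat (- 1 - q)"])
    then show ?thesis by auto
  qed
  ultimately show ?thesis by simp
qed

text \<open>Each factor is O((1 + |q|) min(1, r^(-1/2))). Since the product of the arguments is the constant
  \<xi>^(d+1), one argument is at most \<xi>, and its factor decays faster than any power of q.\<close>

lemma bes_prod_bound:
  fixes r :: "nat \<Rightarrow> real" and \<kappa> :: "nat \<Rightarrow> int"
  assumes I: "finite I" and \<xi>: "\<xi> > 0"
  obtains C where "C > 0" "\<And>q r. (\<And>l. l \<in> I \<Longrightarrow> r l > 0) \<Longrightarrow> (\<exists>j\<in>I. r j \<le> \<xi>) \<Longrightarrow>
    norm (\<Prod>l\<in>I. bes (\<kappa> l + q) (r l)) \<le> C / (1 + \<bar>of_int q\<bar>)\<^sup>2 * (\<Prod>l\<in>I. min 1 (1 / sqrt (r l)))"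
proof -
  \<comment> \<open>Controls all shifts at once: 1 + |\<kappa>_l + q| and 1 + |q| agree up to the
    factor 1 + \<open>K\<close>, in both directions.\<close>
  define K where "K = (\<Sum>l\<in>I. \<bar>real_of_int (\<kappa> l)\<bar>)"
  have K: "K \<ge> 0" "\<And>l. l \<in> I \<Longrightarrow> \<bar>real_of_int (\<kappa> l)\<bar> \<le> K"
    unfolding K_def using I by (auto intro!: sum_nonneg member_le_sum)
  define A where "A = 5 * (1 + K)"
  have A: "A > 0" using K(1) by (simp add: A_def)
  \<comment> \<open>The other \<open>card I - 1\<close> factors may each grow like 1 + |q|; two
    further powers leave the summable 1 / (1 + |q|)^2.\<close>
  define N where "N = card I + 1"
  obtain D where D: "D > 0" "\<And>m r. 0 \<le> r \<Longrightarrow> r \<le> \<xi> \<Longrightarrow> norm (bes m r) * (1 + \<bar>of_int m\<bar>) ^ N \<le> D"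
    using bes_rapid_decay[of \<xi> N] \<xi> by auto
  \<comment> \<open>Lower bound for the weight min 1 (1 / sqrt (r j)) of the factor with small
    argument, so that this weight can be inserted into its bound too.\<close>
  define \<eta> where "\<eta> = min 1 (1 / sqrt \<xi>)"
  have \<eta>: "\<eta> > 0" using \<xi> by (simp add: \<eta>_def)
  define E where "E = D * (1 + K) ^ N / \<eta>"
  have E: "E > 0" using D K \<eta> by (auto simp: E_def intro!: divide_pos_pos mult_pos_pos zero_less_power)
  show ?thesis
  proof (rule that[of "A ^ (card I - 1) * E"])
    show "A ^ (card I - 1) * E > 0" using A E by simp
    fix q r assume r: "\<And>l. l \<in> I \<Longrightarrow> r l > 0" and "\<exists>j\<in>I. r j \<le> \<xi>"
    then obtain j where j: "j \<in> I" "r j \<le> \<xi>" by blast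
    define u where "u l = min 1 (1 / sqrt (r l))" for l
    define Q where "Q = 1 + \<bar>real_of_int q\<bar>"
    have Q: "Q \<ge> 1" by (simp add: Q_def)
    have u0: "u l \<ge> 0" if "l \<in> I" for l using r[OF that] by (simp add: u_def)
    have gen: "norm (bes (\<kappa> l + q) (r l)) \<le> A * Q * u l" if l: "l \<in> I" for l
    proof -
      have "5 * (1 + \<bar>of_int (\<kappa> l + q)\<bar>) \<le> 5 * ((1 + K) * Q)"
      proof -
        have "1 + \<bar>real_of_int (\<kappa> l + q)\<bar> \<le> 1 + K + \<bar>real_of_int q\<bar>" using K(2)[OF l] by simp
        also have "\<dots> \<le> (1 + K) * Q" using K(1) by (simp add: Q_def algebra_simps)
        finally show ?thesis by simp
      qed
      then have "5 * (1 + \<bar>of_int (\<kappa> l + q)\<bar>) * u l \<le> A * Q * u l"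
        using u0[OF l] unfolding A_def by (intro mult_right_mono) (simp_all only: mult.assoc)
      then show ?thesis using norm_bes_le_min[OF r[OF l], of "\<kappa> l + q"] by (simp add: u_def)
    qed
    have special: "norm (bes (\<kappa> j + q) (r j)) \<le> E / Q ^ N * u j"
    proof -
      define M where "M = 1 + \<bar>real_of_int (\<kappa> j + q)\<bar>"
      have M: "M \<ge> 1" by (simp add: M_def)
      have "Q \<le> M + K" using K(2)[OF j(1)] by (simp add: M_def Q_def)
      also have "\<dots> \<le> (1 + K) * M" using K(1) M by (simp add: algebra_simps mult_le_cancel_left1)
      finally have "Q ^ N \<le> ((1 + K) * M) ^ N" using Q by (intro power_mono) auto
      then have QM: "Q ^ N \<le> (1 + K) ^ N * M ^ N" by (simp add: power_mult_distrib)
      have "norm (bes (\<kappa> j + q) (r j)) * Q ^ N \<le> norm (bes (\<kappa> j + q) (r j)) * ((1 + K) ^ N * M ^ N)"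
        by (intro mult_left_mono QM) auto
      also have "\<dots> = (norm (bes (\<kappa> j + q) (r j)) * M ^ N) * (1 + K) ^ N" by simp
      also have "\<dots> \<le> D * (1 + K) ^ N"
        using D(2)[of "r j" "\<kappa> j + q"] r[OF j(1)] j(2) K(1) by (intro mult_right_mono) (auto simp: M_def)
      also have "\<dots> = E * \<eta>" using \<eta> by (simp add: E_def)
      also have "\<dots> \<le> E * u j"
        using E r[OF j(1)] j(2) \<xi> unfolding \<eta>_def u_def
        by (intro mult_left_mono min.mono divide_left_mono) auto
      finally show ?thesis using Q by (simp add: field_simps)
    qed
    have c1: "card (I - {j}) = card I - 1" using j(1) I by simp
    have ci: "card I \<ge> 1" using j(1) I by (simp add: Suc_le_eq card_gt_0_iff) blast
    have "norm (\<Prod>l\<in>I. bes (\<kappa> l + q) (r l)) = norm (bes (\<kappa> j + q) (r j)) * (\<Prod>l\<in>I - {j}. norm (bes (\<kappa> l + q) (r l)))"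
      using prod.remove[OF I j(1), of "\<lambda>l. bes (\<kappa> l + q) (r l)"] by (simp add: norm_mult prod_norm)
    also have "\<dots> \<le> (E / Q ^ N * u j) * (\<Prod>l\<in>I - {j}. A * Q * u l)"
      by (intro mult_mono special prod_mono prod_nonneg conjI gen) (use u0 j E Q in auto)
    also have "(\<Prod>l\<in>I - {j}. A * Q * u l) = (A * Q) ^ (card I - 1) * (\<Prod>l\<in>I - {j}. u l)"
      by (simp only: prod.distrib prod_constant c1 power_mult_distrib)
    also have "(E / Q ^ N * u j) * ((A * Q) ^ (card I - 1) * (\<Prod>l\<in>I - {j}. u l)) = A ^ (card I - 1) * E * (Q ^ (card I - 1) / Q ^ N) * (u j * (\<Prod>l\<in>I - {j}. u l))"
      by (simp add: power_mult_distrib)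
    also have "Q ^ (card I - 1) / Q ^ N = 1 / Q\<^sup>2"
    proof -
      have "N = (card I - 1) + 2" using ci by (simp add: N_def)
      then have "Q ^ N = Q ^ (card I - 1) * Q\<^sup>2" by (simp only: power_add)
      then show ?thesis using Q by simp
    qed
    also have "u j * (\<Prod>l\<in>I - {j}. u l) = (\<Prod>l\<in>I. u l)" using prod.remove[OF I j(1), of u] by simp
    finally show "norm (\<Prod>l\<in>I. bes (\<kappa> l + q) (r l)) \<le> A ^ (card I - 1) * E / (1 + \<bar>of_int q\<bar>)\<^sup>2 * (\<Prod>l\<in>I. min 1 (1 / sqrt (r l)))"
      by (simp add: u_def Q_def)
  qed
qed

text \<open>Majorant in one variable y_l; \<open>e\<close> stands for 2 Re \<nu>_l + a.\<close>

definition radial :: "real \<Rightarrow> real \<Rightarrow> real" where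
  "radial e y = indicat_real {0<..} y * (y powr (e - 1) * min 1 (sqrt y))"

lemma radial_nonneg: "radial e y \<ge> 0"
  by (auto simp: radial_def indicator_def)

text \<open>Near 0 the function is y^(e - 1/2), integrable for e > -1/2; near infinity it is y^(e -
  1), integrable for e < 0. With y = exp u these are the two ends of
  \<open>integrable_exp_min\<close> for \<alpha> = -e, reflected.\<close>

lemma radial_integrable:
  assumes "-1/2 < e" "e < 0"
  shows "integrable lborel (radial e)"
proof -
  define f where "f y = complex_of_real (y powr (e - 1) * min 1 (sqrt y))" for y
  have [measurable]: "f \<in> borel_measurable borel" unfolding f_def by measurable
  have "integrable lborel (\<lambda>u. exp (- e * (0 + (-1) * u)) * min 1 (exp (- (0 + (-1) * u) / 2)))"
    by (rule lborel_integrable_real_affine[OF integrable_exp_min]) (use assms in auto)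
  then have "integrable lborel (\<lambda>u. complex_of_real (exp (- e * (0 + (-1) * u)) * min 1 (exp (- (0 + (-1) * u) / 2))))"
    by (simp only: complex_of_real_integrable_eq)
  moreover have "complex_of_real (exp (- e * (0 + (-1) * u)) * min 1 (exp (- (0 + (-1) * u) / 2))) = exp u *\<^sub>R f (exp u)" for u
  proof -
    have "sqrt (exp u) = exp (u / 2)"
      by (rule real_sqrt_unique) (simp_all add: power2_eq_square flip: exp_add)
    moreover have "exp u * exp u powr (e - 1) = exp (e * u)"
      by (simp add: powr_def algebra_simps flip: exp_add)
    ultimately show ?thesis by (simp add: f_def scaleR_conv_of_real mult.assoc[symmetric] flip: of_real_mult)
  qed
  ultimately have "set_integrable lborel {0<..} f" by (simp add: exp_substitution(1))
  moreover have "indicat_real {0<..} y *\<^sub>R f y = complex_of_real (radial e y)" for y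
    by (simp add: f_def radial_def scaleR_conv_of_real)
  ultimately show ?thesis by (simp add: set_integrable_def complex_of_real_integrable_eq del: of_real_mult)
qed

text \<open>One term of the expanded y-integrand; its integral over y is a multiplicative
  convolution of d + 1 Bessel factors. With the indicators it is a function on all of R^d that is a
  product over the variables, except for the last Bessel function.\<close>

definition bconv :: "nat \<Rightarrow> (nat \<Rightarrow> complex) \<Rightarrow> (nat \<Rightarrow> int) \<Rightarrow> real \<Rightarrow> (nat \<Rightarrow> real) \<Rightarrow> complex" where
  "bconv d \<nu> m \<xi> y = (\<Prod>l\<in>{1..d}. indicat_real {0<..} (y l) *\<^sub>R (of_real (y l) powr (2 * \<nu> l - 1) * bes (m l) (\<xi> * inverse (y l))))
     * bes (m (d + 1)) (\<xi> * (\<Prod>l\<in>{1..d}. y l))"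

lemma measurable_Rmeas_component:
  assumes "l \<in> {1..d}" "f \<in> borel_measurable borel"
  shows "(\<lambda>y. f (y l)) \<in> borel_measurable (Rmeas d)"
  unfolding Rmeas_def using assms
  by (intro measurable_compose[OF measurable_component_singleton]) auto

lemma measurable_bconv: "bconv d \<nu> m \<xi> \<in> borel_measurable (Rmeas d)"
  unfolding bconv_def
proof (intro borel_measurable_times borel_measurable_prod)
  fix l assume l: "l \<in> {1..d}"
  show "(\<lambda>y. indicat_real {0<..} (y l) *\<^sub>R (of_real (y l) powr (2 * \<nu> l - 1) * bes (m l) (\<xi> * inverse (y l)))) \<in> borel_measurable (Rmeas d)"
    by (rule measurable_Rmeas_component[OF l]) measurable
next
  have "(\<lambda>y. \<Prod>l\<in>{1..d}. y l) \<in> borel_measurable (Rmeas d)"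
    by (intro borel_measurable_prod measurable_Rmeas_component) auto
  then show "(\<lambda>y. bes (m (d + 1)) (\<xi> * (\<Prod>l\<in>{1..d}. y l))) \<in> borel_measurable (Rmeas d)"
    by measurable
qed

text \<open>The last factor couples the variables. Bounding it by R^a at R = \<xi> y_1 ... y_d
  splits it into powers y_l^a, which is where the parameter \<open>a\<close> acts, and leaves a
  product of functions of one variable.\<close>

lemma bconv_bound:
  assumes \<xi>: "\<xi> > 0" and a: "a \<in> {-1/2..0}"
  obtains C where "C > 0" "\<And>q y. norm (bconv d \<nu> (\<lambda>l. \<kappa> l + q) \<xi> y) \<le> C / (1 + \<bar>of_int q\<bar>)\<^sup>2 * (\<Prod>l\<in>{1..d}. radial (2 * Re (\<nu> l) + a) (y l))"
proof -
  obtain C where C: "C > 0" "\<And>q r. (\<And>l. l \<in> {1..d+1} \<Longrightarrow> r l > 0) \<Longrightarrow> (\<exists>j\<in>{1..d+1}. r j \<le> \<xi>) \<Longrightarrow>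
    norm (\<Prod>l\<in>{1..d+1}. bes (\<kappa> l + q) (r l)) \<le> C / (1 + \<bar>of_int q\<bar>)\<^sup>2 * (\<Prod>l\<in>{1..d+1}. min 1 (1 / sqrt (r l)))"
    using bes_prod_bound[of "{1..d+1}" \<xi> \<kappa>] \<xi> by auto
  \<comment> \<open>Removes \<xi> from the weights: min(1, sqrt(y / \<xi>)) <= B min(1, sqrt
    y).\<close>
  define B where "B = max 1 (1 / sqrt \<xi>)"
  have B: "B \<ge> 1" by (simp add: B_def)
  show ?thesis
  proof (rule that[of "C * (\<xi> powr a * B ^ d)"])
    show "C * (\<xi> powr a * B ^ d) > 0" using C B \<xi> by simp
    fix q y
    show "norm (bconv d \<nu> (\<lambda>l. \<kappa> l + q) \<xi> y) \<le> C * (\<xi> powr a * B ^ d) / (1 + \<bar>of_int q\<bar>)\<^sup>2 * (\<Prod>l\<in>{1..d}. radial (2 * Re (\<nu> l) + a) (y l))"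
    proof (cases "\<forall>l\<in>{1..d}. y l > 0")
      case False
      then obtain l where "l \<in> {1..d}" "\<not> y l > 0" by blast
      then have "bconv d \<nu> (\<lambda>l. \<kappa> l + q) \<xi> y = 0"
        unfolding bconv_def by (subst prod_zero) (auto intro!: bexI[of _ l])
      then show ?thesis using C B \<xi> by (auto intro!: mult_nonneg_nonneg divide_nonneg_nonneg prod_nonneg radial_nonneg)
    next
      case True
      then have y: "y l > 0" if "l \<in> {1..d}" for l using that by blast
      define Y where "Y = (\<Prod>l\<in>{1..d}. y l)"
      have Y: "Y > 0" unfolding Y_def by (intro prod_pos) (use y in auto)
      define r where "r l = (if l = d + 1 then \<xi> * Y else \<xi> * inverse (y l))" for l
      have rl: "r l = \<xi> * inverse (y l)" if "l \<in> {1..d}" for l using that by (auto simp: r_def)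
      have split: "(\<Prod>l\<in>{1..d+1}. g l) = (\<Prod>l\<in>{1..d}. g l) * g (d + 1)" for g :: "nat \<Rightarrow> 'z :: comm_monoid_mult"
        by (simp add: mult.commute)
      \<comment> \<open>Either y_1 ... y_d <= 1 and the last argument is at most \<xi>, or some y_l
        >= 1 and \<xi> / y_l is.\<close>
      have ex: "\<exists>j\<in>{1..d+1}. r j \<le> \<xi>"
      proof (cases "Y \<le> 1")
        case True
        then have "r (d + 1) \<le> \<xi>" using \<xi> by (simp add: r_def mult_left_le)
        then show ?thesis by auto
      next
        case False
        have "\<exists>l\<in>{1..d}. y l \<ge> 1"
        proof (rule ccontr)
          assume "\<not> (\<exists>l\<in>{1..d}. y l \<ge> 1)"
          then have "Y \<le> 1" unfolding Y_def using y by (intro prod_le_1) (auto simp: not_le less_imp_le)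
          with False show False by simp
        qed
        then obtain l where l: "l \<in> {1..d}" "y l \<ge> 1" by blast
        then have "r l \<le> \<xi>" using \<xi> by (simp add: rl divide_le_eq mult_le_cancel_left1 flip: divide_inverse)
        then show ?thesis using l by auto
      qed
      have rpos: "r l > 0" if "l \<in> {1..d+1}" for l
        using that \<xi> y Y by (cases "l = d + 1") (auto simp: r_def)
      have b1: "min 1 (1 / sqrt (r l)) \<le> B * min 1 (sqrt (y l))" if l: "l \<in> {1..d}" for l
      proof -
        have "1 / sqrt (r l) = 1 / sqrt \<xi> * sqrt (y l)" unfolding rl[OF l]
          by (simp add: real_sqrt_divide divide_inverse[symmetric])
        also have "\<dots> \<le> B * sqrt (y l)" using y[OF l] by (intro mult_right_mono) (auto simp: B_def)
        finally have "min 1 (1 / sqrt (r l)) \<le> min (B * 1) (B * sqrt (y l))" using B by (intro min.mono) auto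
        also have "\<dots> = B * min 1 (sqrt (y l))" using B by (simp add: min_def)
        finally show ?thesis .
      qed
      have b2: "min 1 (1 / sqrt (r (d + 1))) \<le> \<xi> powr a * (\<Prod>l\<in>{1..d}. y l powr a)"
      proof -
        have r0: "r (d + 1) = \<xi> * Y" "\<xi> * Y > 0" using \<xi> Y by (auto simp: r_def)
        \<comment> \<open>As -1/2 <= a <= 0, R^a is at least R^(-1/2) for R >= 1 and at least 1 for
          R < 1.\<close>
        have "min 1 (1 / sqrt (\<xi> * Y)) \<le> (\<xi> * Y) powr a"
        proof (cases "\<xi> * Y \<ge> 1")
          case True
          have "1 / sqrt (\<xi> * Y) = (\<xi> * Y) powr (-1/2)" using r0(2) by (simp add: powr_minus_divide powr_half_sqrt)
          also have "\<dots> \<le> (\<xi> * Y) powr a" using True a by (intro powr_mono) auto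
          finally show ?thesis by simp
        next
          case False
          then have "(\<xi> * Y) powr 0 \<le> (\<xi> * Y) powr a" using a r0(2) by (intro powr_mono') auto
          then have "1 \<le> (\<xi> * Y) powr a" using \<xi> Y by simp
          then show ?thesis by (rule order_trans[OF min.cobounded1])
        qed
        also have "(\<xi> * Y) powr a = \<xi> powr a * (\<Prod>l\<in>{1..d}. y l powr a)"
          using \<xi> Y y unfolding Y_def by (subst powr_mult) (auto simp: prod_powr_distrib less_imp_le)
        finally show ?thesis using r0 by simp
      qed
      have "bconv d \<nu> (\<lambda>l. \<kappa> l + q) \<xi> y = (\<Prod>l\<in>{1..d}. of_real (y l) powr (2 * \<nu> l - 1)) * (\<Prod>l\<in>{1..d+1}. bes (\<kappa> l + q) (r l))"
      proof -
        have e: "indicat_real {0<..} (y l) *\<^sub>R (of_real (y l) powr (2 * \<nu> l - 1) * bes (\<kappa> l + q) (\<xi> * inverse (y l)))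
          = of_real (y l) powr (2 * \<nu> l - 1) * bes (\<kappa> l + q) (r l)" if l: "l \<in> {1..d}" for l
          using y[OF l] by (simp add: rl[OF l])
        have "bconv d \<nu> (\<lambda>l. \<kappa> l + q) \<xi> y = (\<Prod>l\<in>{1..d}. of_real (y l) powr (2 * \<nu> l - 1) * bes (\<kappa> l + q) (r l)) * bes (\<kappa> (d + 1) + q) (r (d + 1))"
          unfolding bconv_def by (intro arg_cong2[where f="(*)"] prod.cong refl e) (auto simp: r_def Y_def)
        then show ?thesis by (simp only: split prod.distrib mult.assoc)
      qed
      moreover have "norm (\<Prod>l\<in>{1..d}. complex_of_real (y l) powr (2 * \<nu> l - 1)) = (\<Prod>l\<in>{1..d}. y l powr (2 * Re (\<nu> l) - 1))"
        unfolding prod_norm[symmetric]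
      proof (intro prod.cong refl)
        fix l assume l: "l \<in> {1..d}"
        show "norm (complex_of_real (y l) powr (2 * \<nu> l - 1)) = y l powr (2 * Re (\<nu> l) - 1)"
          using y[OF l] by (subst norm_powr_real) (auto simp: powr_def)
      qed
      ultimately have "norm (bconv d \<nu> (\<lambda>l. \<kappa> l + q) \<xi> y) = (\<Prod>l\<in>{1..d}. y l powr (2 * Re (\<nu> l) - 1)) * norm (\<Prod>l\<in>{1..d+1}. bes (\<kappa> l + q) (r l))"
        by (simp only: norm_mult)
      also have "\<dots> \<le> (\<Prod>l\<in>{1..d}. y l powr (2 * Re (\<nu> l) - 1)) * (C / (1 + \<bar>of_int q\<bar>)\<^sup>2 * (\<Prod>l\<in>{1..d+1}. min 1 (1 / sqrt (r l))))"
        by (intro mult_left_mono C(2) rpos ex prod_nonneg) auto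
      also have "\<dots> \<le> (\<Prod>l\<in>{1..d}. y l powr (2 * Re (\<nu> l) - 1)) * (C / (1 + \<bar>of_int q\<bar>)\<^sup>2 * ((\<Prod>l\<in>{1..d}. B * min 1 (sqrt (y l))) * (\<xi> powr a * (\<Prod>l\<in>{1..d}. y l powr a))))"
        unfolding split
        by (intro mult_left_mono mult_mono b1 b2 prod_mono prod_nonneg conjI)
           (use y rpos C \<xi> B in \<open>auto intro!: prod_nonneg mult_nonneg_nonneg simp: less_imp_le\<close>)
      also have "\<dots> = C * (\<xi> powr a * B ^ d) / (1 + \<bar>of_int q\<bar>)\<^sup>2 * ((\<Prod>l\<in>{1..d}. y l powr (2 * Re (\<nu> l) - 1)) * (\<Prod>l\<in>{1..d}. min 1 (sqrt (y l))) * (\<Prod>l\<in>{1..d}. y l powr a))"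
        by (simp add: prod.distrib)
      also have "(\<Prod>l\<in>{1..d}. y l powr (2 * Re (\<nu> l) - 1)) * (\<Prod>l\<in>{1..d}. min 1 (sqrt (y l))) * (\<Prod>l\<in>{1..d}. y l powr a) = (\<Prod>l\<in>{1..d}. radial (2 * Re (\<nu> l) + a) (y l))"
        unfolding prod.distrib[symmetric]
      proof (intro prod.cong refl)
        fix l assume l: "l \<in> {1..d}"
        have "2 * Re (\<nu> l) + a - 1 = (2 * Re (\<nu> l) - 1) + a" by simp
        then have "y l powr (2 * Re (\<nu> l) + a - 1) = y l powr (2 * Re (\<nu> l) - 1) * y l powr a" by (simp only: powr_add)
        then show "y l powr (2 * Re (\<nu> l) - 1) * min 1 (sqrt (y l)) * y l powr a = radial (2 * Re (\<nu> l) + a) (y l)"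
          using y[OF l] by (simp add: radial_def)
      qed
      finally show ?thesis .
    qed
  qed
qed

text \<open>Both claims come from one dominated summation over q. Subtracting m_(d+1) from all
  orders gives k_l + q in the first d factors and q in the last; (4 pi)^d collects 2^d from
  \<open>Jnuk\<close> and (2 pi)^d from the angles.\<close>

lemma Jnuk_expansion:
  assumes \<xi>: "\<xi> > 0" and a: "a \<in> {-1/2..0}" "\<And>l. l \<in> {1..d} \<Longrightarrow> -1/2 < 2 * Re (\<nu> l) + a \<and> 2 * Re (\<nu> l) + a < 0"
    and k: "\<And>l. k l = m l - m (d + 1)"
  shows "set_integrable (Rmeas d) (Rplus d) (\<lambda>y. p2nu d \<nu> y * Jk d k y \<xi> \<phi>)"
    and "((\<lambda>q. (4 * pi) ^ d * exp (\<i> * of_real (of_int q * \<phi>)) * (LINT y|Rmeas d. bconv d \<nu> (\<lambda>l. m l - m (d + 1) + q) \<xi> y)) has_sum Jnuk d \<nu> k \<xi> \<phi>) UNIV"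
proof -
  interpret product_sigma_finite "\<lambda>_. lborel :: real measure" by (rule product_sigma_finite_lborel)
  obtain C where C: "C > 0" "\<And>q y. norm (bconv d \<nu> (\<lambda>l. m l - m (d + 1) + q) \<xi> y) \<le> C / (1 + \<bar>of_int q\<bar>)\<^sup>2 * (\<Prod>l\<in>{1..d}. radial (2 * Re (\<nu> l) + a) (y l))"
    using bconv_bound[OF \<xi> a(1), of d \<nu> "\<lambda>l. m l - m (d + 1)"] by blast
  define f where "f q y = exp (\<i> * of_real (of_int q * \<phi>)) * (2 * pi) ^ d * bconv d \<nu> (\<lambda>l. m l - m (d + 1) + q) \<xi> y" for q y
  have 1: "f q \<in> borel_measurable (Rmeas d)" for q
    unfolding f_def using measurable_bconv by (intro borel_measurable_times) auto
  have 2: "integrable (Rmeas d) (\<lambda>y. \<Prod>l\<in>{1..d}. radial (2 * Re (\<nu> l) + a) (y l))"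
    unfolding Rmeas_def by (rule product_integrable_prod) (use a(2) in \<open>auto intro!: radial_integrable\<close>)
  have 3: "(\<lambda>q::int. (2 * pi) ^ d * (C / (1 + \<bar>of_int q\<bar>)\<^sup>2)) summable_on UNIV"
    using summable_on_cmult_right[OF inverse_square_summable_on_int, of "(2 * pi) ^ d * C"] by simp
  have 4: "norm (f q y) \<le> (2 * pi) ^ d * (C / (1 + \<bar>of_int q\<bar>)\<^sup>2) * (\<Prod>l\<in>{1..d}. radial (2 * Re (\<nu> l) + a) (y l))" for q y
    using mult_left_mono[OF C(2)[of q y], of "(2 * pi) ^ d"] by (simp add: f_def norm_mult norm_power)
  have 5: "((\<lambda>q. f q y) has_sum indicat_real (Rplus d) y *\<^sub>R (p2nu d \<nu> y * Jk d k y \<xi> \<phi>)) UNIV" for y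
  proof -
    have "f q y = indicat_real (Rplus d) y *\<^sub>R (p2nu d \<nu> y * (bes q (\<xi> * (\<Prod>l\<in>{1..d}. y l)) * exp (\<i> * of_real (of_int q * \<phi>)) * (2 * pi) ^ d *
      (\<Prod>l\<in>{1..d}. bes (k l + q) (\<xi> * inverse (y l)))))" for q
    proof -
      have "indicat_real (Rplus d) y = (\<Prod>l\<in>{1..d}. indicat_real {0<..} (y l))"
        using indicator_Ball_eq_prod[of "{1..d}" "{0<..}" y] by (simp add: Rplus_def)
      then show ?thesis
        by (simp add: f_def bconv_def p2nu_def k scaleR_conv_of_real prod.distrib)
    qed
    then show ?thesis
      unfolding scaleR_conv_of_real by (simp only:) (intro has_sum_cmult_right Jk_has_sum)
  qed
  note D = has_sum_integral_dominated[OF 1 2 3 4 5]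
  show "set_integrable (Rmeas d) (Rplus d) (\<lambda>y. p2nu d \<nu> y * Jk d k y \<xi> \<phi>)"
    unfolding set_integrable_def by (rule D(1))
  have "((\<lambda>q. 2 ^ d * (LINT y|Rmeas d. f q y)) has_sum Jnuk d \<nu> k \<xi> \<phi>) UNIV"
    unfolding Jnuk_def set_lebesgue_integral_def by (intro has_sum_cmult_right D(2))
  moreover have "2 ^ d * (LINT y|Rmeas d. f q y) = (4 * pi) ^ d * exp (\<i> * of_real (of_int q * \<phi>)) * (LINT y|Rmeas d. bconv d \<nu> (\<lambda>l. m l - m (d + 1) + q) \<xi> y)" for q
  proof -
    have "(4 * pi) ^ d = 2 ^ d * (2 * pi) ^ d"
      by (subst power_mult_distrib[symmetric]) simp
    then have *: "complex_of_real ((4 * pi) ^ d) = 2 ^ d * of_real ((2 * pi) ^ d)"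
      by (simp only: of_real_mult of_real_power of_real_numeral)
    show ?thesis unfolding f_def integral_mult_right_zero * by (simp only: mult_ac)
  qed
  ultimately show "((\<lambda>q. (4 * pi) ^ d * exp (\<i> * of_real (of_int q * \<phi>)) * (LINT y|Rmeas d. bconv d \<nu> (\<lambda>l. m l - m (d + 1) + q) \<xi> y)) has_sum Jnuk d \<nu> k \<xi> \<phi>) UNIV"
    by (simp only:)
qed

subsection \<open>Mellin inversion\<close>

text \<open>As the \<mu>_l sum to 0, \<sigma> is the mean of the \<sigma> - Re \<mu>_l, hence below
  1/4, and 1/4 <= 1/2 - 1/(2 n) for n >= 2. All poles lie at or to the left of some Re \<mu>_l <
  \<sigma>.\<close>

lemma admissible_constant_contour:
  assumes "n \<ge> 2" "(\<Sum>l\<in>{1..n}. \<mu> l) = 0" and \<sigma>: "\<And>l. l \<in> {1..n} \<Longrightarrow> 0 < \<sigma> - Re (\<mu> l) \<and> \<sigma> - Re (\<mu> l) < 1/4"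
  shows "admissible_contour n \<mu> m \<sigma> (\<lambda>_. \<sigma>)"
  unfolding admissible_contour_def Let_def
proof (intro conjI ballI allI)
  have "real n * \<sigma> = (\<Sum>l\<in>{1..n}. \<sigma> - Re (\<mu> l))"
    using arg_cong[OF assms(2), of Re] by (simp add: sum_subtractf)
  also have "\<dots> < (\<Sum>l\<in>{1..n}. 1/4)" by (intro sum_strict_mono) (use \<sigma> assms(1) in auto)
  finally have "real n * \<sigma> < real n / 4" by simp
  moreover have "real n / 4 \<le> real n / 2 - 1 / 2" using assms(1) by simp
  ultimately have "real n * \<sigma> < real n / 2 - 1 / 2" by linarith
  then show "\<sigma> < 1 / 2 + (2 * Re (\<Sum>l\<in>{1..n}. \<mu> l) - 1) / (2 * real n)"
    using assms(1) unfolding assms(2) by (simp add: field_simps)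
next
  fix l and \<kappa> :: nat assume "l \<in> {1..n}"
  then have "Re (\<mu> l) < \<sigma>" using \<sigma>[of l] by simp
  moreover have "0 \<le> \<bar>real_of_int (m l)\<bar> / 2" "0 \<le> real \<kappa> / 2" by simp_all
  moreover have "Re (\<mu> l - of_int \<bar>m l\<bar> / 2 - of_nat \<kappa> / 2) = Re (\<mu> l) - \<bar>real_of_int (m l)\<bar> / 2 - real \<kappa> / 2" by simp
  ultimately show "Re (\<mu> l - of_int \<bar>m l\<bar> / 2 - of_nat \<kappa> / 2) < \<sigma>" by linarith
qed auto

text \<open>The hypothesis allows a = -1/2 and a = 0, but the abscissa Re \<mu>_n - b/2 lies in the
  strip only for \<open>b\<close> strictly between; finitely many strict inequalities survive a
  small move.\<close>

lemma open_parameter_interval: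
  fixes w :: "nat \<Rightarrow> real"
  assumes "finite I" "a \<in> {-1/2..0}" "\<And>l. l \<in> I \<Longrightarrow> -1/2 < w l + a \<and> w l + a < 0"
  obtains b where "-1/2 < b" "b < 0" "\<And>l. l \<in> I \<Longrightarrow> -1/2 < w l + b \<and> w l + b < 0"
proof -
  have ev: "eventually (\<lambda>b. \<forall>l\<in>I. -1/2 < w l + b \<and> w l + b < 0) (at a)"
  proof (intro eventually_ball_finite ballI assms(1))
    fix l assume "l \<in> I"
    have t: "((\<lambda>b. w l + b) \<longlongrightarrow> w l + a) (at a)" by (intro tendsto_intros)
    show "eventually (\<lambda>b. -1/2 < w l + b \<and> w l + b < 0) (at a)"
      using assms(3)[OF \<open>l \<in> I\<close>] by (intro eventually_conj order_tendstoD[OF t]) auto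
  qed
  then obtain e where e: "e > 0" "\<And>b. b \<noteq> a \<Longrightarrow> dist b a < e \<Longrightarrow> \<forall>l\<in>I. -1/2 < w l + b \<and> w l + b < 0"
    unfolding eventually_at by blast
  \<comment> \<open>Moves away from the nearer end point, by at most 1/8, so that \<open>b\<close>
    stays inside the interval.\<close>
  define b where "b = (if a < -1/4 then a + min (e/2) (1/8) else a - min (e/2) (1/8))"
  have "b \<noteq> a" "dist b a < e" "-1/2 < b" "b < 0"
    using e(1) assms(2) by (auto simp: b_def dist_real_def min_def)
  then show ?thesis using that e(2) by blast
qed

text \<open>The factor (2 pi)^(-2 s) is kept apart: over all n factors it combines with x^(-2 s) to
  \<xi>^(-2 n s), the origin of \<xi> = 2 pi x^(1/n).\<close>

lemma Gk_eq_mellin: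
  fixes s :: complex
  assumes "0 < Re s" "Re s < 1/4"
  shows "Gk k s = 4 * pi * exp (- 2 * s * ln (2 * pi)) * (LINT w|lborel. bes k (exp w) * exp (2 * s * of_real w))"
proof -
  have "complex_of_real (2 * pi) powr (1 - 2 * s) = exp ((1 - 2 * s) * ln (2 * pi))"
    unfolding powr_def using pi_gt_zero by (subst Ln_of_real) auto
  also have "\<dots> = exp (of_real (ln (2 * pi))) * exp (- 2 * s * ln (2 * pi))"
    by (simp add: algebra_simps flip: exp_add)
  also have "exp (complex_of_real (ln (2 * pi))) = of_real (2 * pi)"
    by (simp only: exp_of_real exp_ln[of "2 * pi"]) simp
  finally have p: "complex_of_real (2 * pi) powr (1 - 2 * s) = of_real (2 * pi) * exp (- 2 * s * ln (2 * pi))" .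
  have alg: "u * (2 * v * w) * x / y = 4 * v * w * (u / 2 * x / y)" for u v w x y :: complex
    by simp
  show ?thesis
    unfolding Gk_def bes_mellin[OF assms] p unfolding of_real_mult of_real_numeral by (rule alg)
qed

text \<open>The Mellin convolution theorem for d+1 Bessel factors: along the line Re s = \<sigma>, the integrand is,
  up to constants, the product of the Fourier transform of the last factor and that of the first d
  factors, the latter taken along the fibres of y \<mapsto> ln (\<xi> y_1 \<cdots> y_d).\<close>

lemma jmum_eq_bconv:
  assumes d: "d \<ge> 1" and \<mu>: "(\<Sum>l\<in>{1..d+1}. \<mu> l) = 0" and \<nu>: "\<And>l. \<nu> l = \<mu> l - \<mu> (d + 1)"
    and a: "a \<in> {-1/2..0}" "\<And>l. l \<in> {1..d} \<Longrightarrow> -1/2 < 2 * Re (\<nu> l) + a \<and> 2 * Re (\<nu> l) + a < 0"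
    and x: "x > 0" and \<xi>: "\<xi> = 2 * pi * x powr (1 / real (d + 1))"
  shows "jmum (d + 1) \<mu> m x = (4 * pi) ^ (d + 1) / 2 * (LINT y|Rmeas d. bconv d \<nu> m \<xi> y)"
proof -
  interpret product_sigma_finite "\<lambda>_. lborel :: real measure" by (rule product_sigma_finite_lborel)
  obtain b where b: "-1/2 < b" "b < 0" "\<And>l. l \<in> {1..d} \<Longrightarrow> -1/2 < 2 * Re (\<nu> l) + b \<and> 2 * Re (\<nu> l) + b < 0"
    using open_parameter_interval[of "{1..d}" a "\<lambda>l. 2 * Re (\<nu> l)"] a by blast
  define n where "n = d + 1"
  \<comment> \<open>Makes \<sigma> - Re \<mu>_l equal to -(2 Re \<nu>_l + b) / 2 for l <= d and to
    -b / 2 for l = n, all in (0, 1/4).\<close>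
  define \<sigma> where "\<sigma> = Re (\<mu> n) - b / 2"
  have \<sigma>: "0 < \<sigma> - Re (\<mu> l) \<and> \<sigma> - Re (\<mu> l) < 1/4" if "l \<in> {1..n}" for l
  proof (cases "l = n")
    case True then show ?thesis using b by (simp add: \<sigma>_def)
  next
    case False
    then have "l \<in> {1..d}" using that by (auto simp: n_def)
    from b(3)[OF this] show ?thesis by (simp add: \<sigma>_def \<nu> n_def)
  qed
  have split: "(\<Prod>l\<in>{1..n}. g l) = (\<Prod>l\<in>{1..d}. g l) * g n" for g :: "nat \<Rightarrow> complex"
    by (simp add: n_def mult.commute)
  have splits: "(\<Sum>l\<in>{1..n}. g l) = (\<Sum>l\<in>{1..d}. g l) + g n" for g :: "nat \<Rightarrow> complex"
    by (simp add: n_def add.commute)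
  have adm: "admissible_contour n \<mu> m \<sigma> (\<lambda>_. \<sigma>)"
    using d \<mu> by (intro admissible_constant_contour \<sigma>) (auto simp: n_def)
  \<comment> \<open>The contour chosen in \<open>jmum\<close>. The vertical line witnesses that an
    admissible contour exists, so the choice is admissible, possibly with another abscissa.\<close>
  define f where "f = (SOME f. \<exists>\<sigma>. admissible_contour n \<mu> m \<sigma> f)"
  have "\<exists>\<sigma>. admissible_contour n \<mu> m \<sigma> f"
    unfolding f_def by (rule someI[of "\<lambda>f. \<exists>\<sigma>. admissible_contour n \<mu> m \<sigma> f" "\<lambda>_. \<sigma>"]) (use adm in blast)
  then obtain \<sigma>' where f: "admissible_contour n \<mu> m \<sigma>' f" by blast
  define F where "F s = Gmum n \<mu> m s * of_real x powr (- 2 * s)" for s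
  have n1: "n \<ge> 1" by (simp add: n_def)
  note cv = contour_value_eq[OF f adm x n1]
  have Fi: "integrable lborel (\<lambda>t. F (Complex \<sigma> t))" using cv(2) by (simp add: F_def)
  have j: "jmum n \<mu> m x = (LINT t|lborel. F (Complex \<sigma> t)) / (2 * pi)"
  proof -
    have "contour_value n \<mu> m (\<lambda>_. \<sigma>) x = (LINT t|lborel. F (Complex \<sigma> t)) * \<i>"
      by (simp add: contour_value_def F_def)
    then show ?thesis unfolding jmum_def Let_def f_def[symmetric] cv(1) by (simp add: field_simps)
  qed
  have \<xi>0: "\<xi> > 0" using x by (simp add: \<xi>)
  define \<Lambda> where "\<Lambda> = ln \<xi>"
  have \<Lambda>: "real n * \<Lambda> = real n * ln (2 * pi) + ln x"
    using x by (simp add: \<Lambda>_def \<xi> n_def ln_mult ln_powr field_simps)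
  have e\<Lambda>: "exp \<Lambda> = \<xi>" using \<xi>0 by (simp add: \<Lambda>_def)
  define M where "M l s = (LINT w|lborel. bes (m l) (exp w) * exp (2 * (s - \<mu> l) * of_real w))" for l s
  \<comment> \<open>The ordinate t / 2 makes 2 s = 2 \<sigma> + i t, so that t is the Fourier
    variable; rescaling the line integral at the end returns the factor 1/2.\<close>
  define s where "s t = Complex \<sigma> (0 + (1/2) * t)" for t
  have s2: "2 * s t = 2 * of_real \<sigma> + \<i> * of_real t" for t by (simp add: s_def complex_eq_iff)
  have Fs: "F (s t) = (4 * pi) ^ n * exp (- 2 * s t * of_nat n * of_real \<Lambda>) * (\<Prod>l\<in>{1..n}. M l (s t))" for t
  proof -
    have "Gmum n \<mu> m (s t) = (\<Prod>l\<in>{1..n}. 4 * pi * exp (- 2 * (s t - \<mu> l) * ln (2 * pi)) * M l (s t))"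
      unfolding Gmum_def M_def
    proof (intro prod.cong refl Gk_eq_mellin)
      fix l assume "l \<in> {1..n}"
      then show "0 < Re (s t - \<mu> l)" "Re (s t - \<mu> l) < 1/4" using \<sigma>[of l] by (auto simp: s_def)
    qed
    also have "\<dots> = (4 * pi) ^ n * exp (\<Sum>l\<in>{1..n}. - 2 * (s t - \<mu> l) * ln (2 * pi)) * (\<Prod>l\<in>{1..n}. M l (s t))"
      by (simp add: prod.distrib exp_sum power_mult_distrib)
    also have "(\<Sum>l\<in>{1..n}. - 2 * (s t - \<mu> l) * ln (2 * pi)) = - 2 * s t * of_nat n * of_real (ln (2 * pi))"
    proof -
      have "(\<Sum>l\<in>{1..n}. - 2 * (s t - \<mu> l) * ln (2 * pi)) = - 2 * of_real (ln (2 * pi)) * (\<Sum>l\<in>{1..n}. s t - \<mu> l)"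
        unfolding sum_distrib_left by (intro sum.cong refl) (simp add: algebra_simps)
      also have "(\<Sum>l\<in>{1..n}. s t - \<mu> l) = of_nat n * s t" using \<mu> by (simp add: sum_subtractf n_def)
      finally show ?thesis by (simp only: mult_ac)
    qed
    finally have "Gmum n \<mu> m (s t) = (4 * pi) ^ n * exp (- 2 * s t * of_nat n * of_real (ln (2 * pi))) * (\<Prod>l\<in>{1..n}. M l (s t))" .
    moreover have "of_real x powr (- 2 * s t) = exp (- 2 * s t * of_real (ln x))"
      using x by (simp add: powr_def Ln_of_real mult_ac)
    moreover have "exp (- 2 * s t * of_nat n * of_real (ln (2 * pi))) * exp (- 2 * s t * of_real (ln x)) = exp (- 2 * s t * of_nat n * of_real \<Lambda>)"
    proof -
      have "complex_of_nat n * of_real \<Lambda> = of_nat n * of_real (ln (2 * pi)) + of_real (ln x)"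
        using arg_cong[OF \<Lambda>, of complex_of_real] by simp
      then have "- 2 * s t * of_nat n * of_real (ln (2 * pi)) + (- 2 * s t * of_real (ln x)) = - 2 * s t * of_nat n * of_real \<Lambda>"
        by (simp only: mult.assoc distrib_left)
      then show ?thesis by (simp only: exp_add[symmetric])
    qed
    ultimately show ?thesis unfolding F_def by (simp only: mult_ac)
  qed
  \<comment> \<open>Of the exponent 2 \<nu>_l - 1 only 2 \<mu>_l - 2 \<sigma> - 1 is kept here,
    which makes \<open>\<alpha> l\<close> integrable by itself; the remaining 2 (\<sigma> - \<mu>_n)
    is supplied by \<open>g\<close> at \<open>L y\<close>.\<close>
  define \<alpha> where "\<alpha> l y = indicat_real {0<..} y *\<^sub>R (of_real y powr (2 * \<mu> l - 2 * of_real \<sigma> - 1) * bes (m l) (\<xi> * inverse y))" for l y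
  define A where "A y = (\<Prod>l\<in>{1..d}. \<alpha> l (y l))" for y
  \<comment> \<open>On the positive orthant, the logarithm of the last argument \<xi> y_1 ...
    y_d.\<close>
  define L where "L y = \<Lambda> + (\<Sum>l\<in>{1..d}. ln (y l))" for y :: "nat \<Rightarrow> real"
  define g where "g w = bes (m n) (exp w) * exp (2 * (of_real \<sigma> - \<mu> n) * of_real w)" for w :: real
  define c where "c = exp (2 * (of_real \<sigma> - \<mu> n) * of_real \<Lambda>)"
  have \<alpha>m[measurable]: "\<alpha> l \<in> borel_measurable borel" for l unfolding \<alpha>_def by measurable
  have sub: "integrable lborel (\<lambda>y. \<alpha> l y * iexp (- (t * ln y)))"
    "(LINT y|lborel. \<alpha> l y * iexp (- (t * ln y))) = exp (- 2 * (s t - \<mu> l) * of_real \<Lambda>) * M l (s t)" if l: "l \<in> {1..d}" for l t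
  proof -
    define z where "z = s t - \<mu> l"
    have z: "0 < Re z" "Re z < 1/4" using \<sigma>[of l] l by (auto simp: z_def s_def n_def)
    define h where "h y = complex_of_real y powr (2 * \<mu> l - 2 * of_real \<sigma> - 1) * bes (m l) (\<xi> * inverse y) * iexp (- (t * ln y))" for y
    have [measurable]: "h \<in> borel_measurable borel" unfolding h_def by measurable
    define v where "v w = bes (m l) (exp w) * exp (2 * z * of_real w)" for w :: real
    have vi: "integrable lborel v" unfolding v_def by (rule bes_exp_integrable[OF z])
    \<comment> \<open>With y = exp u the argument \<xi> / y is exp(\<Lambda> - u), so a reflection
      turns the integral into \<open>M\<close>, up to the factor exp(-2 z \<Lambda>).\<close>
    have eq: "exp u *\<^sub>R h (exp u) = exp (- 2 * z * of_real \<Lambda>) * v (\<Lambda> + (-1) * u)" for u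
    proof -
      have r1: "\<xi> * inverse (exp u) = exp (\<Lambda> + (-1) * u)" by (simp add: e\<Lambda>[symmetric] exp_diff divide_inverse)
      have r2: "complex_of_real (exp u) powr (2 * \<mu> l - 2 * of_real \<sigma> - 1) = exp ((2 * \<mu> l - 2 * of_real \<sigma> - 1) * of_real u)"
        by (simp add: powr_def Ln_of_real del: of_real_exp)
      have r3: "of_real u + (2 * \<mu> l - 2 * of_real \<sigma> - 1) * of_real u + \<i> * of_real (- (t * ln (exp u))) = - 2 * z * of_real \<Lambda> + 2 * z * of_real (\<Lambda> + (-1) * u)"
      proof -
        have zz: "2 * z = 2 * of_real \<sigma> + \<i> * of_real t - 2 * \<mu> l" using s2[of t] by (simp add: z_def)
        have *: "- 2 * z * of_real \<Lambda> + 2 * z * of_real (\<Lambda> + (-1) * u) = - (2 * z) * of_real u"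
          by (simp add: algebra_simps)
        show ?thesis unfolding * unfolding zz by (simp add: algebra_simps)
      qed
      have r4: "exp (of_real u) * exp ((2 * \<mu> l - 2 * of_real \<sigma> - 1) * of_real u) * iexp (- (t * ln (exp u)))
          = exp (- 2 * z * of_real \<Lambda>) * exp (2 * z * of_real (\<Lambda> + (-1) * u))"
        unfolding exp_add[symmetric] r3 ..
      have alg: "p * (q * b * r) = v * (b * w)" if "p * q * r = v * w" for b p q r v w :: complex
        using that by (simp only: mult_ac)
      show ?thesis
        unfolding h_def v_def r1 r2 unfolding scaleR_conv_of_real exp_of_real[symmetric] by (rule alg[OF r4])
    qed
    have "set_integrable lborel {0<..} h"
      unfolding exp_substitution(1)[OF \<open>h \<in> borel_measurable borel\<close>] eq
      by (intro integrable_mult_right lborel_integrable_real_affine vi) auto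
    moreover have he: "\<alpha> l y * iexp (- (t * ln y)) = indicat_real {0<..} y *\<^sub>R h y" for y
      by (simp add: \<alpha>_def h_def)
    ultimately show "integrable lborel (\<lambda>y. \<alpha> l y * iexp (- (t * ln y)))"
      unfolding he set_integrable_def by simp
    have "(LINT y|lborel. \<alpha> l y * iexp (- (t * ln y))) = (LINT u|lborel. exp u *\<^sub>R h (exp u))"
      unfolding he using exp_substitution(2)[of h] by (simp add: set_lebesgue_integral_def)
    also have "\<dots> = exp (- 2 * z * of_real \<Lambda>) * (LINT u|lborel. v (\<Lambda> + (-1) * u))"
      unfolding eq integral_mult_right_zero ..
    also have "(LINT u|lborel. v (\<Lambda> + (-1) * u)) = (LINT w|lborel. v w)"
      using lborel_integral_real_affine[of "-1" v \<Lambda>] by simp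
    finally show "(LINT y|lborel. \<alpha> l y * iexp (- (t * ln y))) = exp (- 2 * (s t - \<mu> l) * of_real \<Lambda>) * M l (s t)"
      by (simp add: M_def v_def z_def)
  qed
  have Ahat: "(LINT y|Rmeas d. A y * iexp (- (t * L y))) = iexp (- (t * \<Lambda>)) * (\<Prod>l\<in>{1..d}. exp (- 2 * (s t - \<mu> l) * of_real \<Lambda>) * M l (s t))" for t
  proof -
    have "A y * iexp (- (t * L y)) = iexp (- (t * \<Lambda>)) * (\<Prod>l\<in>{1..d}. \<alpha> l (y l) * iexp (- (t * ln (y l))))" for y
    proof -
      have "\<i> * complex_of_real (- (t * L y)) = \<i> * of_real (- (t * \<Lambda>)) + (\<Sum>l\<in>{1..d}. \<i> * of_real (- (t * ln (y l))))"
        by (simp add: L_def algebra_simps sum_distrib_left sum_negf)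
      then have "iexp (- (t * L y)) = iexp (- (t * \<Lambda>)) * (\<Prod>l\<in>{1..d}. iexp (- (t * ln (y l))))"
        by (simp only: exp_add exp_sum[OF finite_atLeastAtMost])
      then show ?thesis by (simp only: A_def prod.distrib mult_ac)
    qed
    then have "(LINT y|Rmeas d. A y * iexp (- (t * L y))) = iexp (- (t * \<Lambda>)) * (LINT y|Rmeas d. (\<Prod>l\<in>{1..d}. \<alpha> l (y l) * iexp (- (t * ln (y l)))))"
      by (simp only: integral_mult_right_zero)
    also have "(LINT y|Rmeas d. (\<Prod>l\<in>{1..d}. \<alpha> l (y l) * iexp (- (t * ln (y l))))) = (\<Prod>l\<in>{1..d}. LINT y|lborel. \<alpha> l y * iexp (- (t * ln y)))"
      unfolding Rmeas_def by (rule product_integral_prod[OF finite_atLeastAtMost sub(1)])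
    also have "\<dots> = (\<Prod>l\<in>{1..d}. exp (- 2 * (s t - \<mu> l) * of_real \<Lambda>) * M l (s t))"
      by (intro prod.cong refl sub(2))
    finally show ?thesis .
  qed
  have ghat: "(LINT w|lborel. g w * iexp (t * w)) = M n (s t)" for t
    unfolding M_def
  proof (intro Bochner_Integration.integral_cong refl)
    fix w
    have "2 * (s t - \<mu> n) = 2 * (of_real \<sigma> - \<mu> n) + \<i> * of_real t" using s2[of t] by (simp add: algebra_simps)
    note r = this
    show "g w * iexp (t * w) = bes (m n) (exp w) * exp (2 * (s t - \<mu> n) * of_real w)"
    proof -
      have "2 * (of_real \<sigma> - \<mu> n) * of_real w + \<i> * of_real (t * w) = 2 * (s t - \<mu> n) * of_real w"
        unfolding r by (simp add: algebra_simps)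
      then show ?thesis
        unfolding g_def by (subst mult.assoc) (simp only: exp_add[symmetric])
    qed
  qed
  \<comment> \<open>The exponentials in \<Lambda> are those of \<open>F\<close> up to the constant
    \<open>c\<close>, again because the \<mu>_l sum to 0.\<close>
  have P: "(LINT w|lborel. g w * iexp (t * w)) * (LINT y|Rmeas d. A y * iexp (- (t * L y))) = c / (4 * pi) ^ n * F (s t)" for t
  proof -
    have "iexp (- (t * \<Lambda>)) * (\<Prod>l\<in>{1..d}. exp (- 2 * (s t - \<mu> l) * of_real \<Lambda>)) = c * exp (- 2 * s t * of_nat n * of_real \<Lambda>)"
    proof -
      have "(\<Prod>l\<in>{1..d}. exp (- 2 * (s t - \<mu> l) * of_real \<Lambda>)) = exp (\<Sum>l\<in>{1..d}. - 2 * (s t - \<mu> l) * of_real \<Lambda>)"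
        by (simp add: exp_sum)
      also have "(\<Sum>l\<in>{1..d}. - 2 * (s t - \<mu> l) * of_real \<Lambda>) = - 2 * of_real \<Lambda> * (\<Sum>l\<in>{1..d}. s t - \<mu> l)"
        unfolding sum_distrib_left by (intro sum.cong refl) (simp add: algebra_simps)
      also have "(\<Sum>l\<in>{1..d}. s t - \<mu> l) = of_nat d * s t + \<mu> n"
      proof -
        have "(\<Sum>l\<in>{1..d}. \<mu> l) = - \<mu> n" using \<mu> splits[of \<mu>] by (simp add: n_def eq_neg_iff_add_eq_0)
        then show ?thesis by (simp add: sum_subtractf)
      qed
      finally have 1: "(\<Prod>l\<in>{1..d}. exp (- 2 * (s t - \<mu> l) * of_real \<Lambda>)) = exp (- 2 * of_real \<Lambda> * (of_nat d * s t + \<mu> n))" .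
      have "\<i> * of_real (- (t * \<Lambda>)) + (- 2 * of_real \<Lambda> * (of_nat d * s t + \<mu> n)) = 2 * (of_real \<sigma> - \<mu> n) * of_real \<Lambda> + (- 2 * s t * of_nat n * of_real \<Lambda>)"
      proof -
        have "\<i> * of_real t = 2 * s t - 2 * of_real \<sigma>" using s2[of t] by simp
        then have "\<i> * of_real (- (t * \<Lambda>)) = - (2 * s t - 2 * of_real \<sigma>) * of_real \<Lambda>" by (metis mult.assoc mult_minus_left mult_minus_right of_real_minus of_real_mult)
        then show ?thesis by (simp add: n_def algebra_simps)
      qed
      then show ?thesis unfolding 1 c_def exp_add[symmetric] by (simp only:)
    qed
    then show ?thesis unfolding ghat Ahat Fs split prod.distrib
      by (simp add: field_simps) 
  qed
  have gc: "continuous_on UNIV g" unfolding g_def by (intro continuous_intros)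
  have \<sigma>n: "0 < Re (of_real \<sigma> - \<mu> n)" "Re (of_real \<sigma> - \<mu> n) < 1/4" using \<sigma>[of n] n1 by auto
  have gi: "integrable lborel g" unfolding g_def by (rule bes_exp_integrable[OF \<sigma>n])
  \<comment> \<open>For w > 0 the growth, at most exp(w / 2), is absorbed by the decay of the Bessel
    function at exp w.\<close>
  have gb: "norm (g w) \<le> 5 * (1 + \<bar>of_int (m n)\<bar>)" for w
  proof (cases "w \<le> 0")
    case True
    then have "norm (exp (2 * (of_real \<sigma> - \<mu> n) * of_real w)) \<le> 1"
      using \<sigma>n by (auto simp: mult_nonneg_nonpos)
    then have "norm (g w) \<le> 1 * 1" unfolding g_def norm_mult by (intro mult_mono norm_bes_le_1) auto
    then show ?thesis by (simp add: add_increasing2)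
  next
    case False
    have sq: "sqrt (exp w) = exp (w / 2)"
      by (rule real_sqrt_unique) (simp_all add: power2_eq_square flip: exp_add)
    have "norm (exp (2 * (of_real \<sigma> - \<mu> n) * of_real w)) \<le> exp (w / 2)"
      using False \<sigma>n by simp
    then have "norm (g w) \<le> (5 * (1 + \<bar>of_int (m n)\<bar>) / exp (w / 2)) * exp (w / 2)"
      unfolding g_def norm_mult using norm_bes_decay[of "exp w" "m n"] by (intro mult_mono) (auto simp: sq)
    then show ?thesis by simp
  qed
  have \<alpha>i: "integrable lborel (\<alpha> l)" if "l \<in> {1..d}" for l
    using sub(1)[OF that, of 0] by simp
  have Ai: "integrable (Rmeas d) A"
    unfolding Rmeas_def A_def by (intro product_integrable_prod \<alpha>i) auto
  have Lm: "L \<in> borel_measurable (Rmeas d)"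
  proof -
    have "(\<lambda>y. \<Sum>l\<in>{1..d}. ln (y l)) \<in> borel_measurable (Rmeas d)"
    proof (rule borel_measurable_sum)
      fix l assume "l \<in> {1..d}"
      then show "(\<lambda>y. ln (y l)) \<in> borel_measurable (Rmeas d)"
        by (rule measurable_Rmeas_component) simp
    qed
    then show ?thesis unfolding L_def by (intro borel_measurable_add) auto
  qed
  have sf: "sigma_finite_measure (Rmeas d)"
    unfolding Rmeas_def by (rule sigma_finite) simp
  have Fsi: "integrable lborel (\<lambda>t. F (s t))"
    unfolding s_def using lborel_integrable_real_affine[OF Fi, of "1/2" 0] by simp
  have "(LINT t|lborel. c / (4 * pi) ^ n * F (s t)) = 2 * pi * (LINT y|Rmeas d. A y * g (L y))"
    using fourier_inversion_at_function[OF sf Ai Lm gi gc gb] Fsi unfolding P by simp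
  moreover have "(LINT y|Rmeas d. A y * g (L y)) = c * (LINT y|Rmeas d. bconv d \<nu> m \<xi> y)"
    unfolding integral_mult_right_zero[symmetric]
  proof (intro Bochner_Integration.integral_cong refl)
    fix y
    show "A y * g (L y) = c * bconv d \<nu> m \<xi> y"
    proof (cases "\<forall>l\<in>{1..d}. y l > 0")
      case False
      then obtain l where l: "l \<in> {1..d}" "\<not> y l > 0" by blast
      then have "A y = 0" unfolding A_def \<alpha>_def by (subst prod_zero) (auto intro!: bexI[of _ l])
      moreover have "bconv d \<nu> m \<xi> y = 0" using l unfolding bconv_def by (subst prod_zero) (auto intro!: bexI[of _ l])
      ultimately show ?thesis by simp
    next
      case True
      then have y: "y l > 0" if "l \<in> {1..d}" for l using that by blast
      have "exp (L y) = \<xi> * (\<Prod>l\<in>{1..d}. y l)"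
      proof -
        have "exp (\<Sum>l\<in>{1..d}. ln (y l)) = (\<Prod>l\<in>{1..d}. y l)"
          unfolding exp_sum[OF finite_atLeastAtMost] using y by (intro prod.cong refl) auto
        then show ?thesis by (simp add: L_def exp_add e\<Lambda>)
      qed
      moreover have "exp (2 * (of_real \<sigma> - \<mu> n) * of_real (L y)) = c * (\<Prod>l\<in>{1..d}. of_real (y l) powr (2 * (of_real \<sigma> - \<mu> n)))"
      proof -
        have "(\<Prod>l\<in>{1..d}. of_real (y l) powr (2 * (of_real \<sigma> - \<mu> n))) = (\<Prod>l\<in>{1..d}. exp (2 * (of_real \<sigma> - \<mu> n) * of_real (ln (y l))))"
        proof (intro prod.cong refl)
          fix l assume "l \<in> {1..d}"
          then show "of_real (y l) powr (2 * (of_real \<sigma> - \<mu> n)) = exp (2 * (of_real \<sigma> - \<mu> n) * of_real (ln (y l)))"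
            using y[of l] by (auto simp: powr_def Ln_of_real)
        qed
        moreover have "2 * (of_real \<sigma> - \<mu> n) * of_real (L y) = 2 * (of_real \<sigma> - \<mu> n) * of_real \<Lambda> + (\<Sum>l\<in>{1..d}. 2 * (of_real \<sigma> - \<mu> n) * of_real (ln (y l)))"
          by (simp add: L_def distrib_left sum_distrib_left)
        ultimately show ?thesis
          by (simp only: c_def exp_add exp_sum[OF finite_atLeastAtMost])
      qed
      moreover have "(\<Prod>l\<in>{1..d}. \<alpha> l (y l)) * (\<Prod>l\<in>{1..d}. of_real (y l) powr (2 * (of_real \<sigma> - \<mu> n))) =
        (\<Prod>l\<in>{1..d}. indicat_real {0<..} (y l) *\<^sub>R (of_real (y l) powr (2 * \<nu> l - 1) * bes (m l) (\<xi> * inverse (y l))))"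
        unfolding prod.distrib[symmetric]
      proof (intro prod.cong refl)
        fix l assume "l \<in> {1..d}"
        have "2 * \<nu> l - 1 = (2 * \<mu> l - 2 * of_real \<sigma> - 1) + 2 * (of_real \<sigma> - \<mu> n)" by (simp add: \<nu> n_def)
        then have "complex_of_real (y l) powr (2 * \<nu> l - 1) = of_real (y l) powr (2 * \<mu> l - 2 * of_real \<sigma> - 1) * of_real (y l) powr (2 * (of_real \<sigma> - \<mu> n))"
          by (simp only: powr_add)
        then show "\<alpha> l (y l) * of_real (y l) powr (2 * (of_real \<sigma> - \<mu> n)) = indicat_real {0<..} (y l) *\<^sub>R (of_real (y l) powr (2 * \<nu> l - 1) * bes (m l) (\<xi> * inverse (y l)))"
          by (simp add: \<alpha>_def mult_ac)
      qed
      ultimately show ?thesis unfolding A_def g_def bconv_def n_def[symmetric] by (simp add: mult_ac)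
    qed
  qed
  moreover have "(LINT t|lborel. F (Complex \<sigma> t)) = 1/2 * (LINT t|lborel. F (s t))"
    unfolding s_def using lborel_integral_real_affine[of "1/2" "\<lambda>t. F (Complex \<sigma> t)" 0] by (simp add: scaleR_conv_of_real)
  moreover have "c \<noteq> 0" by (simp add: c_def)
  ultimately have "(LINT t|lborel. F (Complex \<sigma> t)) = (4 * pi) ^ n * pi * (LINT y|Rmeas d. bconv d \<nu> m \<xi> y)"
    by (simp add: field_simps)
  then show ?thesis using j by (simp add: n_def)
qed

theorem theorem6p2:
  fixes n :: nat and \<mu> :: "nat \<Rightarrow> complex" and m :: "nat \<Rightarrow> int"
    and \<nu> :: "nat \<Rightarrow> complex" and k :: "nat \<Rightarrow> int" and d :: nat
  assumes "n \<ge> 2"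
    and "d = n - 1"
    and "(\<Sum>l\<in>{1..d+1}. \<mu> l) = 0"
    and "\<And>l. \<nu> l = \<mu> l - \<mu> (d+1)"
    and "\<And>l. k l = m l - m (d+1)"
    and "\<exists>a\<in>{-1/2..0::real}. \<forall>l\<in>{1..d}. -1/2 < 2 * Re (\<nu> l) + a \<and> 2 * Re (\<nu> l) + a < 0"
  shows "(\<forall>x>0. \<forall>\<phi>::real.
            set_integrable (Rmeas d) (Rplus d) (\<lambda>y. p2nu d \<nu> y * Jk d k y x \<phi>))
       \<and> (\<forall>x>0. \<forall>\<phi>::real.
            Jmum (d+1) \<mu> m (of_real x * exp (\<i> * of_real \<phi>))
              = exp (- \<i> * of_int (m (d+1)) * of_real \<phi>)
                * Jnuk d \<nu> k (2 * pi * x powr (1 / real (d+1))) \<phi>)"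
proof (intro conjI allI impI)
  obtain a where a: "a \<in> {-1/2..0}" "\<And>l. l \<in> {1..d} \<Longrightarrow> -1/2 < 2 * Re (\<nu> l) + a \<and> 2 * Re (\<nu> l) + a < 0"
    using assms(6) by blast
  fix x \<phi> :: real assume x: "x > 0"
  show "set_integrable (Rmeas d) (Rplus d) (\<lambda>y. p2nu d \<nu> y * Jk d k y x \<phi>)"
    by (rule Jnuk_expansion(1)[where d=d and k=k and m=m, OF x a assms(5)])
  have d: "d \<ge> 1" using assms(1,2) by simp
  define \<xi> where "\<xi> = 2 * pi * x powr (1 / real (d + 1))"
  have \<xi>: "\<xi> > 0" using x by (simp add: \<xi>_def)
  define z where "z = of_real x * exp (\<i> * of_real \<phi>)"
  have cz: "cmod z = x" using x by (simp add: z_def norm_mult)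
  have zp: "(z / of_real (cmod z)) powi q = exp (\<i> * of_real (of_int q * \<phi>))" for q
    using x unfolding cz by (simp add: z_def exp_power_int mult_ac)
  define E where "E = exp (- \<i> * of_int (m (d+1)) * of_real \<phi>)"
  define H where "H q = (LINT y|Rmeas d. bconv d \<nu> (\<lambda>l. m l - m (d + 1) + q) \<xi> y)" for q
  \<comment> \<open>q = j + m_(d+1) turns the orders m_l - m_(d+1) + q into m_l + j, as in
    \<open>Jmum\<close>, and accounts for the phase exp(-i m_(d+1) \<phi>).\<close>
  have bij: "bij_betw (\<lambda>j. j + m (d + 1)) UNIV UNIV"
    by (rule bij_betwI[of _ _ _ "\<lambda>q. q - m (d + 1)"]) auto
  have "((\<lambda>q. (4 * pi) ^ d * exp (\<i> * of_real (of_int q * \<phi>)) * H q) has_sum Jnuk d \<nu> k \<xi> \<phi>) UNIV"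
    unfolding H_def by (rule Jnuk_expansion(2)[where d=d and k=k and m=m, OF \<xi> a assms(5)])
  then have "((\<lambda>j. (4 * pi) ^ d * exp (\<i> * of_real (of_int (j + m (d + 1)) * \<phi>)) * H (j + m (d + 1))) has_sum Jnuk d \<nu> k \<xi> \<phi>) UNIV"
    by (subst has_sum_reindex_bij_betw[OF bij, of "\<lambda>q. (4 * pi) ^ d * exp (\<i> * of_real (of_int q * \<phi>)) * H q"])
  then have "((\<lambda>j. 2 * pi * E * ((4 * pi) ^ d * exp (\<i> * of_real (of_int (j + m (d + 1)) * \<phi>)) * H (j + m (d + 1)))) has_sum 2 * pi * E * Jnuk d \<nu> k \<xi> \<phi>) UNIV"
    by (rule has_sum_cmult_right)
  \<comment> \<open>2 pi (4 pi)^d is the constant (4 pi)^(d + 1) / 2 of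
    \<open>jmum_eq_bconv\<close>.\<close>
  moreover have "2 * pi * E * ((4 * pi) ^ d * exp (\<i> * of_real (of_int (j + m (d + 1)) * \<phi>)) * H (j + m (d + 1))) =
      jmum (d + 1) \<mu> (\<lambda>l. m l + j) (cmod z) * (z / of_real (cmod z)) powi j" for j
  proof -
    have "jmum (d + 1) \<mu> (\<lambda>l. m l + j) x = (4 * pi) ^ (d + 1) / 2 * (LINT y|Rmeas d. bconv d \<nu> (\<lambda>l. m l + j) \<xi> y)"
      by (rule jmum_eq_bconv[OF d assms(3,4) a x \<xi>_def])
    also have "(LINT y|Rmeas d. bconv d \<nu> (\<lambda>l. m l + j) \<xi> y) = H (j + m (d + 1))"
      by (simp add: H_def)
    finally have 1: "jmum (d + 1) \<mu> (\<lambda>l. m l + j) x = 2 * pi * (4 * pi) ^ d * H (j + m (d + 1))" by simp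
    have "E * exp (\<i> * of_real (of_int (j + m (d + 1)) * \<phi>)) = exp (\<i> * of_real (of_int j * \<phi>))"
      by (simp add: E_def algebra_simps flip: exp_add)
    then show ?thesis unfolding zp unfolding cz 1 by (simp add: mult_ac)
  qed
  ultimately have "((\<lambda>j. jmum (d + 1) \<mu> (\<lambda>l. m l + j) (cmod z) * (z / of_real (cmod z)) powi j) has_sum 2 * pi * E * Jnuk d \<nu> k \<xi> \<phi>) UNIV"
    by (simp only:)
  then have "Jmum (d + 1) \<mu> m z = E * Jnuk d \<nu> k \<xi> \<phi>"
    unfolding Jmum_def by (subst infsumI) auto
  then show "Jmum (d+1) \<mu> m (of_real x * exp (\<i> * of_real \<phi>))
              = exp (- \<i> * of_int (m (d+1)) * of_real \<phi>)
                * Jnuk d \<nu> k (2 * pi * x powr (1 / real (d+1))) \<phi>"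
    by (simp only: z_def E_def \<xi>_def)
qed

end
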